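(* Let $a\in L^\infty(0,1)$ satisfy $\int_0^1a(x)\,dx<0$ and suppose there is $z\in(0,1)$ such that $a(x)>0$ for a.e. $x\in(0,z)$ and $a(x)<0$ for a.e. $x\in(z,1)$. Let $f\in\mathcal C(\mathbb R)$ satisfy $f(0)=0$, $f(u)>0$ for $u>0$, and, for some constants $h>0$, $p\in(0,1)$ and $q\in(0,1)$, $$\lim_{u\to0^+}\frac{f(u)}{u^p}=1,\qquad \lim_{u\to\infty}\frac{f(u)}{u^{-q}}=h.$$ Then there is a component $\mathfrak C_{r,0}^+$ of $\mathcal S_r^+$ such that $[0,\lambda_* )\subseteq\mathcal P_\lambda(\mathfrak C_{r,0}^+)$ for some $\lambda_*>0$, and $$\lim_{\lambda\to0}\|u_\lambda\|_{\mathcal C^1[0,1]}=0$$ along the pairs $(\lambda,u_\lambda)\in\mathfrak C_{r,0}^+$ (where $\lambda\to0$ through values $\lambda>0$, and regardless of the choice of $u_\lambda$ for each $\lambda$).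
   Context: Consider the problem $$-\left(\frac{u'}{\sqrt{1+(u')^2}}\right)'=\lambda a(x)f(u),\quad 0<x<1,\qquad u'(0)=u'(1)=0.$$ A regular solution is a function $u\in W^{2,1}(0,1)$ satisfying the equation a.e. in $(0,1)$ and the boundary conditions; it is positive if $\min u\ge0$ and $\max u>0$. Let $\lambda_0>0$ be the unique positive eigenvalue of $-\varphi''=\lambda a(x)\varphi$, $\varphi'(0)=\varphi'(1)=0$, having a strictly positive eigenfunction. $\mathcal S_r^+$ is the set of pairs $(\lambda,u)\in[0,\infty)\times\mathcal C^1[0,1]$ such that $u$ is a positive regular solution for the parameter value $\lambda$, together with $(0,0)$ and $(\lambda_0,0)$. A component of $\mathcal S_r^+$ is a closed connected subset of $\mathcal S_r^+$, for the topology of $\mathbb R\times\mathcal C^1[0,1]$, which is maximal for inclusion. $\mathcal P_\lambda$ is the projection $\mathcal P_\lambda(\lambda,u)=\lambda$. *)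

theory Defs
  imports "HOL-Analysis.Analysis"
begin

section \<open>The normed space of continuously differentiable functions on the unit interval\<close>

text \<open>The derivative is taken within \<open>[0,1]\<close>, i.e. it is one-sided at the endpoints.\<close>

definition deriv01 :: "(real \<Rightarrow> real) \<Rightarrow> real \<Rightarrow> real" where
  "deriv01 u x = vector_derivative u (at x within {0..1})"

lemma deriv01_works:
  assumes "u differentiable_on {0..1}" "x \<in> {0..1}"
  shows "(u has_vector_derivative deriv01 u x) (at x within {0..1})"
  using assms unfolding deriv01_def differentiable_on_def
  by (simp add: vector_derivative_works[symmetric])

lemma deriv01_eqI:
  assumes "(u has_vector_derivative d) (at x within {0..1})" "x \<in> {0..1}"
  shows "deriv01 u x = d"
  using assms unfolding deriv01_def by (intro vector_derivative_within_closed_interval) auto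

text \<open>Elements are represented by functions that vanish off \<open>[0,1]\<close>, so that equality in the type is
  equality on \<open>[0,1]\<close>; the representative need not be continuous on the whole line.\<close>

definition C1_rep :: "(real \<Rightarrow> real) set" where
  "C1_rep = {u. (\<forall>x. x \<notin> {0..1} \<longrightarrow> u x = 0) \<and>
     u differentiable_on {0..1} \<and> continuous_on {0..1} (deriv01 u)}"

lemma C1_repI:
  assumes "\<And>x. x \<notin> {0..1} \<Longrightarrow> u x = 0"
    and "\<And>x. x \<in> {0..1} \<Longrightarrow> (u has_vector_derivative d x) (at x within {0..1})"
    and "continuous_on {0..1} d"
  shows "u \<in> C1_rep"
proof -
  have "u differentiable_on {0..1}"
    using assms(2) unfolding differentiable_on_def by (blast intro: differentiableI_vector)
  moreover have "continuous_on {0..1} (deriv01 u)"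
    using assms(3) by (rule continuous_on_eq) (simp add: deriv01_eqI[OF assms(2)])
  ultimately show ?thesis
    using assms(1) by (auto simp: C1_rep_def)
qed

lemma C1_rep_zero: "(\<lambda>_. 0) \<in> C1_rep"
  by (rule C1_repI[where d = "\<lambda>_. 0"]) auto

typedef C1 = C1_rep morphisms C1_fun Abs_C1
  using C1_rep_zero by blast

definition C1_deriv :: "C1 \<Rightarrow> real \<Rightarrow> real" where
  "C1_deriv u = deriv01 (C1_fun u)"

lemma C1_outside: "x \<notin> {0..1} \<Longrightarrow> C1_fun u x = 0"
  using C1_fun[of u] by (auto simp: C1_rep_def)

lemma C1_has_deriv:
  "x \<in> {0..1} \<Longrightarrow> (C1_fun u has_vector_derivative C1_deriv u x) (at x within {0..1})"
  using C1_fun[of u] by (auto simp: C1_rep_def C1_deriv_def intro: deriv01_works)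

lemma C1_deriv_continuous: "continuous_on {0..1} (C1_deriv u)"
  using C1_fun[of u] by (auto simp: C1_rep_def C1_deriv_def)

lemma C1_fun_continuous: "continuous_on {0..1} (C1_fun u)"
  using C1_fun[of u] by (auto simp: C1_rep_def intro: differentiable_imp_continuous_on)

lemma C1_eqI: "(\<And>x. x \<in> {0..1} \<Longrightarrow> C1_fun u x = C1_fun v x) \<Longrightarrow> u = v"
  by (metis C1_fun_inject C1_outside ext)

instantiation C1 :: real_vector
begin

definition "0 = Abs_C1 (\<lambda>_. 0)"
definition "u + v = Abs_C1 (\<lambda>x. C1_fun u x + C1_fun v x)"
definition "u - v = Abs_C1 (\<lambda>x. C1_fun u x - C1_fun v x)"
definition "- u = Abs_C1 (\<lambda>x. - C1_fun u x)" for u :: C1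
definition "c *\<^sub>R u = Abs_C1 (\<lambda>x. c * C1_fun u x)"

lemma C1_fun_zero: "C1_fun 0 = (\<lambda>_. 0)"
  unfolding zero_C1_def by (simp add: Abs_C1_inverse C1_rep_zero)

lemma C1_fun_add: "C1_fun (u + v) = (\<lambda>x. C1_fun u x + C1_fun v x)"
  unfolding plus_C1_def
  by (intro Abs_C1_inverse C1_repI[where d = "\<lambda>x. C1_deriv u x + C1_deriv v x"]
      has_vector_derivative_add C1_has_deriv continuous_intros C1_deriv_continuous)
     (auto simp: C1_outside)

lemma C1_fun_diff: "C1_fun (u - v) = (\<lambda>x. C1_fun u x - C1_fun v x)"
  unfolding minus_C1_def
  by (intro Abs_C1_inverse C1_repI[where d = "\<lambda>x. C1_deriv u x - C1_deriv v x"]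
      has_vector_derivative_diff C1_has_deriv continuous_intros C1_deriv_continuous)
     (auto simp: C1_outside)

lemma C1_fun_minus: "C1_fun (- u) = (\<lambda>x. - C1_fun u x)"
  unfolding uminus_C1_def
  by (intro Abs_C1_inverse C1_repI[where d = "\<lambda>x. - C1_deriv u x"]
      has_vector_derivative_minus C1_has_deriv continuous_intros C1_deriv_continuous)
     (auto simp: C1_outside)

lemma C1_fun_scaleR: "C1_fun (c *\<^sub>R u) = (\<lambda>x. c * C1_fun u x)"
  unfolding scaleR_C1_def
  by (intro Abs_C1_inverse C1_repI[where d = "\<lambda>x. c * C1_deriv u x"]
      has_vector_derivative_mult_right C1_has_deriv continuous_intros C1_deriv_continuous)
     (auto simp: C1_outside)

lemmas C1_fun_simps = C1_fun_zero C1_fun_add C1_fun_diff C1_fun_minus C1_fun_scaleR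

instance
  by standard (rule C1_eqI, simp add: C1_fun_simps algebra_simps)+

end

lemma C1_deriv_add: "x \<in> {0..1} \<Longrightarrow> C1_deriv (u + v) x = C1_deriv u x + C1_deriv v x"
  unfolding C1_deriv_def[of "u + v"] C1_fun_add
  by (intro deriv01_eqI has_vector_derivative_add C1_has_deriv)

lemma C1_deriv_scaleR: "x \<in> {0..1} \<Longrightarrow> C1_deriv (c *\<^sub>R u) x = c * C1_deriv u x"
  unfolding C1_deriv_def[of "c *\<^sub>R u"] C1_fun_scaleR
  by (intro deriv01_eqI has_vector_derivative_mult_right C1_has_deriv)

definition sup01 :: "(real \<Rightarrow> real) \<Rightarrow> real" where
  "sup01 g = (SUP x\<in>{0..1}. \<bar>g x\<bar>)"

lemma sup01_upper:
  assumes "continuous_on {0..1} g" "x \<in> {0..1}"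
  shows "\<bar>g x\<bar> \<le> sup01 g"
  unfolding sup01_def
proof (rule cSUP_upper[OF assms(2)])
  have "compact ((\<lambda>x. \<bar>g x\<bar>) ` {0..1})"
    by (intro compact_continuous_image continuous_intros assms) auto
  then show "bdd_above ((\<lambda>x. \<bar>g x\<bar>) ` {0..1})"
    by (intro bounded_imp_bdd_above compact_imp_bounded)
qed

lemma sup01_least: "(\<And>x. x \<in> {0..1} \<Longrightarrow> \<bar>g x\<bar> \<le> B) \<Longrightarrow> sup01 g \<le> B"
  unfolding sup01_def by (rule cSUP_least) auto

lemma sup01_nonneg: "continuous_on {0..1} g \<Longrightarrow> 0 \<le> sup01 g"
  by (rule order_trans[OF abs_ge_zero sup01_upper[where x = 0]]) auto

lemma sup01_triangle:
  assumes "continuous_on {0..1} g" "continuous_on {0..1} h"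
    and "\<And>x. x \<in> {0..1} \<Longrightarrow> k x = g x + h x"
  shows "sup01 k \<le> sup01 g + sup01 h"
proof (rule sup01_least)
  fix x :: real assume x: "x \<in> {0..1}"
  show "\<bar>k x\<bar> \<le> sup01 g + sup01 h"
    using sup01_upper[OF assms(1) x] sup01_upper[OF assms(2) x] assms(3)[OF x] by linarith
qed

lemma sup01_scale:
  assumes "continuous_on {0..1} g" "\<And>x. x \<in> {0..1} \<Longrightarrow> k x = c * g x"
  shows "sup01 k = \<bar>c\<bar> * sup01 g"
proof (rule antisym)
  show le: "sup01 k \<le> \<bar>c\<bar> * sup01 g"
    using assms by (intro sup01_least) (simp add: abs_mult mult_left_mono sup01_upper)
  show "\<bar>c\<bar> * sup01 g \<le> sup01 k"
  proof (cases "c = 0")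
    case True
    have "continuous_on {0..1} k"
      by (rule continuous_on_eq[where f = "\<lambda>_. 0"]) (auto simp: assms(2) True)
    then show ?thesis
      using sup01_nonneg True by simp
  next
    case False
    have k: "continuous_on {0..1} k"
      by (rule continuous_on_eq[where f = "\<lambda>x. c * g x"])
         (auto intro!: continuous_intros assms(1) simp: assms(2))
    have "sup01 g \<le> sup01 k / \<bar>c\<bar>"
    proof (rule sup01_least)
      fix x :: real assume "x \<in> {0..1}"
      then show "\<bar>g x\<bar> \<le> sup01 k / \<bar>c\<bar>"
        using sup01_upper[OF k, of x] False by (simp add: assms(2) abs_mult field_simps)
    qed
    then show ?thesis using False by (simp add: field_simps)
  qed
qed

instantiation C1 :: real_normed_vector
begin

definition norm_C1 :: "C1 \<Rightarrow> real" where
  "norm_C1 u = (SUP x\<in>{0..1}. \<bar>C1_fun u x\<bar>) + (SUP x\<in>{0..1}. \<bar>C1_deriv u x\<bar>)"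
definition dist_C1 :: "C1 \<Rightarrow> C1 \<Rightarrow> real" where
  "dist_C1 u v = norm (u - v)"
definition sgn_C1 :: "C1 \<Rightarrow> C1" where
  "sgn_C1 u = u /\<^sub>R norm u"
definition uniformity_C1 :: "(C1 \<times> C1) filter" where
  "uniformity_C1 = (INF e\<in>{0 <..}. principal {(x, y). dist x y < e})"
definition open_C1 :: "C1 set \<Rightarrow> bool" where
  "open_C1 S = (\<forall>x\<in>S. \<forall>\<^sub>F (x', y) in uniformity. x' = x \<longrightarrow> y \<in> S)"

lemma norm_C1_sup01: "norm u = sup01 (C1_fun u) + sup01 (C1_deriv u)" for u :: C1
  by (simp add: norm_C1_def sup01_def)

instance
proof
  fix u v :: C1 and c :: real
  show "(norm u = 0) = (u = 0)"
  proof
    assume "norm u = 0"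
    then have "sup01 (C1_fun u) = 0"
      using sup01_nonneg[OF C1_fun_continuous, of u] sup01_nonneg[OF C1_deriv_continuous, of u]
      unfolding norm_C1_sup01 by linarith
    then show "u = 0"
      using sup01_upper[OF C1_fun_continuous, of _ u] by (intro C1_eqI) (simp add: C1_fun_zero)
  next
    assume u: "u = 0"
    have "norm u = \<bar>0\<bar> * sup01 (C1_fun u) + \<bar>0\<bar> * sup01 (C1_deriv u)"
      unfolding norm_C1_sup01 using C1_deriv_scaleR[of _ 0 u]
      by (intro arg_cong2[where f = "(+)"] sup01_scale C1_fun_continuous C1_deriv_continuous)
         (auto simp: u C1_fun_zero)
    then show "norm u = 0" by simp
  qed
  have "sup01 (C1_fun (u + v)) \<le> sup01 (C1_fun u) + sup01 (C1_fun v)"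
    by (intro sup01_triangle C1_fun_continuous) (simp add: C1_fun_add)
  moreover have "sup01 (C1_deriv (u + v)) \<le> sup01 (C1_deriv u) + sup01 (C1_deriv v)"
    by (intro sup01_triangle C1_deriv_continuous C1_deriv_add)
  ultimately show "norm (u + v) \<le> norm u + norm v"
    unfolding norm_C1_sup01 by linarith
  have "sup01 (C1_fun (c *\<^sub>R u)) = \<bar>c\<bar> * sup01 (C1_fun u)"
    by (intro sup01_scale C1_fun_continuous) (simp add: C1_fun_scaleR)
  moreover have "sup01 (C1_deriv (c *\<^sub>R u)) = \<bar>c\<bar> * sup01 (C1_deriv u)"
    by (intro sup01_scale C1_deriv_continuous C1_deriv_scaleR)
  ultimately show "norm (c *\<^sub>R u) = \<bar>c\<bar> * norm u"
    unfolding norm_C1_sup01 distrib_left by (rule arg_cong2)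
  show "dist u v = norm (u - v)"
    by (fact dist_C1_def)
  show "sgn u = u /\<^sub>R norm u"
    by (fact sgn_C1_def)
  show "uniformity = (INF e\<in>{0 <..}. principal {(x, y :: C1). dist x y < e})"
    by (fact uniformity_C1_def)
  show "open S = (\<forall>x\<in>S. \<forall>\<^sub>F (x', y) in uniformity. x' = x \<longrightarrow> y \<in> S)" for S :: "C1 set"
    by (fact open_C1_def)
qed

end


section \<open>Sobolev spaces on the open unit interval\<close>

abbreviation leb01 :: "real measure" where
  "leb01 \<equiv> lebesgue_on {0<..<1}"

text \<open>\<open>\<C>\<^sub>c\<^sup>\<infinity>(0,1)\<close>.\<close>

definition test_function :: "(real \<Rightarrow> real) \<Rightarrow> bool" where
  "test_function \<phi> \<longleftrightarrow>
     (\<forall>n x. ((deriv ^^ n) \<phi>) differentiable (at x)) \<and>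
     compact (closure {x. \<phi> x \<noteq> 0}) \<and> closure {x. \<phi> x \<noteq> 0} \<subseteq> {0<..<1}"

text \<open>\<open>v\<close> is the weak derivative of order \<open>n\<close> of \<open>u\<close> on \<open>(0,1)\<close>. As only derivatives belonging to
  \<open>L\<^sup>1(0,1)\<close> are needed, integrability is part of the notion.\<close>

definition weak_deriv :: "nat \<Rightarrow> (real \<Rightarrow> real) \<Rightarrow> (real \<Rightarrow> real) \<Rightarrow> bool" where
  "weak_deriv n u v \<longleftrightarrow> integrable leb01 u \<and> integrable leb01 v \<and>
     (\<forall>\<phi>. test_function \<phi> \<longrightarrow>
        (\<integral>x. u x * (deriv ^^ n) \<phi> x \<partial>leb01) = (-1) ^ n * (\<integral>x. v x * \<phi> x \<partial>leb01))"

text \<open>\<open>W\<^sup>k\<^sup>,\<^sup>1(0,1)\<close>.\<close>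

definition sobolev1 :: "nat \<Rightarrow> (real \<Rightarrow> real) set" where
  "sobolev1 k = {u. \<forall>n\<le>k. \<exists>v. weak_deriv n u v}"

text \<open>\<open>L\<^sup>\<infinity>(0,1)\<close>.\<close>

definition Linfty01 :: "(real \<Rightarrow> real) set" where
  "Linfty01 = {a \<in> borel_measurable leb01. \<exists>B. AE x in leb01. \<bar>a x\<bar> \<le> B}"


section \<open>The one-dimensional mean curvature problem with Neumann conditions\<close>

definition neumann :: "C1 \<Rightarrow> bool" where
  "neumann u \<longleftrightarrow> C1_deriv u 0 = 0 \<and> C1_deriv u 1 = 0"

definition flux :: "C1 \<Rightarrow> real \<Rightarrow> real" where
  "flux u x = C1_deriv u x / sqrt (1 + (C1_deriv u x)\<^sup>2)"

text \<open>Every element of \<open>W\<^sup>2\<^sup>,\<^sup>1(0,1)\<close> has a unique representative in \<open>\<C>\<^sup>1[0,1]\<close>, so solutions are taken in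
  the type \<open>C1\<close>. The flux of a function in \<open>W\<^sup>2\<^sup>,\<^sup>1(0,1)\<close> lies in \<open>W\<^sup>1\<^sup>,\<^sup>1(0,1)\<close>; its derivative, which
  enters the equation, is the \<open>L\<^sup>1\<close> function \<open>g\<close> below, unique up to null sets.\<close>

definition regular_solution :: "(real \<Rightarrow> real) \<Rightarrow> (real \<Rightarrow> real) \<Rightarrow> real \<Rightarrow> C1 \<Rightarrow> bool" where
  "regular_solution a f \<mu> u \<longleftrightarrow>
     C1_fun u \<in> sobolev1 2 \<and>
     (\<exists>g. weak_deriv 1 (flux u) g \<and> (AE x in leb01. - g x = \<mu> * a x * f (C1_fun u x))) \<and>
     neumann u"

definition positive_C1 :: "C1 \<Rightarrow> bool" where
  "positive_C1 u \<longleftrightarrow> (INF x\<in>{0..1}. C1_fun u x) \<ge> 0 \<and> (SUP x\<in>{0..1}. C1_fun u x) > 0"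

definition eigenfunction :: "(real \<Rightarrow> real) \<Rightarrow> real \<Rightarrow> C1 \<Rightarrow> bool" where
  "eigenfunction a \<mu> \<phi> \<longleftrightarrow>
     \<phi> \<noteq> 0 \<and> C1_fun \<phi> \<in> sobolev1 2 \<and>
     (\<exists>g. weak_deriv 2 (C1_fun \<phi>) g \<and> (AE x in leb01. - g x = \<mu> * a x * C1_fun \<phi> x)) \<and>
     neumann \<phi>"

text \<open>The principal eigenvalue. For a sign-changing weight \<open>a\<close> with negative mean, existence and
  uniqueness are classical.\<close>

definition lambda0 :: "(real \<Rightarrow> real) \<Rightarrow> real" where
  "lambda0 a = (THE \<mu>. \<mu> > 0 \<and> (\<exists>\<phi>. eigenfunction a \<mu> \<phi> \<and> (\<forall>x\<in>{0..1}. C1_fun \<phi> x > 0)))"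

definition S_r_plus :: "(real \<Rightarrow> real) \<Rightarrow> (real \<Rightarrow> real) \<Rightarrow> (real \<times> C1) set" where
  "S_r_plus a f =
     {(\<mu>, u). \<mu> \<ge> 0 \<and> regular_solution a f \<mu> u \<and> positive_C1 u} \<union> {(0, 0), (lambda0 a, 0)}"

text \<open>The library's \<open>components S\<close> are the maximal connected subsets of \<open>S\<close>; these are
  automatically closed in \<open>S\<close>. The following spells out the definition of a component as a maximal
  closed connected subset.\<close>

lemma components_iff_maximal_closed_connected:
  assumes "S \<noteq> {}"
  shows "C \<in> components S \<longleftrightarrow>
    C \<subseteq> S \<and> closedin (top_of_set S) C \<and> connected C \<and>
    (\<forall>D. D \<subseteq> S \<and> closedin (top_of_set S) D \<and> connected D \<and> C \<subseteq> D \<longrightarrow> D = C)"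
    (is "?L \<longleftrightarrow> ?R")
proof
  assume L: ?L
  then show ?R
    by (metis bot.extremum_uniqueI closedin_component in_components_maximal)
next
  assume R: ?R
  have "\<exists>K \<in> components S. C \<subseteq> K"
  proof (cases "C = {}")
    case True
    then show ?thesis using assms by (metis Union_components Union_empty empty_subsetI ex_in_conv)
  next
    case False
    then show ?thesis using R by (metis exists_component_superset assms)
  qed
  then show ?L
    using R by (metis closedin_component in_components_connected in_components_subset)
qed

end

theory Submission
  imports Defs "HOL-Complex_Analysis.Great_Picard"
begin

text \<open>
  Write \<open>y\<close> for the flux \<open>u' / sqrt (1 + u'\<^sup>2)\<close>. The problem says that \<open>y\<close> is the primitive of
  \<open>- \<mu> a f(u)\<close> and vanishes at both endpoints. As \<open>a\<close> is positive before \<open>z\<close> and negative after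
  it, positive solutions are nonincreasing, so \<open>u 0\<close> is their maximum, and
  \<open>J(u) = \<integral>\<^sub>0\<^sup>1 a f(u)\<close> vanishes if \<open>\<mu> > 0\<close>.

  \<^bold>\<open>The limit.\<close> It holds along all positive solutions. For small \<open>\<mu>\<close> the slopes are \<open>O(\<mu>)\<close>, so
  \<open>u\<close> is nearly constant. If \<open>u 0\<close> stayed away from zero, \<open>f(u)\<close> would be nearly constant in the
  relative sense: on bounded ranges because \<open>f\<close> is continuous and positive, and at infinity
  because it behaves like \<open>u\<close> to the power \<open>-q\<close> (\<open>nearly_constant\<close>). Then \<open>J(u)\<close> would have
  the sign of the mean of \<open>a\<close>, which is negative (\<open>solution_small\<close>).

  \<^bold>\<open>The component.\<close> It contains \<open>(0, 0)\<close>. Since the projection of a connected set is an interval, it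
  suffices to find a connected set of solutions that contains \<open>(0, 0)\<close> and reaches some level
  \<open>\<mu> = L > 0\<close>. Shooting from \<open>u 0 = c\<close> leaves the scalar equation \<open>J = 0\<close>. With
  \<open>c = s \<gamma>(\<mu>)\<close>, where \<open>\<gamma>(\<mu>)\<close> is \<open>\<mu>\<close> to the power \<open>1 / (1 - p)\<close>, sublinearity of \<open>f\<close> at zero gives
  \<open>J \<ge> 0\<close> for a small value \<open>s = m\<close>, where \<open>u\<close> has reached zero at \<open>z\<close>
  (\<open>source_1_nonneg_bottom\<close>), and \<open>J \<le> 0\<close> for a large value \<open>s = M\<close>, where \<open>u\<close> is nearly
  constant (\<open>source_1_nonpos_top\<close>).

  If no connected set of solutions joined level \<open>0\<close> to level \<open>L\<close>, the compact solution set would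
  split into two clopen parts, and a continuous \<open>\<theta>\<close> equal to \<open>L\<close> on the part containing
  \<open>(0, 0)\<close> and to \<open>0\<close> on the part containing level \<open>L\<close> would satisfy \<open>\<theta>(\<mu>, u) \<noteq> \<mu>\<close> for every
  solution (\<open>connected_subset_reaching_level\<close>). This is contradicted by a fixed point of the planar
  map sending \<open>(\<mu>, s)\<close> to \<open>\<theta>(\<mu>, u)\<close> and to \<open>s + J(u)\<close> clamped to \<open>[m, M]\<close>
  (\<open>branch_fixed_level\<close>). As \<open>f\<close> is merely continuous, \<open>u\<close> is not determined by \<open>(\<mu>, s)\<close>.
  Therefore Brouwer's theorem is applied to the uniquely solvable initial value problem with a
  delay in the argument of \<open>f\<close> (Tonelli's approximation), and the delay is sent to zero by
  compactness (\<open>delayed_limit\<close>).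

  \<^bold>\<open>Weak formulation.\<close> The initial value problem is an integral equation. A chain rule for primitives
  of bounded measurable functions (\<open>has_bdd_density_chain\<close>) turns its solutions into regular ones;
  the du Bois-Reymond lemma (\<open>du_Bois_Reymond\<close>) gives the converse.
\<close>

section \<open>Primitives of bounded measurable functions\<close>

definition bdd_meas :: "(real \<Rightarrow> real) \<Rightarrow> bool" where
  "bdd_meas k \<longleftrightarrow> k \<in> borel_measurable (lebesgue_on {0..1}) \<and> (\<exists>L. \<forall>x\<in>{0..1}. \<bar>k x\<bar> \<le> L)"

lemma bdd_meas_continuous: "continuous_on {0..1} k \<Longrightarrow> bdd_meas k"
  unfolding bdd_meas_def
  by (auto intro!: continuous_imp_measurable_on_sets_lebesgue intro: sup01_upper)

lemma bdd_meas_mult: "bdd_meas k \<Longrightarrow> bdd_meas l \<Longrightarrow> bdd_meas (\<lambda>x. k x * l x)"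
proof -
  assume *: "bdd_meas k" "bdd_meas l"
  then obtain L L' where "\<forall>x\<in>{0..1}. \<bar>k x\<bar> \<le> L" "\<forall>x\<in>{0..1}. \<bar>l x\<bar> \<le> L'"
    by (auto simp: bdd_meas_def)
  then have "\<forall>x\<in>{0..1}. \<bar>k x * l x\<bar> \<le> L * L'"
    by (auto simp: abs_mult intro!: mult_mono intro: order_trans[OF abs_ge_zero])
  with * show ?thesis
    by (auto simp: bdd_meas_def)
qed

lemma bdd_meas_add: "bdd_meas k \<Longrightarrow> bdd_meas l \<Longrightarrow> bdd_meas (\<lambda>x. k x + l x)"
proof -
  assume *: "bdd_meas k" "bdd_meas l"
  then obtain L L' where "\<forall>x\<in>{0..1}. \<bar>k x\<bar> \<le> L" "\<forall>x\<in>{0..1}. \<bar>l x\<bar> \<le> L'"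
    by (auto simp: bdd_meas_def)
  then have "\<forall>x\<in>{0..1}. \<bar>k x + l x\<bar> \<le> L + L'"
    by (meson abs_triangle_ineq add_mono order_trans)
  with * show ?thesis
    by (auto simp: bdd_meas_def)
qed

lemma bdd_meas_const: "bdd_meas (\<lambda>x. c)"
  by (rule bdd_meas_continuous) (rule continuous_on_const)

lemma bdd_meas_integrable_on:
  assumes "bdd_meas k" "{s..t} \<subseteq> {0..1}"
  shows "k integrable_on {s..t}"
proof -
  obtain L where L: "\<forall>x\<in>{0..1}. \<bar>k x\<bar> \<le> L"
    using assms by (auto simp: bdd_meas_def)
  have "k \<in> borel_measurable (lebesgue_on {s..t})"
    by (rule measurable_restrict_mono[where A = "{0..1}"]) (use assms in \<open>auto simp: bdd_meas_def\<close>)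
  then show ?thesis
    by (rule measurable_bounded_by_integrable_imp_integrable_real[where g = "\<lambda>_. L"])
       (use L assms in auto)
qed

lemma bdd_meas_integrable_leb01: "bdd_meas k \<Longrightarrow> integrable leb01 k"
proof -
  assume k: "bdd_meas k"
  then obtain L where L: "\<forall>x\<in>{0..1}. \<bar>k x\<bar> \<le> L"
    by (auto simp: bdd_meas_def)
  have "k \<in> borel_measurable leb01"
    by (rule measurable_restrict_mono[where A = "{0..1}"]) (use k in \<open>auto simp: bdd_meas_def\<close>)
  then show ?thesis
    by (rule measurable_bounded_by_integrable_imp_lebesgue_integrable[where g = "\<lambda>_. L"])
       (use L in \<open>auto simp: integrable_restrict_space\<close>)
qed

lemma bdd_meas_LINT:
  assumes "bdd_meas k"
  shows "(\<integral>x. k x \<partial>leb01) = integral {0..1} k"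
  using lebesgue_integral_eq_integral[OF bdd_meas_integrable_leb01[OF assms]]
  by (simp add: integral_open_interval_real)

lemma integral_diff_Icc:
  fixes k :: "real \<Rightarrow> real"
  assumes "bdd_meas k" "0 \<le> s" "s \<le> t" "t \<le> 1"
  shows "integral {0..t} k - integral {0..s} k = integral {s..t} k"
  using Henstock_Kurzweil_Integration.integral_combine[of 0 s t k] assms bdd_meas_integrable_on[of k 0 t]
  by auto

lemma abs_integral_le:
  fixes k :: "real \<Rightarrow> real"
  assumes "bdd_meas k" "0 \<le> s" "s \<le> t" "t \<le> 1" "\<And>x. x \<in> {s..t} \<Longrightarrow> \<bar>k x\<bar> \<le> L"
  shows "\<bar>integral {s..t} k\<bar> \<le> L * (t - s)"
  using integral_norm_bound_integral[of k "{s..t}" "\<lambda>_. L"] bdd_meas_integrable_on[of k s t] assms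
  by (auto simp: mult.commute)

text \<open>A Lipschitz function on \<open>[0,1]\<close>, together with a bounded representative of its almost
  everywhere derivative. Working with the integral instead of the derivative avoids all almost
  everywhere statements.\<close>

definition has_bdd_density :: "(real \<Rightarrow> real) \<Rightarrow> (real \<Rightarrow> real) \<Rightarrow> bool" where
  "has_bdd_density w k \<longleftrightarrow> bdd_meas k \<and> (\<forall>x\<in>{0..1}. w x = w 0 + integral {0..x} k)"

lemma has_bdd_densityD:
  assumes "has_bdd_density w k"
  shows "bdd_meas k" and "x \<in> {0..1} \<Longrightarrow> w x = w 0 + integral {0..x} k"
  using assms unfolding has_bdd_density_def by blast+

lemma has_bdd_density_diff:
  assumes w: "has_bdd_density w k" and "0 \<le> s" "s \<le> t" "t \<le> 1"
  shows "w t - w s = integral {s..t} k"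
  using has_bdd_densityD(2)[OF w, of s] has_bdd_densityD(2)[OF w, of t]
    integral_diff_Icc[OF has_bdd_densityD(1)[OF w] assms(2-4)] assms(2-4) by simp

lemma has_bdd_density_lipschitz:
  assumes "has_bdd_density w k"
  obtains L where "L > 0" "\<And>s t. s \<in> {0..1} \<Longrightarrow> t \<in> {0..1} \<Longrightarrow> \<bar>w t - w s\<bar> \<le> L * \<bar>t - s\<bar>"
proof -
  have k: "bdd_meas k"
    using assms by (rule has_bdd_densityD)
  then obtain L where L: "\<forall>x\<in>{0..1}. \<bar>k x\<bar> \<le> L"
    by (auto simp: bdd_meas_def)
  define L' where "L' = max 1 L"
  have le: "\<bar>w t - w s\<bar> \<le> L' * \<bar>t - s\<bar>" if "0 \<le> s" "s \<le> t" "t \<le> 1" for s t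
  proof -
    have "w t - w s = integral {s..t} k"
      using has_bdd_density_diff[OF assms that] .
    moreover have "\<bar>integral {s..t} k\<bar> \<le> L' * (t - s)"
      by (rule abs_integral_le[OF k]) (use that L in \<open>auto simp: L'_def le_max_iff_disj\<close>)
    ultimately show ?thesis using that by simp
  qed
  have "\<bar>w t - w s\<bar> \<le> L' * \<bar>t - s\<bar>" if "s \<in> {0..1}" "t \<in> {0..1}" for s t
    using le[of s t] le[of t s] that by (cases "s \<le> t") (auto simp: abs_minus_commute)
  then show ?thesis
    using that[of L'] by (simp add: L'_def)
qed

lemma has_bdd_density_continuous:
  assumes "has_bdd_density w k"
  shows "continuous_on {0..1} w"
proof -
  obtain L where "L > 0" and L: "\<And>s t. s \<in> {0..1} \<Longrightarrow> t \<in> {0..1} \<Longrightarrow> \<bar>w t - w s\<bar> \<le> L * \<bar>t - s\<bar>"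
    using has_bdd_density_lipschitz[OF assms] by blast
  have "L-lipschitz_on {0..1} w"
    using \<open>L > 0\<close> L by (intro lipschitz_onI) (auto simp: dist_real_def abs_minus_commute)
  then show ?thesis
    by (rule lipschitz_on_continuous_on)
qed

text \<open>A primitive of a bounded measurable function need not be differentiable, so the usual chain rule
  does not apply. However, \<open>H \<circ> w\<close> minus the primitive of \<open>(H' \<circ> w) k\<close> is differentiable at every
  point, with derivative zero: near \<open>x\<close>, both terms differ by \<open>o(\<bar>t - x\<bar>)\<close> from
  \<open>H' (w x) (w t - w x)\<close>, because \<open>w\<close> is Lipschitz and \<open>H' \<circ> w\<close> is continuous.\<close>

lemma has_bdd_density_chain:
  assumes w: "has_bdd_density w k"
    and H: "\<And>x. x \<in> {0..1} \<Longrightarrow> (H has_real_derivative H' (w x)) (at (w x))"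
    and cont: "continuous_on {0..1} (\<lambda>x. H' (w x))"
  shows "has_bdd_density (\<lambda>x. H (w x)) (\<lambda>x. H' (w x) * k x)"
proof -
  define m where "m = (\<lambda>x. H' (w x) * k x)"
  have k: "bdd_meas k"
    using w by (rule has_bdd_densityD)
  have m: "bdd_meas m"
    unfolding m_def by (intro bdd_meas_mult bdd_meas_continuous cont k)
  obtain L where "L > 0" and L: "\<And>s t. s \<in> {0..1} \<Longrightarrow> t \<in> {0..1} \<Longrightarrow> \<bar>w t - w s\<bar> \<le> L * \<bar>t - s\<bar>"
    using has_bdd_density_lipschitz[OF w] by blast
  obtain M0 where M0: "\<forall>x\<in>{0..1}. \<bar>k x\<bar> \<le> M0"
    using k by (auto simp: bdd_meas_def)
  define M where "M = max 1 M0"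
  have M: "\<bar>k x\<bar> \<le> M" if "x \<in> {0..1}" for x
    using M0 that by (auto simp: M_def le_max_iff_disj)
  have "M > 0" by (simp add: M_def)
  define D where "D = (\<lambda>t. H (w t) - integral {0..t} m)"
  note wdiff = has_bdd_density_diff[OF w]
  have "(D has_real_derivative 0) (at x within {0..1})" if x: "x \<in> {0..1}" for x
    unfolding has_field_derivative_def has_derivative_within_alt
  proof (intro conjI allI impI)
    show "bounded_linear ((*) (0::real))"
      by (rule bounded_linear_mult_right)
    fix e :: real assume "e > 0"
    have "(H has_derivative (*) (H' (w x))) (at (w x))"
      using H[OF x] by (simp add: has_field_derivative_def)
    then obtain d1 where "d1 > 0" and d1: "\<And>v. \<bar>v - w x\<bar> < d1 \<Longrightarrow>
        \<bar>H v - H (w x) - H' (w x) * (v - w x)\<bar> \<le> e / (2 * L) * \<bar>v - w x\<bar>"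
    proof -
      have "e / (2 * L) > 0"
        using \<open>e > 0\<close> \<open>L > 0\<close> by simp
      then show ?thesis
        using \<open>(H has_derivative (*) (H' (w x))) (at (w x))\<close> that
        unfolding has_derivative_at_alt real_norm_def by blast
    qed
    obtain d2 where "d2 > 0" and d2: "\<And>t. t \<in> {0..1} \<Longrightarrow> \<bar>t - x\<bar> < d2 \<Longrightarrow>
        \<bar>H' (w t) - H' (w x)\<bar> < e / (2 * M)"
    proof -
      have "e / (2 * M) > 0"
        using \<open>e > 0\<close> \<open>M > 0\<close> by simp
      then show ?thesis
        using cont x that unfolding continuous_on_iff dist_real_def by blast
    qed
    define d where "d = min d2 (d1 / L)"
    have "d > 0"
      using \<open>d1 > 0\<close> \<open>d2 > 0\<close> \<open>L > 0\<close> by (simp add: d_def)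
    have "\<bar>D t - D x\<bar> \<le> e * \<bar>t - x\<bar>" if t: "t \<in> {0..1}" and tx: "\<bar>t - x\<bar> < d" for t
    proof -
      have "\<bar>w t - w x\<bar> \<le> L * \<bar>t - x\<bar>"
        using L x t by blast
      moreover have "L * \<bar>t - x\<bar> < d1"
        using tx \<open>L > 0\<close> by (simp add: d_def field_simps)
      ultimately have "\<bar>H (w t) - H (w x) - H' (w x) * (w t - w x)\<bar> \<le> e / (2 * L) * \<bar>w t - w x\<bar>"
        by (intro d1) linarith
      also have "\<dots> \<le> e / (2 * L) * (L * \<bar>t - x\<bar>)"
        using \<open>\<bar>w t - w x\<bar> \<le> L * \<bar>t - x\<bar>\<close> \<open>e > 0\<close> \<open>L > 0\<close> by (intro mult_left_mono) auto
      finally have 1: "\<bar>H (w t) - H (w x) - H' (w x) * (w t - w x)\<bar> \<le> e / 2 * \<bar>t - x\<bar>"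
        using \<open>L > 0\<close> by simp
      have aux: "\<bar>integral {s..s'} m - H' (w x) * (w s' - w s)\<bar> \<le> e / 2 * (s' - s)"
        if s: "0 \<le> s" "s \<le> s'" "s' \<le> 1" and near: "\<And>r. r \<in> {s..s'} \<Longrightarrow> \<bar>r - x\<bar> < d2" for s s'
      proof -
        have kb: "bdd_meas (\<lambda>r. - H' (w x) * k r)"
          by (intro bdd_meas_mult bdd_meas_const k)
        have "integral {s..s'} (\<lambda>r. m r + - H' (w x) * k r)
            = integral {s..s'} m + integral {s..s'} (\<lambda>r. - H' (w x) * k r)"
          by (rule Henstock_Kurzweil_Integration.integral_add) (use m kb s in \<open>auto intro: bdd_meas_integrable_on\<close>)
        also have "\<dots> = integral {s..s'} m - H' (w x) * (w s' - w s)"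
          using wdiff s by simp
        finally have "integral {s..s'} m - H' (w x) * (w s' - w s)
            = integral {s..s'} (\<lambda>r. m r + - H' (w x) * k r)" ..
        moreover have "\<bar>m r + - H' (w x) * k r\<bar> \<le> e / 2" if r: "r \<in> {s..s'}" for r
        proof -
          have "\<bar>m r + - H' (w x) * k r\<bar> = \<bar>H' (w r) - H' (w x)\<bar> * \<bar>k r\<bar>"
            unfolding m_def by (simp add: algebra_simps flip: abs_mult)
          also have "\<dots> \<le> e / (2 * M) * M"
            using d2[of r] near[OF r] M[of r] r s \<open>M > 0\<close> \<open>e > 0\<close> by (intro mult_mono) auto
          finally show ?thesis using \<open>M > 0\<close> by simp
        qed
        ultimately show ?thesis
          using abs_integral_le[OF bdd_meas_add[OF m kb] s] by metis
      qed
      have 2: "\<bar>integral {0..t} m - integral {0..x} m - H' (w x) * (w t - w x)\<bar> \<le> e / 2 * \<bar>t - x\<bar>"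
      proof (cases "x \<le> t")
        case True
        then show ?thesis
          using aux[of x t] integral_diff_Icc[OF m, of x t] x t tx by (auto simp: d_def)
      next
        case False
        have "\<bar>integral {t..x} m - H' (w x) * (w x - w t)\<bar> \<le> e / 2 * (x - t)"
          by (rule aux) (use False x t tx in \<open>auto simp: d_def\<close>)
        moreover have "integral {0..x} m - integral {0..t} m = integral {t..x} m"
          using integral_diff_Icc[OF m, of t x] x t False by auto
        ultimately show ?thesis
          using False by (auto simp: algebra_simps abs_if split: if_splits)
      qed
      show ?thesis
        using 1 2 unfolding D_def by (auto simp: field_simps abs_if split: if_splits)
    qed
    then show "\<exists>d>0. \<forall>y\<in>{0..1}. norm (y - x) < d \<longrightarrow> norm (D y - D x - 0 * (y - x)) \<le> e * norm (y - x)"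
      using \<open>d > 0\<close> by (intro exI[of _ d]) auto
  qed
  then obtain c where c: "\<And>x. x \<in> {0..1} \<Longrightarrow> D x = c"
    using has_field_derivative_zero_constant[of "{0..1}" D] by auto
  have "H (w x) = H (w 0) + integral {0..x} m" if "x \<in> {0..1}" for x
    using c[OF that] c[of 0] by (simp add: D_def)
  with m show ?thesis
    unfolding has_bdd_density_def m_def by blast
qed

lemma has_bdd_density_cmult:
  assumes "has_bdd_density w k"
  shows "has_bdd_density (\<lambda>x. c * w x) (\<lambda>x. c * k x)"
  unfolding has_bdd_density_def
proof (intro conjI ballI)
  show "bdd_meas (\<lambda>x. c * k x)"
    by (intro bdd_meas_mult bdd_meas_const has_bdd_densityD(1)[OF assms])
  show "c * w x = c * w 0 + integral {0..x} (\<lambda>x. c * k x)" if "x \<in> {0..1}" for x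
    by (subst has_bdd_densityD(2)[OF assms that]) (simp add: algebra_simps)
qed

lemma has_bdd_density_add:
  assumes "has_bdd_density w k" "has_bdd_density v l"
  shows "has_bdd_density (\<lambda>x. w x + v x) (\<lambda>x. k x + l x)"
  unfolding has_bdd_density_def
proof (intro conjI ballI)
  show "bdd_meas (\<lambda>x. k x + l x)"
    by (intro bdd_meas_add has_bdd_densityD(1)[OF assms(1)] has_bdd_densityD(1)[OF assms(2)])
  fix x :: real assume x: "x \<in> {0..1}"
  have "integral {0..x} (\<lambda>x. k x + l x) = integral {0..x} k + integral {0..x} l"
    by (intro Henstock_Kurzweil_Integration.integral_add bdd_meas_integrable_on
        has_bdd_densityD(1)[OF assms(1)] has_bdd_densityD(1)[OF assms(2)]) (use x in auto)
  then show "w x + v x = w 0 + v 0 + integral {0..x} (\<lambda>x. k x + l x)"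
    using has_bdd_densityD(2)[OF assms(1) x] has_bdd_densityD(2)[OF assms(2) x] by linarith
qed

lemma has_bdd_density_cong:
  assumes "has_bdd_density w k" "\<And>x. x \<in> {0..1} \<Longrightarrow> w' x = w x" "\<And>x. x \<in> {0..1} \<Longrightarrow> k' x = k x"
  shows "has_bdd_density w' k'"
  unfolding has_bdd_density_def
proof (intro conjI ballI)
  have "k' \<in> borel_measurable (lebesgue_on {0..1}) \<longleftrightarrow> k \<in> borel_measurable (lebesgue_on {0..1})"
    by (rule measurable_cong) (simp add: assms(3))
  then show "bdd_meas k'"
    using has_bdd_densityD(1)[OF assms(1)] assms(3) by (simp add: bdd_meas_def)
  show "w' x = w' 0 + integral {0..x} k'" if "x \<in> {0..1}" for x
  proof -
    have "integral {0..x} k' = integral {0..x} k"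
      by (rule Henstock_Kurzweil_Integration.integral_cong) (use assms(3) that in auto)
    then show ?thesis
      using has_bdd_densityD(2)[OF assms(1) that] assms(2)[OF that] assms(2)[of 0] by simp
  qed
qed

text \<open>The product rule follows from the chain rule for \<open>H y = y\<^sup>2\<close> by polarization.\<close>

lemma has_bdd_density_mult:
  assumes w: "has_bdd_density w k" and v: "has_bdd_density v l"
  shows "has_bdd_density (\<lambda>x. w x * v x) (\<lambda>x. w x * l x + k x * v x)"
proof -
  have sq: "has_bdd_density (\<lambda>x. (w x)\<^sup>2) (\<lambda>x. 2 * w x * k x)" if "has_bdd_density w k" for w k
    by (rule has_bdd_density_chain[OF that])
       (auto intro!: derivative_eq_intros continuous_intros has_bdd_density_continuous[OF that])
  have "has_bdd_density (\<lambda>x. 1/2 * ((w x + v x)\<^sup>2 + (-1) * ((w x)\<^sup>2 + (v x)\<^sup>2)))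
     (\<lambda>x. 1/2 * (2 * (w x + v x) * (k x + l x) + (-1) * (2 * w x * k x + 2 * v x * l x)))"
    by (intro has_bdd_density_cmult has_bdd_density_add sq w v)
  then show ?thesis
    by (rule has_bdd_density_cong) (auto simp: power2_eq_square field_simps)
qed

lemma has_bdd_density_C1:
  assumes "\<And>x. x \<in> {0..1} \<Longrightarrow> (w has_vector_derivative k x) (at x within {0..1})"
    and "continuous_on {0..1} k"
  shows "has_bdd_density w k"
proof -
  have "w x = w 0 + integral {0..x} k" if "x \<in> {0..1}" for x
  proof -
    have "(k has_integral (w x - w 0)) {0..x}"
      by (rule fundamental_theorem_of_calculus)
         (use that assms(1) in \<open>auto intro: has_vector_derivative_within_subset[of _ _ _ "{0..1}"]\<close>)
    then show ?thesis
      by (simp add: integral_unique)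
  qed
  then show ?thesis
    using bdd_meas_continuous[OF assms(2)] unfolding has_bdd_density_def by blast
qed

section \<open>Weak derivatives of primitives\<close>

lemma test_function_deriv:
  assumes "test_function \<phi>"
  shows "(\<phi> has_real_derivative deriv \<phi> x) (at x)"
proof -
  have "((deriv ^^ 0) \<phi>) differentiable (at x)"
    using assms unfolding test_function_def by blast
  then show ?thesis
    by (simp add: DERIV_deriv_iff_real_differentiable)
qed

lemma test_function_outside:
  assumes "test_function \<phi>" "x \<notin> {0<..<1}"
  shows "\<phi> x = 0"
proof (rule ccontr)
  assume "\<phi> x \<noteq> 0"
  then have "x \<in> closure {x. \<phi> x \<noteq> 0}"
    by (intro subsetD[OF closure_subset]) simp
  with assms show False
    by (auto simp: test_function_def)
qed

lemma test_function_deriv_test_function: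
  assumes "test_function \<phi>"
  shows "test_function (deriv \<phi>)"
proof -
  have sub: "{x. deriv \<phi> x \<noteq> 0} \<subseteq> closure {x. \<phi> x \<noteq> 0}"
  proof (rule subsetI, rule ccontr)
    fix x assume x: "x \<in> {x. deriv \<phi> x \<noteq> 0}" "x \<notin> closure {x. \<phi> x \<noteq> 0}"
    have "((\<lambda>_. 0) has_real_derivative 0) (at x)"
      by simp
    then have "(\<phi> has_real_derivative 0) (at x)"
    proof (rule has_field_derivative_transform_within_open)
      show "open (- closure {x. \<phi> x \<noteq> 0})"
        by (rule open_Compl) (rule closed_closure)
      show "x \<in> - closure {x. \<phi> x \<noteq> 0}"
        using x by simp
      show "0 = \<phi> y" if "y \<in> - closure {x. \<phi> x \<noteq> 0}" for y
        using that subsetD[OF closure_subset, of y "{x. \<phi> x \<noteq> 0}"] by (cases "\<phi> y = 0") auto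
    qed
    then show False
      using x DERIV_imp_deriv[of \<phi> 0 x] by auto
  qed
  have cl: "closure {x. deriv \<phi> x \<noteq> 0} \<subseteq> closure {x. \<phi> x \<noteq> 0}"
    by (rule closure_minimal[OF sub]) simp
  have "(deriv ^^ n) (deriv \<phi>) differentiable (at x)" for n x
  proof -
    have "((deriv ^^ Suc n) \<phi>) differentiable (at x)"
      using assms unfolding test_function_def by blast
    then show ?thesis
      by (simp add: funpow_swap1)
  qed
  moreover have "compact (closure {x. \<phi> x \<noteq> 0} \<inter> closure {x. deriv \<phi> x \<noteq> 0})"
    using assms unfolding test_function_def by (intro compact_Int_closed) auto
  then have "compact (closure {x. deriv \<phi> x \<noteq> 0})"
    using cl by (simp add: Int_absorb1)
  ultimately show ?thesis
    using assms cl unfolding test_function_def by blast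
qed

lemma has_bdd_density_test_function:
  assumes "test_function \<phi>"
  shows "has_bdd_density \<phi> (deriv \<phi>)"
proof (rule has_bdd_density_C1)
  show "(\<phi> has_vector_derivative deriv \<phi> x) (at x within {0..1})" for x
    using test_function_deriv[OF assms, of x]
    by (simp add: has_real_derivative_iff_has_vector_derivative[symmetric] has_field_derivative_at_within)
  show "continuous_on {0..1} (deriv \<phi>)"
    by (intro continuous_at_imp_continuous_on ballI)
       (rule DERIV_isCont[OF test_function_deriv[OF test_function_deriv_test_function[OF assms]]])
qed

text \<open>Integration by parts: the product of a primitive and a test function is a primitive that
  vanishes at both endpoints.\<close>

lemma integral_by_parts_density:
  assumes w: "has_bdd_density w k" and \<phi>: "test_function \<phi>"
  shows "(\<integral>x. w x * deriv \<phi> x \<partial>leb01) = - (\<integral>x. k x * \<phi> x \<partial>leb01)"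
proof -
  note P = has_bdd_density_test_function[OF \<phi>]
  note c = bdd_meas_continuous[OF has_bdd_density_continuous[OF w]]
    bdd_meas_continuous[OF has_bdd_density_continuous[OF P]]
    has_bdd_densityD(1)[OF w] has_bdd_densityD(1)[OF P]
  have "w 1 * \<phi> 1 = w 0 * \<phi> 0 + integral {0..1} (\<lambda>x. w x * deriv \<phi> x + k x * \<phi> x)"
    by (rule has_bdd_densityD(2)[OF has_bdd_density_mult[OF w P]]) simp
  also have "integral {0..1} (\<lambda>x. w x * deriv \<phi> x + k x * \<phi> x) =
      integral {0..1} (\<lambda>x. w x * deriv \<phi> x) + integral {0..1} (\<lambda>x. k x * \<phi> x)"
    by (intro Henstock_Kurzweil_Integration.integral_add bdd_meas_integrable_on bdd_meas_mult c) auto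
  finally have "integral {0..1} (\<lambda>x. w x * deriv \<phi> x) + integral {0..1} (\<lambda>x. k x * \<phi> x) = 0"
    using test_function_outside[OF \<phi>, of 0] test_function_outside[OF \<phi>, of 1] by simp
  then show ?thesis
    by (simp add: bdd_meas_LINT bdd_meas_mult c)
qed

lemma weak_deriv_1_density:
  assumes "has_bdd_density w k"
  shows "weak_deriv 1 w k"
  unfolding weak_deriv_def
proof (intro conjI allI impI)
  show "integrable leb01 w" "integrable leb01 k"
    by (intro bdd_meas_integrable_leb01 bdd_meas_continuous has_bdd_density_continuous[OF assms]
        has_bdd_densityD(1)[OF assms])+
  fix \<phi> :: "real \<Rightarrow> real" assume \<phi>: "test_function \<phi>"
  show "(\<integral>x. w x * (deriv ^^ 1) \<phi> x \<partial>leb01) = (-1) ^ 1 * (\<integral>x. k x * \<phi> x \<partial>leb01)"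
    using integral_by_parts_density[OF assms \<phi>] by simp
qed

text \<open>Integrating by parts twice; the derivative of a test function is again a test function.\<close>

lemma weak_deriv_2_density:
  assumes "has_bdd_density w k" "has_bdd_density k l"
  shows "weak_deriv 2 w l"
  unfolding weak_deriv_def
proof (intro conjI allI impI)
  show "integrable leb01 w" "integrable leb01 l"
    by (intro bdd_meas_integrable_leb01 bdd_meas_continuous has_bdd_density_continuous[OF assms(1)]
        has_bdd_densityD(1)[OF assms(2)])+
  fix \<phi> :: "real \<Rightarrow> real" assume \<phi>: "test_function \<phi>"
  show "(\<integral>x. w x * (deriv ^^ 2) \<phi> x \<partial>leb01) = (-1)\<^sup>2 * (\<integral>x. l x * \<phi> x \<partial>leb01)"
    using integral_by_parts_density[OF assms(1) test_function_deriv_test_function[OF \<phi>]]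
      integral_by_parts_density[OF assms(2) \<phi>] by (simp add: numeral_2_eq_2)
qed

section \<open>The du Bois-Reymond lemma\<close>

text \<open>For \<open>P = 1\<close> this is the classical smooth function that is flat at \<open>0\<close>. The polynomial
  factor accounts for its derivatives.\<close>

definition flat_exp :: "real poly \<Rightarrow> real \<Rightarrow> real" where
  "flat_exp P x = (if x > 0 then poly P (1 / x) * exp (- 1 / x) else 0)"

lemma tendsto_poly_exp_at_right_0:
  "((\<lambda>x. poly P (1 / x) * exp (- 1 / x)) \<longlongrightarrow> (0::real)) (at_right 0)"
proof -
  have "((\<lambda>y. \<Sum>i\<le>degree P. coeff P i * (y ^ i / exp y)) \<longlongrightarrow> (\<Sum>i\<le>degree P. coeff P i * 0)) at_top"
    by (intro tendsto_sum tendsto_mult tendsto_const tendsto_power_div_exp_0)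
  then have "((\<lambda>y. poly P y * exp (- y)) \<longlongrightarrow> 0) at_top"
    by (simp add: poly_altdef exp_minus sum_divide_distrib flip: divide_inverse)
  from filterlim_compose[OF this filterlim_inverse_at_top_right] show ?thesis
    by (simp add: inverse_eq_divide)
qed

lemma flat_exp_deriv:
  "(flat_exp P has_real_derivative flat_exp ((P - pderiv P) * [:0, 0, 1:]) x) (at x)"
proof -
  consider "x > 0" | "x < 0" | "x = 0" by linarith
  then show ?thesis
  proof cases
    case 1
    have "((\<lambda>x. poly P (1 / x) * exp (- 1 / x)) has_real_derivative
        flat_exp ((P - pderiv P) * [:0, 0, 1:]) x) (at x)"
      using 1 by (auto intro!: derivative_eq_intros simp: flat_exp_def field_simps power2_eq_square)
    then show ?thesis
      by (rule has_field_derivative_transform_within_open[where S = "{0<..}"])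
         (use 1 in \<open>auto simp: flat_exp_def\<close>)
  next
    case 2
    have "((\<lambda>x. 0) has_real_derivative 0) (at x)" by simp
    then have "(flat_exp P has_real_derivative 0) (at x)"
      by (rule has_field_derivative_transform_within_open[where S = "{..<0}"])
         (use 2 in \<open>auto simp: flat_exp_def\<close>)
    then show ?thesis using 2 by (simp add: flat_exp_def)
  next
    case 3
    have "((\<lambda>h. flat_exp P h / h) \<longlongrightarrow> 0) (at 0)"
    proof (rule filterlim_split_at)
      have "\<forall>\<^sub>F h in at_left 0. flat_exp P h / h = 0"
        by (auto simp: flat_exp_def eventually_at_filter)
      then show "((\<lambda>h. flat_exp P h / h) \<longlongrightarrow> 0) (at_left 0)"
        by (rule tendsto_eventually)
      have "\<forall>\<^sub>F h in at_right 0. flat_exp P h / h = poly (P * [:0, 1:]) (1 / h) * exp (- 1 / h)"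
        by (auto simp: flat_exp_def eventually_at_filter field_simps)
      then show "((\<lambda>h. flat_exp P h / h) \<longlongrightarrow> 0) (at_right 0)"
        by (rule tendsto_cong[THEN iffD2]) (rule tendsto_poly_exp_at_right_0)
    qed
    then show ?thesis
      using 3 by (simp add: DERIV_def flat_exp_def)
  qed
qed

text \<open>A family of functions closed under differentiation consists of smooth functions; this one
  contains smooth bumps.\<close>

inductive_set bump_family :: "(real \<Rightarrow> real) set" where
  left: "(\<lambda>x. flat_exp P (x - s)) \<in> bump_family"
| right: "(\<lambda>x. flat_exp P (s - x)) \<in> bump_family"
| add: "\<lbrakk>\<rho> \<in> bump_family; \<sigma> \<in> bump_family\<rbrakk> \<Longrightarrow> (\<lambda>x. \<rho> x + \<sigma> x) \<in> bump_family"
| mult: "\<lbrakk>\<rho> \<in> bump_family; \<sigma> \<in> bump_family\<rbrakk> \<Longrightarrow> (\<lambda>x. \<rho> x * \<sigma> x) \<in> bump_family"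
| scale: "\<rho> \<in> bump_family \<Longrightarrow> (\<lambda>x. c * \<rho> x) \<in> bump_family"

lemma bump_family_deriv:
  "\<rho> \<in> bump_family \<Longrightarrow> \<exists>\<rho>'\<in>bump_family. \<forall>x. (\<rho> has_real_derivative \<rho>' x) (at x)"
proof (induction rule: bump_family.induct)
  case (left P s)
  have "((\<lambda>x. flat_exp P (x - s)) has_real_derivative flat_exp ((P - pderiv P) * [:0, 0, 1:]) (x - s) * 1) (at x)" for x
    by (rule DERIV_chain2[OF flat_exp_deriv]) (auto intro!: derivative_eq_intros)
  then show ?case
    by (intro bexI[OF _ bump_family.left[of "(P - pderiv P) * [:0, 0, 1:]" s]] allI)
       (simp only: mult_1_right)
next
  case (right P s)
  have "((\<lambda>x. flat_exp P (s - x)) has_real_derivative flat_exp ((P - pderiv P) * [:0, 0, 1:]) (s - x) * (-1)) (at x)" for x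
    by (rule DERIV_chain2[OF flat_exp_deriv]) (auto intro!: derivative_eq_intros)
  then show ?case
    by (intro bexI[OF _ bump_family.scale[OF bump_family.right[of "(P - pderiv P) * [:0, 0, 1:]" s], of "-1"]] allI)
       (simp only: mult.commute[of "-1"])
next
  case (add \<rho> \<sigma>)
  obtain \<rho>' where \<rho>': "\<rho>' \<in> bump_family" "\<And>x. (\<rho> has_real_derivative \<rho>' x) (at x)"
    using add.IH(1) by auto
  obtain \<sigma>' where \<sigma>': "\<sigma>' \<in> bump_family" "\<And>x. (\<sigma> has_real_derivative \<sigma>' x) (at x)"
    using add.IH(2) by auto
  show ?case
    by (intro bexI[OF _ bump_family.add[OF \<rho>'(1) \<sigma>'(1)]] allI DERIV_add \<rho>'(2) \<sigma>'(2))
next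
  case (mult \<rho> \<sigma>)
  obtain \<rho>' where \<rho>': "\<rho>' \<in> bump_family" "\<And>x. (\<rho> has_real_derivative \<rho>' x) (at x)"
    using mult.IH(1) by auto
  obtain \<sigma>' where \<sigma>': "\<sigma>' \<in> bump_family" "\<And>x. (\<sigma> has_real_derivative \<sigma>' x) (at x)"
    using mult.IH(2) by auto
  show ?case
    by (intro bexI[OF _ bump_family.add[OF bump_family.mult[OF \<rho>'(1) mult.hyps(2)]
            bump_family.mult[OF \<sigma>'(1) mult.hyps(1)]]] allI DERIV_mult \<rho>'(2) \<sigma>'(2))
next
  case (scale \<rho> c)
  obtain \<rho>' where \<rho>': "\<rho>' \<in> bump_family" "\<And>x. (\<rho> has_real_derivative \<rho>' x) (at x)"
    using scale.IH by auto
  show ?case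
    by (intro bexI[OF _ bump_family.scale[OF \<rho>'(1), of c]] allI DERIV_cmult \<rho>'(2))
qed

lemma bump_family_smooth:
  assumes "\<rho> \<in> bump_family"
  shows "(deriv ^^ n) \<rho> differentiable (at x)"
proof -
  have "(deriv ^^ n) \<rho> \<in> bump_family"
  proof (induction n)
    case (Suc n)
    obtain \<rho>' where "\<rho>' \<in> bump_family" "\<And>x. ((deriv ^^ n) \<rho> has_real_derivative \<rho>' x) (at x)"
      using bump_family_deriv[OF Suc.IH] by auto
    then have "(deriv ^^ Suc n) \<rho> = \<rho>'"
      by (auto simp: DERIV_imp_deriv)
    then show ?case
      using \<open>\<rho>' \<in> bump_family\<close> by simp
  qed (simp add: assms)
  from bump_family_deriv[OF this] show ?thesis
    unfolding real_differentiable_def by auto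
qed

lemma continuous_integral_pos:
  fixes g :: "real \<Rightarrow> real"
  assumes "continuous_on {0..1} g" "\<And>x. x \<in> {0..1} \<Longrightarrow> g x \<ge> 0" "y \<in> {0..1}" "g y > 0"
  shows "integral {0..1} g > 0"
proof -
  have "integral {0..1} g \<ge> 0"
    by (rule Henstock_Kurzweil_Integration.integral_nonneg)
       (use assms in \<open>auto intro: integrable_continuous_real\<close>)
  moreover have "integral {0..1} g \<noteq> 0"
    using integral_eq_0_iff[of 0 1 g] assms by force
  ultimately show ?thesis by simp
qed

text \<open>If \<open>w\<close> took a larger value at \<open>x\<close> than at \<open>y\<close>, it could be tested against the derivative of a
  function that rises by a bump near \<open>x\<close> and descends by a bump of equal mass near \<open>y\<close>.\<close>

lemma du_Bois_Reymond_le: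
  assumes w: "continuous_on {0..1} w"
    and 0: "\<And>\<phi>. test_function \<phi> \<Longrightarrow> (\<integral>x. w x * deriv \<phi> x \<partial>leb01) = 0"
    and x: "x \<in> {0<..<1}" and y: "y \<in> {0<..<1}"
  shows "w x \<le> w y"
proof (rule ccontr)
  assume "\<not> w x \<le> w y"
  define \<kappa> where "\<kappa> = (w x + w y) / 2"
  have k: "w y < \<kappa>" "\<kappa> < w x"
    using \<open>\<not> w x \<le> w y\<close> by (auto simp: \<kappa>_def)
  have near: "\<exists>r>0. 0 < v - r \<and> v + r < 1 \<and> (\<forall>s. \<bar>s - v\<bar> < r \<longrightarrow> \<bar>w s - w v\<bar> < \<bar>w v - \<kappa>\<bar>)"
    if v: "0 < v" "v < 1" "w v \<noteq> \<kappa>" for v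
  proof -
    have "isCont w v"
      using w v continuous_on_interior[of "{0..1}" w v] by auto
    moreover have "\<bar>w v - \<kappa>\<bar> > 0"
      using v by simp
    ultimately obtain r0 where "r0 > 0" and r0: "\<And>s. \<bar>s - v\<bar> < r0 \<Longrightarrow> \<bar>w s - w v\<bar> < \<bar>w v - \<kappa>\<bar>"
      unfolding continuous_at_eps_delta dist_real_def by blast
    define r where "r = min r0 (min v (1 - v)) / 2"
    have "r > 0" "0 < v - r" "v + r < 1" "r < r0"
      using \<open>r0 > 0\<close> v by (auto simp: r_def min_def field_simps)
    then show ?thesis
      using r0 by (intro exI[of _ r]) auto
  qed
  obtain r where "r > 0" and r: "0 < x - r" "x + r < 1" and r': "\<And>s. \<bar>s - x\<bar> < r \<Longrightarrow> \<bar>w s - w x\<bar> < \<bar>w x - \<kappa>\<bar>"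
    using near[of x] x k by auto
  obtain q where "q > 0" and q: "0 < y - q" "y + q < 1" and q': "\<And>s. \<bar>s - y\<bar> < q \<Longrightarrow> \<bar>w s - w y\<bar> < \<bar>w y - \<kappa>\<bar>"
    using near[of y] y k by auto
  have wr: "w s > \<kappa>" if "\<bar>s - x\<bar> < r" for s
    using r'[OF that] k by linarith
  have wq: "w s < \<kappa>" if "\<bar>s - y\<bar> < q" for s
    using q'[OF that] k by linarith
  define bump where "bump = (\<lambda>v d t. flat_exp 1 (t - (v - d)) * flat_exp 1 (v + d - t))"
  have bump_in: "bump v d \<in> bump_family" for v d
    unfolding bump_def by (intro bump_family.intros)
  have bump_pos: "bump v d t > 0 \<longleftrightarrow> \<bar>t - v\<bar> < d" and bump_nonneg: "bump v d t \<ge> 0"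
    and bump_0: "bump v d t \<noteq> 0 \<longleftrightarrow> \<bar>t - v\<bar> < d" for v d t
    by (auto simp: bump_def flat_exp_def)
  have cont: "continuous_on S \<rho>" if "\<rho> \<in> bump_family" for \<rho> S
    using bump_family_deriv[OF that] by (auto intro!: continuous_at_imp_continuous_on intro: DERIV_isCont)
  note cb = cont[OF bump_in]
  define I where "I = integral {0..1} (bump x r)"
  define K where "K = integral {0..1} (bump y q)"
  have "I > 0" "K > 0"
    unfolding I_def K_def
    by (rule continuous_integral_pos[where y = x], use x \<open>r > 0\<close> in \<open>auto simp: cb bump_nonneg bump_pos\<close>)
       (rule continuous_integral_pos[where y = y], use y \<open>q > 0\<close> in \<open>auto simp: cb bump_nonneg bump_pos\<close>)
  define \<rho> where "\<rho> = (\<lambda>t. K * bump x r t + - I * bump y q t)"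
  have \<rho>: "\<rho> \<in> bump_family"
    unfolding \<rho>_def by (intro bump_family.intros bump_in)
  have \<rho>_int: "integral {0..1} \<rho> = 0"
  proof -
    have "integral {0..1} \<rho> = K * integral {0..1} (bump x r) + - I * integral {0..1} (bump y q)"
      unfolding \<rho>_def by (subst Henstock_Kurzweil_Integration.integral_add)
        (auto intro!: integrable_continuous_real continuous_intros cb)
    then show ?thesis by (simp add: I_def K_def)
  qed
  have "\<exists>F. \<forall>t. (F has_vector_derivative \<rho> t) (at t)"
    using einterval_antiderivative[of "-\<infinity>" "\<infinity>" \<rho>] cont[OF \<rho>, of UNIV]
    by (auto simp: continuous_on_eq_continuous_at)
  then obtain F where F: "\<And>t. (F has_real_derivative \<rho> t) (at t)"
    by (auto simp: has_real_derivative_iff_has_vector_derivative)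
  define \<phi> where "\<phi> = (\<lambda>t. F t - F 0)"
  have \<phi>': "(\<phi> has_real_derivative \<rho> t) (at t)" for t
    unfolding \<phi>_def using F by (auto intro!: derivative_eq_intros)
  have d\<phi>: "deriv \<phi> = \<rho>"
    using \<phi>' by (auto simp: DERIV_imp_deriv)
  have "(\<rho> has_integral (\<phi> 1 - \<phi> 0)) {0..1}"
    by (rule fundamental_theorem_of_calculus)
       (use \<phi>' in \<open>auto simp flip: has_real_derivative_iff_has_vector_derivative intro: has_field_derivative_at_within\<close>)
  then have "\<phi> 1 = 0"
    using \<rho>_int by (simp add: integral_unique \<phi>_def)
  define \<alpha> where "\<alpha> = min (x - r) (y - q)"
  define \<beta> where "\<beta> = max (x + r) (y + q)"
  have "0 < \<alpha>" "\<beta> < 1"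
    using r q \<open>r > 0\<close> \<open>q > 0\<close> by (auto simp: \<alpha>_def \<beta>_def)
  have \<rho>_0: "\<rho> t = 0" if "t \<le> \<alpha> \<or> \<beta> \<le> t" for t
  proof -
    have "\<not> \<bar>t - x\<bar> < r" "\<not> \<bar>t - y\<bar> < q"
      using that by (auto simp: \<alpha>_def \<beta>_def)
    then show ?thesis
      using bump_0[of x r t] bump_0[of y q t] by (simp add: \<rho>_def)
  qed
  have const: "\<phi> t = \<phi> s" if "convex S" "t \<in> S" "s \<in> S" "\<And>u. u \<in> S \<Longrightarrow> \<rho> u = 0" for S s t
  proof -
    have "(\<phi> has_real_derivative 0) (at u within S)" if "u \<in> S" for u
      using has_field_derivative_at_within[OF \<phi>'[of u]] \<open>\<And>u. u \<in> S \<Longrightarrow> \<rho> u = 0\<close>[OF that] by simp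
    then obtain c where "\<And>u. u \<in> S \<Longrightarrow> \<phi> u = c"
      using has_field_derivative_zero_constant[OF \<open>convex S\<close>, of \<phi>] by blast
    then show ?thesis
      using that by simp
  qed
  have "\<phi> t = 0" if "t \<notin> {\<alpha>..\<beta>}" for t
  proof (cases "t < \<alpha>")
    case True
    then show ?thesis
      using const[of "{..\<alpha>}" t 0] \<rho>_0 \<open>0 < \<alpha>\<close> by (auto simp: \<phi>_def)
  next
    case False
    then show ?thesis
      using const[of "{\<beta>..}" t 1] \<rho>_0 \<open>\<beta> < 1\<close> that \<open>\<phi> 1 = 0\<close> by auto
  qed
  then have "{t. \<phi> t \<noteq> 0} \<subseteq> {\<alpha>..\<beta>}"
    by blast
  then have cl: "closure {t. \<phi> t \<noteq> 0} \<subseteq> {\<alpha>..\<beta>}"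
    by (rule closure_minimal) simp
  have "test_function \<phi>"
    unfolding test_function_def
  proof (intro conjI allI)
    show "(deriv ^^ n) \<phi> differentiable at t" for n t
    proof (cases n)
      case 0
      then show ?thesis using \<phi>' real_differentiable_def by auto
    next
      case (Suc m)
      then have "(deriv ^^ n) \<phi> = (deriv ^^ m) \<rho>"
        by (simp add: funpow_swap1 d\<phi>)
      then show ?thesis using bump_family_smooth[OF \<rho>] by simp
    qed
    have "compact ({\<alpha>..\<beta>} \<inter> closure {t. \<phi> t \<noteq> 0})"
      by (intro compact_Int_closed) auto
    then show "compact (closure {t. \<phi> t \<noteq> 0})"
      using cl by (simp add: Int_absorb1)
    show "closure {t. \<phi> t \<noteq> 0} \<subseteq> {0<..<1}"
      by (rule order_trans[OF cl]) (use \<open>0 < \<alpha>\<close> \<open>\<beta> < 1\<close> in auto)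
  qed
  from 0[OF this] have "integral {0..1} (\<lambda>t. w t * \<rho> t) = 0"
    by (simp add: d\<phi> bdd_meas_LINT bdd_meas_continuous continuous_intros w cont[OF \<rho>])
  moreover have "integral {0..1} (\<lambda>t. (w t - \<kappa>) * \<rho> t)
      = integral {0..1} (\<lambda>t. w t * \<rho> t) - \<kappa> * integral {0..1} \<rho>"
    unfolding left_diff_distrib
    by (subst Henstock_Kurzweil_Integration.integral_diff)
       (auto intro!: integrable_continuous_real continuous_intros w cont[OF \<rho>])
  moreover have "integral {0..1} (\<lambda>t. (w t - \<kappa>) * \<rho> t) > 0"
  proof (rule continuous_integral_pos[where y = x])
    show "continuous_on {0..1} (\<lambda>t. (w t - \<kappa>) * \<rho> t)"
      by (intro continuous_intros w cont[OF \<rho>])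
    have disj: "bump x r t = 0 \<or> bump y q t = 0" for t
      using bump_0[of x r t] bump_0[of y q t] wr[of t] wq[of t] by linarith
    have 1: "(w t - \<kappa>) * bump x r t \<ge> 0" for t
      using wr[of t] bump_0[of x r t] bump_nonneg[of x r t]
      by (cases "\<bar>t - x\<bar> < r") auto
    have 2: "(w t - \<kappa>) * bump y q t \<le> 0" for t
      using wq[of t] bump_0[of y q t] bump_nonneg[of y q t]
      by (cases "\<bar>t - y\<bar> < q") (auto simp: mult_nonpos_nonneg)
    show "(w t - \<kappa>) * \<rho> t \<ge> 0" for t
    proof -
      have "(w t - \<kappa>) * \<rho> t = K * ((w t - \<kappa>) * bump x r t) + I * - ((w t - \<kappa>) * bump y q t)"
        by (simp add: \<rho>_def algebra_simps)
      also have "\<dots> \<ge> 0"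
        using mult_nonneg_nonneg[of K, OF _ 1[of t]] mult_nonneg_nonpos[of I, OF _ 2[of t]]
          \<open>I > 0\<close> \<open>K > 0\<close> by simp
      finally show ?thesis .
    qed
    have "bump x r x > 0" "bump y q x = 0"
      using disj[of x] bump_pos[of x r x] \<open>r > 0\<close> by auto
    then show "(w x - \<kappa>) * \<rho> x > 0"
      using k \<open>K > 0\<close> by (simp add: \<rho>_def)
  qed (use x in auto)
  ultimately show False
    by (simp add: \<rho>_int)
qed

lemma du_Bois_Reymond:
  assumes w: "continuous_on {0..1} w"
    and 0: "\<And>\<phi>. test_function \<phi> \<Longrightarrow> (\<integral>x. w x * deriv \<phi> x \<partial>leb01) = 0"
    and x: "x \<in> {0..1}"
  shows "w x = w 0"
proof -
  have eq: "w y = w (1/2)" if "y \<in> {0<..<1}" for y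
    using du_Bois_Reymond_le[OF w 0 that, of "1/2"] du_Bois_Reymond_le[OF w 0 _ that, of "1/2"] by simp
  have "w y = w (1/2)" if "y \<in> {0..1}" for y
  proof (rule continuous_constant_on_closure[where f = w and S = "{0<..<1}"])
    show "continuous_on (closure {0<..<1::real}) w"
      using w by simp
    show "y \<in> closure {0<..<1}"
      using that by simp
  qed (rule eq)
  from this[OF x] this[of 0] show ?thesis
    by simp
qed

text \<open>The difference of \<open>w\<close> and the primitive of \<open>k\<close> has the weak derivative zero, hence is
  constant.\<close>

lemma weak_deriv_1_imp_density:
  assumes w: "continuous_on {0..1} w" and k: "bdd_meas k"
    and wd: "weak_deriv 1 w g" and g: "AE x in leb01. g x = k x"
  shows "has_bdd_density w k"
proof -
  define y where "y = (\<lambda>x. integral {0..x} k)"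
  have y: "has_bdd_density y k"
    unfolding has_bdd_density_def y_def using k by simp
  note cy = has_bdd_density_continuous[OF y]
  have diff: "w x - y x = w 0 - y 0" if "x \<in> {0..1}" for x
  proof (rule du_Bois_Reymond[where w = "\<lambda>x. w x - y x", OF _ _ that])
    show "continuous_on {0..1} (\<lambda>x. w x - y x)"
      by (intro continuous_intros w cy)
    fix \<phi> assume \<phi>: "test_function \<phi>"
    note P = has_bdd_density_test_function[OF \<phi>]
    have int: "integrable leb01 (\<lambda>x. v x * deriv \<phi> x)" if "continuous_on {0..1} v" for v
      by (intro bdd_meas_integrable_leb01 bdd_meas_mult bdd_meas_continuous that has_bdd_densityD(1)[OF P])
    have "(\<integral>x. g x * \<phi> x \<partial>leb01) = (\<integral>x. k x * \<phi> x \<partial>leb01)"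
    proof (rule integral_cong_AE)
      show "(\<lambda>x. k x * \<phi> x) \<in> borel_measurable leb01"
        by (intro borel_measurable_integrable bdd_meas_integrable_leb01 bdd_meas_mult k
            bdd_meas_continuous has_bdd_density_continuous[OF P])
      have "\<phi> \<in> borel_measurable leb01"
        by (intro borel_measurable_integrable bdd_meas_integrable_leb01
            bdd_meas_continuous has_bdd_density_continuous[OF P])
      then show "(\<lambda>x. g x * \<phi> x) \<in> borel_measurable leb01"
        using wd by (auto simp: weak_deriv_def)
      show "AE x in leb01. g x * \<phi> x = k x * \<phi> x"
        using g by eventually_elim simp
    qed
    moreover have "(\<integral>x. w x * deriv \<phi> x \<partial>leb01) = - (\<integral>x. g x * \<phi> x \<partial>leb01)"
      using wd \<phi> by (simp add: weak_deriv_def)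
    ultimately show "(\<integral>x. (w x - y x) * deriv \<phi> x \<partial>leb01) = 0"
      using integral_by_parts_density[OF y \<phi>] int[OF w] int[OF cy] by (simp add: left_diff_distrib)
  qed
  have "w x = w 0 + integral {0..x} k" if "x \<in> {0..1}" for x
    using diff[OF that] by (simp add: y_def algebra_simps)
  then show ?thesis
    using k unfolding has_bdd_density_def by blast
qed

section \<open>Connected subsets of compact sets\<close>

text \<open>If no connected subset of \<open>S\<close> joined \<open>p\<close> to the level \<open>L\<close>, the compact set \<open>S\<close> would split into
  two clopen parts, the first containing \<open>p\<close> and the second containing all points of level \<open>L\<close>. Any
  continuous \<open>\<theta>\<close> that equals \<open>L\<close> on the first part and \<open>0\<close> on the second one would then violate the
  last hypothesis.\<close>

lemma connected_subset_reaching_level: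
  fixes S :: "(real \<times> 'a::metric_space) set"
  assumes "compact S" "p \<in> S" "L > 0"
    and level_0: "\<And>q. q \<in> S \<Longrightarrow> fst q = 0 \<Longrightarrow> q = p"
    and fixed_level: "\<And>\<theta>. continuous_on UNIV \<theta> \<Longrightarrow> range \<theta> \<subseteq> {0..L} \<Longrightarrow> \<exists>q\<in>S. \<theta> q = fst q"
  shows "\<exists>C. connected C \<and> C \<subseteq> S \<and> p \<in> C \<and> (\<exists>q\<in>C. fst q = L)"
proof (rule ccontr)
  assume no_C: "\<nexists>C. connected C \<and> C \<subseteq> S \<and> p \<in> C \<and> (\<exists>q\<in>C. fst q = L)"
  define SL where "SL = S \<inter> {q. fst q = L}"
  have clSL: "closed SL"
    unfolding SL_def
    by (intro closed_Int compact_imp_closed[OF \<open>compact S\<close>] closed_Collect_eq continuous_intros)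
  have "separated_between (top_of_set S) {p} SL"
  proof (rule cut_wire_fence_theorem)
    show "closedin (top_of_set S) {p}" "closedin (top_of_set S) SL"
      using \<open>p \<in> S\<close> clSL by (auto intro!: closed_subset simp: SL_def)
    show "disjnt C {p} \<or> disjnt C SL" if "connectedin (top_of_set S) C" for C
    proof (rule ccontr)
      assume "\<not> (disjnt C {p} \<or> disjnt C SL)"
      moreover have "connected C" "C \<subseteq> S"
        using that by (auto simp: connectedin_subtopology)
      moreover from calculation(1) obtain q where "q \<in> C" "q \<in> SL" "p \<in> C"
        unfolding disjnt_def by blast
      moreover from this have "fst q = L"
        by (simp add: SL_def)
      ultimately show False
        using no_C by blast
    qed
  qed (use \<open>compact S\<close> in \<open>auto simp: compact_space_subtopology Hausdorff_space_subtopology\<close>)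
  then obtain U V where UV: "openin (top_of_set S) U" "openin (top_of_set S) V" "U \<union> V = S"
      "disjnt U V" "p \<in> U" "SL \<subseteq> V"
    by (auto simp: separated_between_def)
  have "U = S - V" "V = S - U"
    using \<open>U \<union> V = S\<close> \<open>disjnt U V\<close> unfolding disjnt_def by blast+
  then have "closedin (top_of_set S) U" "closedin (top_of_set S) V"
    using UV by (metis closedin_diff closedin_topspace topspace_euclidean_subtopology)+
  then have "closed U" "closed V"
    by (auto intro: closedin_closed_trans[OF _ compact_imp_closed[OF \<open>compact S\<close>]])
  have "normal_space (euclidean :: (real \<times> 'a) topology)"
    by (intro metrizable_imp_normal_space metrizable_space_euclidean)
  moreover have "closedin euclidean V" "closedin euclidean U" "disjnt V U" "0 \<le> L"
    using \<open>closed U\<close> \<open>closed V\<close> \<open>disjnt U V\<close> \<open>L > 0\<close> by (auto simp: disjnt_sym)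
  ultimately obtain \<theta> where \<theta>: "continuous_map euclidean (top_of_set {0..L}) \<theta>" "\<theta> ` V \<subseteq> {0}" "\<theta> ` U \<subseteq> {L}"
    by (rule Urysohn_lemma)
  obtain q where q: "q \<in> S" "\<theta> q = fst q"
    using fixed_level[of \<theta>] \<theta>(1) unfolding continuous_map_in_subtopology
    by (auto simp: image_subset_iff Pi_iff)
  show False
  proof (cases "q \<in> U")
    case True
    then have "q \<in> SL"
      using \<theta>(3) q by (auto simp: SL_def)
    then show False
      using True \<open>disjnt U V\<close> \<open>SL \<subseteq> V\<close> unfolding disjnt_def by blast
  next
    case False
    then have "q \<in> V" "\<theta> q = 0"
      using q(1) UV(3) \<theta>(2) by auto
    then have "q = p"
      using level_0 q by simp
    then show False
      using False UV(5) by simp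
  qed
qed

section \<open>Convergence in the norm of continuously differentiable functions\<close>

definition C1_of :: "real \<Rightarrow> (real \<Rightarrow> real) \<Rightarrow> C1" where
  "C1_of c w = Abs_C1 (\<lambda>x. if x \<in> {0..1} then c + integral {0..x} w else 0)"

lemma
  assumes w: "continuous_on {0..1} w" and x: "x \<in> {0..1}"
  shows C1_fun_C1_of: "C1_fun (C1_of c w) x = c + integral {0..x} w"
    and C1_deriv_C1_of: "C1_deriv (C1_of c w) x = w x"
proof -
  define u where "u = (\<lambda>x. if x \<in> {0..1} then c + integral {0..x} w else 0)"
  have der: "(u has_vector_derivative w x) (at x within {0..1})" if "x \<in> {0..1}" for x
  proof -
    have "((\<lambda>x. c + integral {0..x} w) has_vector_derivative 0 + w x) (at x within {0..1})"
      by (intro has_vector_derivative_add has_vector_derivative_const integral_has_vector_derivative w that)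
    then have "((\<lambda>x. c + integral {0..x} w) has_vector_derivative w x) (at x within {0..1})"
      by simp
    then show ?thesis
      by (rule has_vector_derivative_transform[rotated 2]) (use that in \<open>auto simp: u_def\<close>)
  qed
  have "u \<in> C1_rep"
    by (rule C1_repI[OF _ der w]) (auto simp: u_def)
  then have fun_eq: "C1_fun (C1_of c w) = u"
    unfolding C1_of_def u_def[symmetric] by (rule Abs_C1_inverse)
  show "C1_fun (C1_of c w) x = c + integral {0..x} w"
    using x by (simp add: fun_eq u_def)
  show "C1_deriv (C1_of c w) x = w x"
    unfolding C1_deriv_def fun_eq by (rule deriv01_eqI[OF der[OF x] x])
qed

lemma C1_has_bdd_density: "has_bdd_density (C1_fun u) (C1_deriv u)"
  by (rule has_bdd_density_C1) (rule C1_has_deriv, assumption, rule C1_deriv_continuous)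

lemma C1_deriv_diff: "x \<in> {0..1} \<Longrightarrow> C1_deriv (u - v) x = C1_deriv u x - C1_deriv v x"
  using C1_deriv_add[of x "u - v" v] by simp

lemma abs_C1_fun_le_norm: "x \<in> {0..1} \<Longrightarrow> \<bar>C1_fun u x\<bar> \<le> norm u"
  and abs_C1_deriv_le_norm: "x \<in> {0..1} \<Longrightarrow> \<bar>C1_deriv u x\<bar> \<le> norm u"
  using sup01_upper[OF C1_fun_continuous, of x u] sup01_upper[OF C1_deriv_continuous, of x u]
    sup01_nonneg[OF C1_fun_continuous, of u] sup01_nonneg[OF C1_deriv_continuous, of u]
  by (auto simp: norm_C1_sup01)

lemma C1_fun_diff_le:
  assumes "0 \<le> s" "s \<le> t" "t \<le> 1" "\<And>x. x \<in> {s..t} \<Longrightarrow> \<bar>C1_deriv u x\<bar> \<le> L"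
  shows "\<bar>C1_fun u t - C1_fun u s\<bar> \<le> L * (t - s)"
  unfolding has_bdd_density_diff[OF C1_has_bdd_density assms(1-3)]
  by (rule abs_integral_le[OF has_bdd_densityD(1)[OF C1_has_bdd_density] assms])

lemma C1_fun_lipschitz:
  assumes "s \<in> {0..1}" "t \<in> {0..1}"
  shows "\<bar>C1_fun u t - C1_fun u s\<bar> \<le> norm u * \<bar>t - s\<bar>"
proof -
  have "\<bar>C1_fun u t - C1_fun u s\<bar> \<le> norm u * (t - s)" if "0 \<le> s" "s \<le> t" "t \<le> 1" for s t
    by (rule C1_fun_diff_le[OF that]) (use that in \<open>auto intro: abs_C1_deriv_le_norm\<close>)
  from this[of s t] this[of t s] assms show ?thesis
    by (cases "s \<le> t") (auto simp: abs_minus_commute)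
qed

lemma norm_C1_le:
  assumes "\<bar>C1_fun u 0\<bar> \<le> K" "\<And>x. x \<in> {0..1} \<Longrightarrow> \<bar>C1_deriv u x\<bar> \<le> L"
  shows "norm u \<le> K + 2 * L"
proof -
  have "0 \<le> L"
    using assms(2)[of 0] by simp
  have "\<bar>C1_fun u x\<bar> \<le> K + L" if "x \<in> {0..1}" for x
  proof -
    have "\<bar>C1_fun u x - C1_fun u 0\<bar> \<le> L * (x - 0)"
      by (rule C1_fun_diff_le) (use that assms(2) in auto)
    also have "\<dots> \<le> L"
      using that \<open>0 \<le> L\<close> by (simp add: mult_left_le)
    finally show ?thesis
      using assms(1) by linarith
  qed
  then have "sup01 (C1_fun u) \<le> K + L" "sup01 (C1_deriv u) \<le> L"
    by (auto intro!: sup01_least assms(2))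
  then show ?thesis
    by (simp add: norm_C1_sup01)
qed

lemma tendsto_C1_of:
  assumes "c \<longlonglongrightarrow> c'" "uniform_limit {0..1} w w' sequentially"
    and w: "\<And>n. continuous_on {0..1} (w n)" and w': "continuous_on {0..1} w'"
  shows "(\<lambda>n. C1_of (c n) (w n)) \<longlonglongrightarrow> C1_of c' w'"
proof (rule tendstoI)
  fix e :: real assume "e > 0"
  then have "\<forall>\<^sub>F n in sequentially. dist (c n) c' < e / 4"
    by (intro tendstoD[OF assms(1)]) simp
  moreover have "\<forall>\<^sub>F n in sequentially. \<forall>x\<in>{0..1}. dist (w n x) (w' x) < e / 4"
    by (intro uniform_limitD[OF assms(2)]) (use \<open>e > 0\<close> in simp)
  ultimately show "\<forall>\<^sub>F n in sequentially. dist (C1_of (c n) (w n)) (C1_of c' w') < e"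
  proof eventually_elim
    case (elim n)
    have "norm (C1_of (c n) (w n) - C1_of c' w') \<le> e / 4 + 2 * (e / 4)"
    proof (rule norm_C1_le)
      show "\<bar>C1_fun (C1_of (c n) (w n) - C1_of c' w') 0\<bar> \<le> e / 4"
        using elim(1) by (simp add: C1_fun_diff C1_fun_C1_of w w' dist_real_def)
      show "\<bar>C1_deriv (C1_of (c n) (w n) - C1_of c' w') x\<bar> \<le> e / 4" if "x \<in> {0..1}" for x
        using elim(2) that by (auto simp: C1_deriv_diff C1_deriv_C1_of w w' dist_real_def intro: less_imp_le)
    qed
    then show ?case
      using \<open>e > 0\<close> by (simp add: dist_norm)
  qed
qed

section \<open>The truncated initial value problem with delay\<close>

text \<open>The slope \<open>u'\<close> for which the flux \<open>u' / sqrt (1 + u'\<^sup>2)\<close> equals \<open>y\<close>. The flux is truncated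
  to \<open>[-1/2, 0]\<close>: the lower bound avoids the singularity at \<open>-1\<close> and is inactive for small
  parameters; the upper bound makes every function with these slopes nonincreasing.\<close>

definition slope :: "real \<Rightarrow> real" where
  "slope y = (let t = max (- 1 / 2) (min y 0) in t / sqrt (1 - t\<^sup>2))"

lemma slope_arg_sqrt:
  assumes "- 1 / 2 \<le> t" "t \<le> (0::real)"
  shows "1 / 2 \<le> sqrt (1 - t\<^sup>2)" "sqrt (1 - t\<^sup>2) \<le> 1"
proof -
  have "\<bar>t\<bar> \<le> 1 / 2"
    using assms by auto
  then have "t\<^sup>2 \<le> (1 / 2)\<^sup>2"
    by (metis abs_ge_zero power2_abs power_mono)
  then have "(1 / 2)\<^sup>2 \<le> 1 - t\<^sup>2"
    by (simp add: power2_eq_square)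
  then show "1 / 2 \<le> sqrt (1 - t\<^sup>2)"
    by (intro real_le_rsqrt)
  show "sqrt (1 - t\<^sup>2) \<le> 1"
    by simp
qed

lemma slope_eq: "- 1 / 2 \<le> y \<Longrightarrow> y \<le> 0 \<Longrightarrow> slope y = y / sqrt (1 - y\<^sup>2)"
  by (simp add: slope_def)

lemma slope_nonneg_arg: "0 \<le> y \<Longrightarrow> slope y = 0"
  by (simp add: slope_def)

lemma slope_bounds:
  assumes "- 1 / 2 \<le> y" "y \<le> 0"
  shows "2 * y \<le> slope y" "slope y \<le> y"
proof -
  note s = slope_arg_sqrt[OF assms]
  have "sqrt (1 - y\<^sup>2) > 0"
    using s(1) by linarith
  have "y * 1 \<le> y * sqrt (1 - y\<^sup>2)"
    by (rule mult_left_mono_neg) (use s(2) assms in auto)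
  moreover have "y * sqrt (1 - y\<^sup>2) \<le> y * (1 / 2)"
    by (rule mult_left_mono_neg) (use s(1) assms in auto)
  ultimately show "2 * y \<le> slope y" "slope y \<le> y"
    using \<open>sqrt (1 - y\<^sup>2) > 0\<close> by (simp_all add: slope_eq[OF assms] pos_le_divide_eq pos_divide_le_eq)
qed

lemma slope_nonpos: "slope y \<le> 0"
proof (cases "y \<le> 0")
  case True
  have "slope y = slope (max (- 1 / 2) y)"
    by (simp add: slope_def True)
  also have "\<dots> \<le> 0"
    using slope_bounds(2)[of "max (- 1 / 2) y"] True by simp
  finally show ?thesis .
qed (simp add: slope_nonneg_arg)

lemma slope_mono:
  assumes "x \<le> y"
  shows "slope x \<le> slope y"
proof -
  define s where "s = max (- 1 / 2) (min x 0)"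
  define t where "t = max (- 1 / 2) (min y 0)"
  have st: "- 1 / 2 \<le> s" "s \<le> t" "t \<le> 0"
    using assms by (auto simp: s_def t_def)
  then have "t\<^sup>2 \<le> s\<^sup>2"
    by (simp add: abs_le_square_iff[symmetric])
  then have le: "sqrt (1 - s\<^sup>2) \<le> sqrt (1 - t\<^sup>2)"
    by simp
  have pos: "sqrt (1 - s\<^sup>2) > 0"
    using slope_arg_sqrt(1)[of s] st by linarith
  have "s / sqrt (1 - s\<^sup>2) \<le> t / sqrt (1 - s\<^sup>2)"
    using st pos by (simp add: divide_right_mono)
  also have "\<dots> \<le> t / sqrt (1 - t\<^sup>2)"
    using st pos le by (intro divide_left_mono_neg) auto
  finally show ?thesis
    by (simp add: slope_def Let_def s_def t_def)
qed

lemma slope_uniformly_continuous: "uniformly_continuous_on UNIV slope"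
proof -
  have "continuous_on {- 1 / 2..0} (\<lambda>t::real. t / sqrt (1 - t\<^sup>2))"
  proof (intro continuous_intros ballI)
    show "sqrt (1 - t\<^sup>2) \<noteq> 0" if "t \<in> {- 1 / 2..0}" for t :: real
      using slope_arg_sqrt(1)[of t] that by auto
  qed
  then have u: "uniformly_continuous_on {- 1 / 2..0} (\<lambda>t::real. t / sqrt (1 - t\<^sup>2))"
    by (rule compact_uniformly_continuous) simp
  show ?thesis
    unfolding uniformly_continuous_on_def
  proof (intro allI impI)
    fix e :: real assume "e > 0"
    with u obtain d where "d > 0" and d: "\<And>s t. s \<in> {- 1 / 2..0} \<Longrightarrow> t \<in> {- 1 / 2..0} \<Longrightarrow> dist t s < d \<Longrightarrow>
        dist (t / sqrt (1 - t\<^sup>2)) (s / sqrt (1 - s\<^sup>2)) < e"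
      by (rule uniformly_continuous_onE) blast
    have "dist (slope y) (slope x) < e" if "dist y x < d" for x y
      unfolding slope_def Let_def
    proof (rule d)
      show "dist (max (- 1 / 2) (min y 0)) (max (- 1 / 2) (min x 0)) < d"
        using that by (auto simp: dist_real_def max_def min_def abs_if split: if_splits)
    qed auto
    then show "\<exists>d>0. \<forall>x\<in>UNIV. \<forall>y\<in>UNIV. dist y x < d \<longrightarrow> dist (slope y) (slope x) < e"
      using \<open>d > 0\<close> by blast
  qed
qed

lemma slope_continuous: "continuous_on S slope"
  using slope_uniformly_continuous uniformly_continuous_imp_continuous continuous_on_subset by blast

locale delayed_problem =
  fixes b F :: "real \<Rightarrow> real" and A B :: real
  assumes b_meas: "bdd_meas b" and b_le: "\<And>x. x \<in> {0..1} \<Longrightarrow> \<bar>b x\<bar> \<le> A"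
    and F_cont: "continuous_on UNIV F" and F_nonneg: "\<And>v. 0 \<le> F v" and F_le: "\<And>v. F v \<le> B"
begin

lemma A_nonneg: "0 \<le> A"
  using b_le[of 0] by simp

lemma B_nonneg: "0 \<le> B"
  using F_nonneg[of 0] F_le[of 0] by simp

definition delayed :: "real \<Rightarrow> C1 \<Rightarrow> real \<Rightarrow> real" where
  "delayed \<tau> v r = C1_fun v (max 0 (r - \<tau>))"

definition source :: "real \<Rightarrow> C1 \<Rightarrow> real \<Rightarrow> real" where
  "source \<tau> v x = integral {0..x} (\<lambda>r. b r * F (delayed \<tau> v r))"

text \<open>The fixed points of this operator with \<open>\<tau> = 0\<close> are the solutions of the initial value problem
  \<open>u 0 = c\<close>, \<open>u' = slope y\<close> with flux \<open>y x = - \<mu> \<integral>\<^sub>0\<^sup>x b F(u)\<close>. As \<open>F\<close> need not be Lipschitz,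
  they need not be unique. A delay \<open>\<tau> > 0\<close> restores uniqueness: then the value of \<open>u\<close> at \<open>x\<close>
  depends only on the restriction of \<open>u\<close> to \<open>[0, x - \<tau>]\<close>.\<close>

definition step :: "real \<Rightarrow> real \<Rightarrow> real \<Rightarrow> C1 \<Rightarrow> C1" where
  "step \<mu> c \<tau> v = C1_of c (\<lambda>x. slope (- \<mu> * source \<tau> v x))"

lemma delayed_continuous:
  assumes "0 \<le> \<tau>"
  shows "continuous_on {0..1} (delayed \<tau> v)"
  unfolding delayed_def
  by (rule continuous_on_compose2[OF C1_fun_continuous]) (use assms in \<open>auto intro!: continuous_intros\<close>)

lemma integrand_bdd_meas:
  assumes "0 \<le> \<tau>"
  shows "bdd_meas (\<lambda>r. b r * F (delayed \<tau> v r))"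
  by (intro bdd_meas_mult b_meas bdd_meas_continuous continuous_on_compose2[OF F_cont delayed_continuous[OF assms]])
     auto

lemma integrand_le: "x \<in> {0..1} \<Longrightarrow> \<bar>b x * F v\<bar> \<le> A * B"
  unfolding abs_mult by (rule mult_mono) (use b_le F_nonneg[of v] F_le[of v] A_nonneg in auto)

lemma source_density:
  assumes "0 \<le> \<tau>"
  shows "has_bdd_density (source \<tau> v) (\<lambda>r. b r * F (delayed \<tau> v r))"
  unfolding has_bdd_density_def source_def using integrand_bdd_meas[OF assms] by simp

lemma source_0: "source \<tau> v 0 = 0"
  by (simp add: source_def)

lemma source_continuous: "0 \<le> \<tau> \<Longrightarrow> continuous_on {0..1} (source \<tau> v)"
  by (rule has_bdd_density_continuous[OF source_density])

lemma source_lipschitz: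
  assumes "0 \<le> \<tau>" "s \<in> {0..1}" "t \<in> {0..1}"
  shows "\<bar>source \<tau> v t - source \<tau> v s\<bar> \<le> A * B * \<bar>t - s\<bar>"
proof -
  have "\<bar>source \<tau> v t - source \<tau> v s\<bar> \<le> A * B * (t - s)" if "0 \<le> s" "s \<le> t" "t \<le> 1" for s t
    unfolding has_bdd_density_diff[OF source_density[OF assms(1)] that]
    by (rule abs_integral_le[OF integrand_bdd_meas[OF assms(1)] that]) (use that in \<open>auto intro!: integrand_le\<close>)
  from this[of s t] this[of t s] assms show ?thesis
    by (cases "s \<le> t") (auto simp: abs_minus_commute)
qed

lemma abs_source_le:
  assumes "0 \<le> \<tau>" "x \<in> {0..1}"
  shows "\<bar>source \<tau> v x\<bar> \<le> A * B"
proof -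
  have "\<bar>source \<tau> v x - source \<tau> v 0\<bar> \<le> A * B * \<bar>x - 0\<bar>"
    by (rule source_lipschitz) (use assms in auto)
  also have "\<dots> \<le> A * B"
    using assms A_nonneg B_nonneg by (auto intro!: mult_left_le)
  finally show ?thesis
    by (simp add: source_0)
qed

lemma delayed_tendsto:
  assumes "\<And>n. 0 \<le> \<tau> n" "\<tau> \<longlonglongrightarrow> \<tau>'" "v \<longlonglongrightarrow> v'" "0 \<le> \<tau>'"
  shows "uniform_limit {0..1} (\<lambda>n. delayed (\<tau> n) (v n)) (delayed \<tau>' v') sequentially"
proof (rule uniform_limitI)
  fix e :: real assume "e > 0"
  have "(\<lambda>n. norm (v n - v') + norm v' * \<bar>\<tau> n - \<tau>'\<bar>) \<longlonglongrightarrow> norm (v' - v') + norm v' * \<bar>\<tau>' - \<tau>'\<bar>"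
    by (intro tendsto_intros assms)
  then have "\<forall>\<^sub>F n in sequentially. norm (v n - v') + norm v' * \<bar>\<tau> n - \<tau>'\<bar> < e"
    using \<open>e > 0\<close> by (intro order_tendstoD(2)) auto
  then show "\<forall>\<^sub>F n in sequentially. \<forall>x\<in>{0..1}. dist (delayed (\<tau> n) (v n) x) (delayed \<tau>' v' x) < e"
  proof eventually_elim
    case (elim n)
    show ?case
    proof
      fix x :: real assume x: "x \<in> {0..1}"
      define s where "s = max 0 (x - \<tau> n)"
      define t where "t = max 0 (x - \<tau>')"
      have st: "s \<in> {0..1}" "t \<in> {0..1}" "\<bar>s - t\<bar> \<le> \<bar>\<tau> n - \<tau>'\<bar>"
        using x assms(1)[of n] \<open>0 \<le> \<tau>'\<close> by (auto simp: s_def t_def)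
      have "\<bar>C1_fun (v n) s - C1_fun v' s\<bar> \<le> norm (v n - v')"
        using abs_C1_fun_le_norm[OF st(1), of "v n - v'"] by (simp add: C1_fun_diff)
      moreover have "\<bar>C1_fun v' s - C1_fun v' t\<bar> \<le> norm v' * \<bar>\<tau> n - \<tau>'\<bar>"
        using C1_fun_lipschitz[OF st(2,1), of v'] mult_left_mono[OF st(3), of "norm v'"] by simp
      ultimately show "dist (delayed (\<tau> n) (v n) x) (delayed \<tau>' v' x) < e"
        using elim unfolding delayed_def s_def[symmetric] t_def[symmetric] dist_real_def by linarith
    qed
  qed
qed

lemma source_tendsto:
  assumes "\<And>n. 0 \<le> \<tau> n" "\<tau> \<longlonglongrightarrow> \<tau>'" "v \<longlonglongrightarrow> v'" "0 \<le> \<tau>'"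
  shows "uniform_limit {0..1} (\<lambda>n. source (\<tau> n) (v n)) (source \<tau>' v') sequentially"
proof (rule uniform_limitI)
  fix e :: real assume "e > 0"
  define R where "R = norm v' + 1"
  have "uniform_limit {0..1} (\<lambda>n x. F (delayed (\<tau> n) (v n) x)) (\<lambda>x. F (delayed \<tau>' v' x)) sequentially"
  proof (rule uniform_limit_compose_uniformly_continuous_on[OF delayed_tendsto[OF assms]])
    show "uniformly_continuous_on {-R..R} F"
      by (rule compact_uniformly_continuous) (use F_cont continuous_on_subset in auto)
    have "\<forall>\<^sub>F n in sequentially. norm (v n) < R"
      by (rule order_tendstoD(2)[OF tendsto_norm[OF assms(3)]]) (simp add: R_def)
    then show "\<forall>\<^sub>F n in sequentially. \<forall>y\<in>{0..1}. delayed (\<tau> n) (v n) y \<in> {-R..R}"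
    proof eventually_elim
      case (elim n)
      show ?case
      proof
        fix y :: real assume "y \<in> {0..1}"
        then have "max 0 (y - \<tau> n) \<in> {0..1}"
          using assms(1)[of n] by auto
        from abs_C1_fun_le_norm[OF this, of "v n"] elim show "delayed (\<tau> n) (v n) y \<in> {-R..R}"
          by (auto simp: delayed_def)
      qed
    qed
  qed auto
  moreover have "e / (A + 1) > 0"
    using \<open>e > 0\<close> A_nonneg by simp
  ultimately have "\<forall>\<^sub>F n in sequentially. \<forall>x\<in>{0..1}.
      dist (F (delayed (\<tau> n) (v n) x)) (F (delayed \<tau>' v' x)) < e / (A + 1)"
    by (rule uniform_limitD)
  then show "\<forall>\<^sub>F n in sequentially. \<forall>x\<in>{0..1}. dist (source (\<tau> n) (v n) x) (source \<tau>' v' x) < e"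
  proof eventually_elim
    case (elim n)
    show ?case
    proof
      fix x :: real assume x: "x \<in> {0..1}"
      define k where "k = (\<lambda>r. b r * F (delayed (\<tau> n) (v n) r) + (-1) * (b r * F (delayed \<tau>' v' r)))"
      have k: "bdd_meas k"
        unfolding k_def by (intro bdd_meas_add bdd_meas_mult[of "\<lambda>_. -1"] bdd_meas_const integrand_bdd_meas assms)
      have "integral {0..x} k = source (\<tau> n) (v n) x + integral {0..x} (\<lambda>r. (-1) * (b r * F (delayed \<tau>' v' r)))"
        unfolding k_def source_def using x
        by (intro Henstock_Kurzweil_Integration.integral_add bdd_meas_integrable_on bdd_meas_mult[of "\<lambda>_. -1"]
            bdd_meas_const integrand_bdd_meas assms) auto
      also have "\<dots> = source (\<tau> n) (v n) x - source \<tau>' v' x"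
        by (simp add: source_def)
      finally have "dist (source (\<tau> n) (v n) x) (source \<tau>' v' x) = \<bar>integral {0..x} k\<bar>"
        by (simp add: dist_real_def)
      also have "\<dots> \<le> A * (e / (A + 1)) * (x - 0)"
      proof (rule abs_integral_le[OF k])
        fix r :: real assume r: "r \<in> {0..x}"
        have "\<bar>k r\<bar> = \<bar>b r\<bar> * dist (F (delayed (\<tau> n) (v n) r)) (F (delayed \<tau>' v' r))"
          by (simp add: k_def dist_real_def algebra_simps flip: abs_mult)
        also have "\<dots> \<le> A * (e / (A + 1))"
          using elim r x b_le[of r] A_nonneg by (intro mult_mono) (auto intro: less_imp_le)
        finally show "\<bar>k r\<bar> \<le> A * (e / (A + 1))" .
      qed (use x in auto)
      also have "\<dots> \<le> A * (e / (A + 1)) * 1"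
        using x A_nonneg \<open>e > 0\<close> by (intro mult_left_mono) auto
      also have "\<dots> < e"
        using A_nonneg \<open>e > 0\<close> by (simp add: field_simps)
      finally show "dist (source (\<tau> n) (v n) x) (source \<tau>' v' x) < e" .
    qed
  qed
qed

lemma flux_continuous: "0 \<le> \<tau> \<Longrightarrow> continuous_on {0..1} (\<lambda>x. - \<mu> * source \<tau> v x)"
  by (intro continuous_intros source_continuous)

lemma slope_flux_continuous: "0 \<le> \<tau> \<Longrightarrow> continuous_on {0..1} (\<lambda>x. slope (- \<mu> * source \<tau> v x))"
  by (rule continuous_on_compose2[OF slope_continuous flux_continuous]) auto

lemma slope_uniform_limit:
  "uniform_limit S y y' sequentially \<Longrightarrow> uniform_limit S (\<lambda>n x. slope (y n x)) (\<lambda>x. slope (y' x)) sequentially"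
  by (rule uniform_limit_compose_uniformly_continuous_on[OF _ slope_uniformly_continuous]) auto

lemma step_tendsto:
  assumes "\<mu> \<longlonglongrightarrow> \<mu>'" "c \<longlonglongrightarrow> c'" "\<And>n. 0 \<le> \<tau> n" "\<tau> \<longlonglongrightarrow> \<tau>'" "v \<longlonglongrightarrow> v'"
  shows "(\<lambda>n. step (\<mu> n) (c n) (\<tau> n) (v n)) \<longlonglongrightarrow> step \<mu>' c' \<tau>' v'"
proof -
  have "0 \<le> \<tau>'"
    using assms(3,4) by (intro LIMSEQ_le_const[OF assms(4)]) auto
  have 1: "uniform_limit {0..1} (\<lambda>n x. - \<mu> n) (\<lambda>x. - \<mu>') sequentially"
    using tendsto_minus[OF assms(1)] by (auto simp: uniform_limit_iff tendsto_iff)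
  have bd: "bounded (source \<tau>' v' ` {0..1})"
    using compact_continuous_image[OF source_continuous[OF \<open>0 \<le> \<tau>'\<close>]] compact_imp_bounded by blast
  have "uniform_limit {0..1} (\<lambda>n x. - \<mu> n * source (\<tau> n) (v n) x) (\<lambda>x. - \<mu>' * source \<tau>' v' x) sequentially"
    by (rule uniform_lim_mult[OF 1 source_tendsto[OF assms(3-5) \<open>0 \<le> \<tau>'\<close>] _ bd]) (auto simp: image_constant_conv)
  then show ?thesis
    unfolding step_def
    by (intro tendsto_C1_of assms(2) slope_uniform_limit slope_flux_continuous assms(3) \<open>0 \<le> \<tau>'\<close>)
qed

text \<open>Whatever the functions \<open>v n\<close> are, the fluxes in \<open>step\<close> are uniformly bounded and uniformly
  Lipschitz, so the Arzela-Ascoli theorem applies to them.\<close>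

lemma step_compact:
  assumes "\<And>n. 0 \<le> \<tau> n" "\<And>n. \<bar>\<mu> n\<bar> \<le> K" "c \<longlonglongrightarrow> c'"
  obtains k u where "strict_mono (k :: nat \<Rightarrow> nat)" "(\<lambda>n. step (\<mu> (k n)) (c (k n)) (\<tau> (k n)) (v (k n))) \<longlonglongrightarrow> u"
proof -
  define y where "y = (\<lambda>n x. - \<mu> n * source (\<tau> n) (v n) x)"
  have K: "0 \<le> K"
    using assms(2)[of 0] by simp
  have y_le: "norm (y n x) \<le> K * (A * B)" if "x \<in> {0..1}" for n x
    unfolding y_def using abs_source_le[OF assms(1) that] assms(2)
    by (auto simp: abs_mult intro!: mult_mono K)
  have y_lip: "norm (y n x - y n t) \<le> K * (A * B) * \<bar>x - t\<bar>" if "x \<in> {0..1}" "t \<in> {0..1}" for n x t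
  proof -
    have "norm (y n x - y n t) = \<bar>\<mu> n\<bar> * \<bar>source (\<tau> n) (v n) x - source (\<tau> n) (v n) t\<bar>"
    proof -
      have "y n x - y n t = - (\<mu> n * (source (\<tau> n) (v n) x - source (\<tau> n) (v n) t))"
        by (simp add: y_def algebra_simps)
      then show ?thesis
        by (simp only: real_norm_def abs_minus_cancel abs_mult)
    qed
    also have "\<dots> \<le> K * (A * B * \<bar>x - t\<bar>)"
      by (intro mult_mono assms(2) source_lipschitz assms(1) that K) auto
    finally show ?thesis
      by (simp add: mult.assoc)
  qed
  obtain g k where g: "continuous_on {0..1} g" "strict_mono (k :: nat \<Rightarrow> nat)"
    "\<And>e. 0 < e \<Longrightarrow> \<exists>N. \<forall>n x. n \<ge> N \<and> x \<in> {0..1} \<longrightarrow> norm (y (k n) x - g x) < e"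
  proof (rule Arzela_Ascoli[of "{0..1}" y "K * (A * B)"])
    fix x e :: real assume "x \<in> {0..1}" "0 < e"
    define d where "d = e / (K * (A * B) + 1)"
    have pos: "K * (A * B) + 1 > 0"
      using K A_nonneg B_nonneg by (simp add: add_nonneg_pos)
    have "norm (y n x - y n t) < e" if "t \<in> {0..1}" "norm (x - t) < d" for n t
    proof -
      have "norm (y n x - y n t) \<le> K * (A * B) * \<bar>x - t\<bar>"
        by (rule y_lip) fact+
      also have "\<dots> \<le> (K * (A * B) + 1) * \<bar>x - t\<bar>"
        by (intro mult_right_mono) auto
      also have "\<dots> < e"
        using that(2) pos by (simp add: d_def pos_less_divide_eq mult.commute)
      finally show ?thesis .
    qed
    then show "\<exists>d>0. \<forall>n t. t \<in> {0..1} \<and> norm (x - t) < d \<longrightarrow> norm (y n x - y n t) < e"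
      using pos \<open>0 < e\<close> by (intro exI[of _ d]) (auto simp: d_def)
  qed (use y_le in auto)
  have "uniform_limit {0..1} (\<lambda>n. y (k n)) g sequentially"
    unfolding uniform_limit_sequentially_iff
  proof (intro allI impI)
    fix e :: real assume "e > 0"
    from g(3)[OF this] show "\<exists>N. \<forall>n\<ge>N. \<forall>x\<in>{0..1}. dist (y (k n) x) (g x) < e"
      unfolding dist_real_def real_norm_def by blast
  qed
  moreover have "(\<lambda>n. c (k n)) \<longlonglongrightarrow> c'"
    using LIMSEQ_subseq_LIMSEQ[OF assms(3) g(2)] by (simp add: o_def)
  ultimately have "(\<lambda>n. C1_of (c (k n)) (\<lambda>x. slope (y (k n) x))) \<longlonglongrightarrow> C1_of c' (\<lambda>x. slope (g x))"
    by (intro tendsto_C1_of slope_uniform_limit)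
       (auto simp: y_def intro!: slope_flux_continuous[simplified] assms(1) continuous_on_compose2[OF slope_continuous g(1)])
  then show thesis
    using that g(2) by (auto simp: step_def y_def)
qed

text \<open>The delayed problem has a unique solution, obtained by iterating the operator: each further
  application of it fixes the values on an interval that is longer by \<open>\<tau>\<close>.\<close>

definition delay :: "nat \<Rightarrow> real" where
  "delay n = 1 / real (Suc n)"

text \<open>The iteration starts at the wrong initial value: the first application corrects the value at
  \<open>0\<close>, and \<open>n + 1\<close> further ones advance by \<open>1 / (n + 1)\<close> each.\<close>

definition tonelli :: "nat \<Rightarrow> real \<Rightarrow> real \<Rightarrow> C1" where
  "tonelli n \<mu> c = (step \<mu> c (delay n) ^^ (n + 2)) 0"

lemma delay_nonneg: "0 \<le> delay n"
  by (simp add: delay_def)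

lemma delay_tendsto: "delay \<longlonglongrightarrow> 0"
  using LIMSEQ_inverse_real_of_nat by (simp add: delay_def[abs_def] inverse_eq_divide)

lemma C1_fun_step:
  assumes "0 \<le> \<tau>" "x \<in> {0..1}"
  shows "C1_fun (step \<mu> c \<tau> v) x = c + integral {0..x} (\<lambda>x. slope (- \<mu> * source \<tau> v x))"
    and "C1_deriv (step \<mu> c \<tau> v) x = slope (- \<mu> * source \<tau> v x)"
  unfolding step_def using C1_fun_C1_of C1_deriv_C1_of slope_flux_continuous[OF assms(1)] assms(2)
  by blast+

text \<open>The delay lets the operator transport agreement from \<open>[0, y]\<close> to \<open>[0, y + \<tau>]\<close>.\<close>

lemma step_agree:
  assumes "0 \<le> \<tau>" "0 \<le> y" and agree: "\<And>x. 0 \<le> x \<Longrightarrow> x \<le> y \<Longrightarrow> x \<le> 1 \<Longrightarrow> C1_fun u x = C1_fun v x"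
    and x: "0 \<le> x" "x \<le> y + \<tau>" "x \<le> 1"
  shows "C1_fun (step \<mu> c \<tau> u) x = C1_fun (step \<mu> c \<tau> v) x"
proof -
  have "source \<tau> u s = source \<tau> v s" if "s \<in> {0..x}" for s
    unfolding source_def delayed_def
    by (rule Henstock_Kurzweil_Integration.integral_cong) (subst agree, use assms that in auto)
  then have "integral {0..x} (\<lambda>x. slope (- \<mu> * source \<tau> u x)) = integral {0..x} (\<lambda>x. slope (- \<mu> * source \<tau> v x))"
    by (intro Henstock_Kurzweil_Integration.integral_cong) simp
  then show ?thesis
    using x by (simp only: C1_fun_step(1)[OF assms(1)] atLeastAtMost_iff)
qed

lemma step_tonelli: "step \<mu> c (delay n) (tonelli n \<mu> c) = tonelli n \<mu> c"
proof -
  define T where "T = step \<mu> c (delay n)"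
  have "C1_fun ((T ^^ (j + 2)) 0) x = C1_fun ((T ^^ (j + 1)) 0) x"
    if "0 \<le> x" "x \<le> real j * delay n" "x \<le> 1" for j x
    using that
  proof (induction j arbitrary: x)
    case 0
    then show ?case
      by (simp add: T_def C1_fun_step(1)[OF delay_nonneg])
  next
    case (Suc j)
    have "C1_fun (T ((T ^^ (j + 2)) 0)) x = C1_fun (T ((T ^^ (j + 1)) 0)) x"
      unfolding T_def
      by (rule step_agree[where y = "real j * delay n"])
         (use Suc delay_nonneg in \<open>auto simp: T_def algebra_simps\<close>)
    then show ?case by simp
  qed
  from this[of _ "Suc n"] have "(T ^^ (Suc n + 2)) 0 = (T ^^ (Suc n + 1)) 0"
    by (intro C1_eqI) (simp add: delay_def)
  then show ?thesis
    by (simp add: tonelli_def T_def)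
qed

lemma tonelli_tendsto:
  assumes "\<mu> \<longlonglongrightarrow> \<mu>'" "c \<longlonglongrightarrow> c'"
  shows "(\<lambda>j. tonelli n (\<mu> j) (c j)) \<longlonglongrightarrow> tonelli n \<mu>' c'"
proof -
  have "(\<lambda>j. (step (\<mu> j) (c j) (delay n) ^^ k) 0) \<longlonglongrightarrow> (step \<mu>' c' (delay n) ^^ k) 0" for k
  proof (induction k)
    case (Suc k)
    from step_tendsto[OF assms delay_nonneg tendsto_const this] show ?case
      by simp
  qed simp
  then show ?thesis
    unfolding tonelli_def .
qed

end

context delayed_problem
begin

section \<open>The branch of solutions\<close>

text \<open>As the delays vanish, solutions of the delayed problem accumulate at solutions of the problem
  without delay.\<close>

lemma delayed_limit:
  assumes "\<And>n. \<mu> n \<in> {0..L}" "\<And>n. s n \<in> {m..M}" "\<And>n. 0 \<le> \<tau> n" "\<tau> \<longlonglongrightarrow> 0"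
    and u: "\<And>n. u n = step (\<mu> n) (s n * \<gamma> (\<mu> n)) (\<tau> n) (u n)"
    and \<gamma>: "continuous_on {0..L} \<gamma>"
  obtains k \<mu>' s' u' where "strict_mono (k :: nat \<Rightarrow> nat)" "\<mu>' \<in> {0..L}" "s' \<in> {m..M}"
    "(\<lambda>n. \<mu> (k n)) \<longlonglongrightarrow> \<mu>'" "(\<lambda>n. s (k n)) \<longlonglongrightarrow> s'" "(\<lambda>n. u (k n)) \<longlonglongrightarrow> u'"
    "u' = step \<mu>' (s' * \<gamma> \<mu>') 0 u'"
proof -
  have "seq_compact ({0..L} \<times> {m..M})"
    by (intro compact_imp_seq_compact compact_Times) auto
  moreover have "\<forall>n. (\<mu> n, s n) \<in> {0..L} \<times> {m..M}"
    using assms(1,2) by auto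
  ultimately obtain l k1 where l: "l \<in> {0..L} \<times> {m..M}" "strict_mono (k1 :: nat \<Rightarrow> nat)"
    "((\<lambda>n. (\<mu> n, s n)) \<circ> k1) \<longlonglongrightarrow> l"
    by (rule seq_compactE)
  define \<mu>' where "\<mu>' = fst l"
  define s' where "s' = snd l"
  have \<mu>': "(\<lambda>n. \<mu> (k1 n)) \<longlonglongrightarrow> \<mu>'" "\<mu>' \<in> {0..L}" and s': "(\<lambda>n. s (k1 n)) \<longlonglongrightarrow> s'" "s' \<in> {m..M}"
    using l(1) tendsto_fst[OF l(3)] tendsto_snd[OF l(3)] by (auto simp: \<mu>'_def s'_def o_def)
  have "(\<lambda>n. \<gamma> (\<mu> (k1 n))) \<longlonglongrightarrow> \<gamma> \<mu>'"
    by (rule continuous_on_tendsto_compose[OF \<gamma> \<mu>']) (use assms(1) in auto)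
  then have c: "(\<lambda>n. s (k1 n) * \<gamma> (\<mu> (k1 n))) \<longlonglongrightarrow> s' * \<gamma> \<mu>'"
    by (intro tendsto_mult s')
  have \<tau>: "(\<lambda>n. \<tau> (k1 n)) \<longlonglongrightarrow> 0"
    using LIMSEQ_subseq_LIMSEQ[OF assms(4) l(2)] by (simp add: o_def)
  obtain k2 u' where k2: "strict_mono (k2 :: nat \<Rightarrow> nat)"
    "(\<lambda>n. step (\<mu> (k1 (k2 n))) (s (k1 (k2 n)) * \<gamma> (\<mu> (k1 (k2 n)))) (\<tau> (k1 (k2 n))) (u (k1 (k2 n)))) \<longlonglongrightarrow> u'"
    by (rule step_compact[where \<tau> = "\<lambda>n. \<tau> (k1 n)" and \<mu> = "\<lambda>n. \<mu> (k1 n)" and K = L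
          and v = "\<lambda>n. u (k1 n)", OF _ _ c]) (use assms(1,3) in auto)
  have u': "(\<lambda>n. u (k1 (k2 n))) \<longlonglongrightarrow> u'"
    using k2(2) unfolding u[symmetric] .
  note sub = LIMSEQ_subseq_LIMSEQ[OF _ k2(1), unfolded o_def]
  have "(\<lambda>n. step (\<mu> (k1 (k2 n))) (s (k1 (k2 n)) * \<gamma> (\<mu> (k1 (k2 n)))) (\<tau> (k1 (k2 n))) (u (k1 (k2 n))))
      \<longlonglongrightarrow> step \<mu>' (s' * \<gamma> \<mu>') 0 u'"
    by (rule step_tendsto[OF sub[OF \<mu>'(1)] sub[OF c] assms(3) sub[OF \<tau>] u'])
  then have "u' = step \<mu>' (s' * \<gamma> \<mu>') 0 u'"
    by (rule LIMSEQ_unique[OF k2(2)])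
  then show thesis
    using that[of "\<lambda>n. k1 (k2 n)" \<mu>' s' u'] \<mu>'(2) s'(2) sub[OF \<mu>'(1)] sub[OF s'(1)] u'
      strict_mono_o[OF l(2) k2(1)] by (simp add: o_def)
qed

text \<open>The initial value is written as \<open>u 0 = s \<gamma>(\<mu>)\<close> because positive solutions are of the order of
  \<open>\<mu>\<close> raised to the power \<open>1 / (1 - p)\<close>. With \<open>\<gamma>\<close> this power, a fixed range \<open>[m, M]\<close> of \<open>s\<close>
  captures them for all small \<open>\<mu>\<close>, and at \<open>\<mu> = 0\<close> it collapses to the zero function. The vanishing
  source integral is the Neumann condition at \<open>1\<close>.\<close>

definition branch :: "(real \<Rightarrow> real) \<Rightarrow> real \<Rightarrow> real \<Rightarrow> real \<Rightarrow> (real \<times> C1) set" where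
  "branch \<gamma> m M L =
     {(\<mu>, u). \<mu> \<in> {0..L} \<and> (\<exists>s\<in>{m..M}. u = step \<mu> (s * \<gamma> \<mu>) 0 u) \<and> source 0 u 1 = 0}"

lemma source_1_tendsto:
  assumes "\<And>n. 0 \<le> \<tau> n" "\<tau> \<longlonglongrightarrow> 0" "v \<longlonglongrightarrow> v'"
  shows "(\<lambda>n. source (\<tau> n) (v n) 1) \<longlonglongrightarrow> source 0 v' 1"
  by (rule tendsto_uniform_limitI[OF source_tendsto[OF assms]]) auto

lemma branch_compact:
  assumes \<gamma>: "continuous_on {0..L} \<gamma>"
  shows "compact (branch \<gamma> m M L)"
  unfolding compact_eq_seq_compact_metric seq_compact_def
proof (intro allI impI)
  fix q :: "nat \<Rightarrow> real \<times> C1"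
  assume q: "\<forall>n. q n \<in> branch \<gamma> m M L"
  define \<mu> where "\<mu> = (\<lambda>n. fst (q n))"
  define u where "u = (\<lambda>n. snd (q n))"
  have "\<forall>n. \<mu> n \<in> {0..L} \<and> (\<exists>s\<in>{m..M}. u n = step (\<mu> n) (s * \<gamma> (\<mu> n)) 0 (u n)) \<and> source 0 (u n) 1 = 0"
    using q by (auto simp: branch_def \<mu>_def u_def split_beta)
  then obtain s where *: "\<And>n. \<mu> n \<in> {0..L}" "\<And>n. s n \<in> {m..M}"
    "\<And>n. u n = step (\<mu> n) (s n * \<gamma> (\<mu> n)) 0 (u n)" and J: "\<And>n. source 0 (u n) 1 = 0"
    by metis
  obtain k \<mu>' s' u' where k: "strict_mono (k :: nat \<Rightarrow> nat)" "\<mu>' \<in> {0..L}" "s' \<in> {m..M}"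
    "(\<lambda>n. \<mu> (k n)) \<longlonglongrightarrow> \<mu>'" "(\<lambda>n. s (k n)) \<longlonglongrightarrow> s'" "(\<lambda>n. u (k n)) \<longlonglongrightarrow> u'"
    "u' = step \<mu>' (s' * \<gamma> \<mu>') 0 u'"
    by (rule delayed_limit[where \<tau> = "\<lambda>_. 0" and u = u, OF *(1,2) order_refl tendsto_const *(3) \<gamma>])
  have "(\<lambda>n. source 0 (u (k n)) 1) \<longlonglongrightarrow> source 0 u' 1"
    by (rule source_1_tendsto[OF _ tendsto_const k(6)]) simp
  then have "source 0 u' 1 = 0"
    unfolding J by (simp add: LIMSEQ_const_iff)
  then have "(\<mu>', u') \<in> branch \<gamma> m M L"
    using k(2,3,7) by (auto simp: branch_def)
  moreover have "(q \<circ> k) \<longlonglongrightarrow> (\<mu>', u')"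
    using tendsto_Pair[OF k(4,6)] by (simp add: \<mu>_def u_def o_def)
  ultimately show "\<exists>l\<in>branch \<gamma> m M L. \<exists>r. strict_mono r \<and> (q \<circ> r) \<longlonglongrightarrow> l"
    using k(1) by blast
qed

lemma solution_parameter_0:
  assumes "F 0 = 0" "u = step 0 0 0 u"
  shows "u = 0" and "source 0 u 1 = 0"
proof -
  show "u = 0"
  proof (rule C1_eqI)
    fix x :: real assume "x \<in> {0..1}"
    then show "C1_fun u x = C1_fun 0 x"
      by (subst assms(2)) (simp add: C1_fun_step(1) slope_nonneg_arg C1_fun_zero)
  qed
  then show "source 0 u 1 = 0"
    by (simp add: source_def delayed_def C1_fun_zero assms(1))
qed

text \<open>Brouwer's theorem in the plane applies to the solutions of the delayed problem: the first
  component of the map forces \<open>\<theta> = \<mu>\<close>, the second one forces the source integral to vanish,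
  unless \<open>s\<close> is driven against an endpoint of \<open>[m, M]\<close>. Letting the delay tend to zero yields
  solutions of the original problem, for which the sign conditions at \<open>m\<close> and \<open>M\<close> exclude
  this exception.\<close>

lemma branch_fixed_level:
  assumes "0 < L" "m \<le> M" and F0: "F 0 = 0"
    and \<gamma>: "continuous_on {0..L} \<gamma>" "\<gamma> 0 = 0"
    and bottom: "\<And>\<mu> u. 0 < \<mu> \<Longrightarrow> \<mu> \<le> L \<Longrightarrow> u = step \<mu> (m * \<gamma> \<mu>) 0 u \<Longrightarrow> 0 \<le> source 0 u 1"
    and top: "\<And>\<mu> u. 0 < \<mu> \<Longrightarrow> \<mu> \<le> L \<Longrightarrow> u = step \<mu> (M * \<gamma> \<mu>) 0 u \<Longrightarrow> source 0 u 1 \<le> 0"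
    and \<theta>: "continuous_on UNIV \<theta>" "range \<theta> \<subseteq> {0..L}"
  shows "\<exists>q\<in>branch \<gamma> m M L. \<theta> q = fst q"
proof -
  define clamp where "clamp = (\<lambda>s. max m (min M s))"
  define sol where "sol = (\<lambda>n q. tonelli n (fst q) (snd q * \<gamma> (fst q)))"
  define G where "G = (\<lambda>n q. (\<theta> (fst q, sol n q), clamp (snd q + source (delay n) (sol n q) 1)))"
  define Q where "Q = {0..L} \<times> {m..M}"
  have "\<exists>q\<in>Q. G n q = q" for n
  proof (rule brouwer[of Q "G n"])
    show "compact Q" "convex Q" "Q \<noteq> {}"
      using assms(1,2) by (auto simp: Q_def intro: compact_Times convex_Times)
    show "G n \<in> Q \<rightarrow> Q"
      using \<theta>(2) assms(2) by (auto simp: G_def Q_def clamp_def)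
    show "continuous_on Q (G n)"
      unfolding continuous_on_sequentially
    proof (intro allI impI ballI)
      fix q and q' assume q': "q' \<in> Q" and "(\<forall>j. q j \<in> Q) \<and> q \<longlonglongrightarrow> q'"
      then have q: "\<And>j. q j \<in> Q" and lim: "q \<longlonglongrightarrow> q'" by auto
      note fst_lim = tendsto_fst[OF lim] and snd_lim = tendsto_snd[OF lim]
      have "(\<lambda>j. \<gamma> (fst (q j))) \<longlonglongrightarrow> \<gamma> (fst q')"
        by (rule continuous_on_tendsto_compose[OF \<gamma>(1) fst_lim]) (use q q' in \<open>auto simp: Q_def mem_Times_iff\<close>)
      then have sol_lim: "(\<lambda>j. sol n (q j)) \<longlonglongrightarrow> sol n q'"
        unfolding sol_def by (intro tonelli_tendsto fst_lim tendsto_mult snd_lim)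
      have "(\<lambda>j. \<theta> (fst (q j), sol n (q j))) \<longlonglongrightarrow> \<theta> (fst q', sol n q')"
        by (rule continuous_on_tendsto_compose[OF \<theta>(1) tendsto_Pair[OF fst_lim sol_lim]]) auto
      moreover have "(\<lambda>j. source (delay n) (sol n (q j)) 1) \<longlonglongrightarrow> source (delay n) (sol n q') 1"
        by (rule tendsto_uniform_limitI[OF source_tendsto[OF delay_nonneg tendsto_const sol_lim delay_nonneg]]) simp
      ultimately show "(G n \<circ> q) \<longlonglongrightarrow> G n q'"
        unfolding G_def clamp_def o_def by (intro tendsto_Pair tendsto_max tendsto_min tendsto_const tendsto_add snd_lim)
    qed
  qed auto
  then obtain q where q: "\<And>n. q n \<in> Q" "\<And>n. G n (q n) = q n"
    by metis
  define \<mu> where "\<mu> = (\<lambda>n. fst (q n))"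
  define s where "s = (\<lambda>n. snd (q n))"
  define u where "u = (\<lambda>n. sol n (q n))"
  have u: "u n = step (\<mu> n) (s n * \<gamma> (\<mu> n)) (delay n) (u n)" for n
    unfolding u_def sol_def \<mu>_def s_def by (rule step_tonelli[symmetric])
  have fix1: "\<theta> (\<mu> n, u n) = \<mu> n" and fix2: "clamp (s n + source (delay n) (u n) 1) = s n" for n
    using q(2)[of n] by (auto simp: G_def \<mu>_def s_def u_def prod_eq_iff)
  have "\<mu> n \<in> {0..L}" "s n \<in> {m..M}" for n
    using q(1)[of n] by (auto simp: Q_def \<mu>_def s_def mem_Times_iff)
  then obtain k \<mu>' s' u' where k: "strict_mono (k :: nat \<Rightarrow> nat)" "\<mu>' \<in> {0..L}" "s' \<in> {m..M}"
    "(\<lambda>n. \<mu> (k n)) \<longlonglongrightarrow> \<mu>'" "(\<lambda>n. s (k n)) \<longlonglongrightarrow> s'" "(\<lambda>n. u (k n)) \<longlonglongrightarrow> u'"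
    "u' = step \<mu>' (s' * \<gamma> \<mu>') 0 u'"
    using delayed_limit[OF _ _ delay_nonneg delay_tendsto u \<gamma>(1), of m M] by blast
  have "(\<lambda>n. \<theta> (\<mu> (k n), u (k n))) \<longlonglongrightarrow> \<theta> (\<mu>', u')"
    by (rule continuous_on_tendsto_compose[OF \<theta>(1) tendsto_Pair[OF k(4,6)]]) auto
  then have level: "\<theta> (\<mu>', u') = \<mu>'"
    unfolding fix1 using k(4) LIMSEQ_unique by blast
  have "(\<lambda>n. source (delay (k n)) (u (k n)) 1) \<longlonglongrightarrow> source 0 u' 1"
    by (rule source_1_tendsto[OF delay_nonneg _ k(6)])
       (use LIMSEQ_subseq_LIMSEQ[OF delay_tendsto k(1)] in \<open>simp add: o_def\<close>)
  then have "(\<lambda>n. clamp (s (k n) + source (delay (k n)) (u (k n)) 1)) \<longlonglongrightarrow> clamp (s' + source 0 u' 1)"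
    unfolding clamp_def by (intro tendsto_max tendsto_min tendsto_const tendsto_add k(5))
  then have clamp: "clamp (s' + source 0 u' 1) = s'"
    unfolding fix2 using k(5) LIMSEQ_unique by blast
  have "source 0 u' 1 = 0"
  proof (cases "\<mu>' = 0")
    case True
    then show ?thesis
      using solution_parameter_0(2)[OF F0] k(7) \<gamma>(2) by simp
  next
    case False
    then have \<mu>': "0 < \<mu>'" "\<mu>' \<le> L"
      using k(2) by auto
    \<comment> \<open>A fixed point of the clamped translation is a zero of the source integral, unless the
      translation points out of the interval.\<close>
    have "source 0 u' 1 = 0 \<or> s' = m \<and> source 0 u' 1 \<le> 0 \<or> s' = M \<and> 0 \<le> source 0 u' 1"
      using clamp k(3) by (auto simp: clamp_def max_def min_def split: if_splits)
    then show ?thesis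
      using bottom[OF \<mu>'] top[OF \<mu>'] k(7) by force
  qed
  then have "(\<mu>', u') \<in> branch \<gamma> m M L"
    using k(2,3,7) by (auto simp: branch_def)
  with level show ?thesis
    by (intro bexI[of _ "(\<mu>', u')"]) simp_all
qed

lemma branch_continuum:
  assumes "0 < L" "m \<le> M" and F0: "F 0 = 0"
    and \<gamma>: "continuous_on {0..L} \<gamma>" "\<gamma> 0 = 0"
    and bottom: "\<And>\<mu> u. 0 < \<mu> \<Longrightarrow> \<mu> \<le> L \<Longrightarrow> u = step \<mu> (m * \<gamma> \<mu>) 0 u \<Longrightarrow> 0 \<le> source 0 u 1"
    and top: "\<And>\<mu> u. 0 < \<mu> \<Longrightarrow> \<mu> \<le> L \<Longrightarrow> u = step \<mu> (M * \<gamma> \<mu>) 0 u \<Longrightarrow> source 0 u 1 \<le> 0"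
  shows "\<exists>C. connected C \<and> C \<subseteq> branch \<gamma> m M L \<and> (0, 0) \<in> C \<and> (\<exists>q\<in>C. fst q = L)"
proof (rule connected_subset_reaching_level[OF branch_compact[OF \<gamma>(1)]])
  have step_0: "step 0 (s * \<gamma> 0) 0 0 = 0" for s
    by (rule C1_eqI) (simp add: C1_fun_step(1) slope_nonneg_arg C1_fun_zero \<gamma>(2))
  then have "(0 :: C1) = step 0 0 0 0"
    using \<gamma>(2) by simp
  from solution_parameter_0(2)[OF F0 this] show "(0, 0) \<in> branch \<gamma> m M L"
    using assms(1,2) step_0[of m] by (auto simp: branch_def intro!: bexI[of _ m])
  show "q = (0, 0)" if "q \<in> branch \<gamma> m M L" "fst q = 0" for q
    using that solution_parameter_0(1)[OF F0] \<gamma>(2) by (auto simp: branch_def)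
  show "\<exists>q\<in>branch \<gamma> m M L. \<theta> q = fst q" if "continuous_on UNIV \<theta>" "range \<theta> \<subseteq> {0..L}" for \<theta>
    by (rule branch_fixed_level[OF assms that])
qed (fact \<open>0 < L\<close>)

end

section \<open>Sign-changing weights\<close>

lemma C1_fun_diff_le_deriv:
  assumes "0 \<le> s" "s \<le> t" "t \<le> 1" "\<And>x. x \<in> {s..t} \<Longrightarrow> C1_deriv u x \<le> K"
  shows "C1_fun u t - C1_fun u s \<le> K * (t - s)"
proof -
  have "integral {s..t} (C1_deriv u) \<le> integral {s..t} (\<lambda>_. K)"
    by (rule integral_le)
       (use assms in \<open>auto intro: bdd_meas_integrable_on[OF has_bdd_densityD(1)[OF C1_has_bdd_density]]\<close>)
  then show ?thesis
    using assms(2) by (simp add: has_bdd_density_diff[OF C1_has_bdd_density assms(1-3)] mult.commute)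
qed

lemma C1_fun_diff_ge_deriv:
  assumes "0 \<le> s" "s \<le> t" "t \<le> 1" "\<And>x. x \<in> {s..t} \<Longrightarrow> K \<le> C1_deriv u x"
  shows "K * (t - s) \<le> C1_fun u t - C1_fun u s"
proof -
  have "integral {s..t} (\<lambda>_. K) \<le> integral {s..t} (C1_deriv u)"
    by (rule integral_le)
       (use assms in \<open>auto intro: bdd_meas_integrable_on[OF has_bdd_densityD(1)[OF C1_has_bdd_density]]\<close>)
  then show ?thesis
    using assms(2) by (simp add: has_bdd_density_diff[OF C1_has_bdd_density assms(1-3)] mult.commute)
qed

locale sign_changing_problem = delayed_problem +
  fixes z :: real
  assumes z: "0 < z" "z < 1"
    and b_nonneg: "\<And>x. x \<in> {0..z} \<Longrightarrow> 0 \<le> b x" and b_nonpos: "\<And>x. x \<in> {z..1} \<Longrightarrow> b x \<le> 0"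
    and F_nonpos: "\<And>v. v \<le> 0 \<Longrightarrow> F v = 0"
begin

lemma delayed_0: "0 \<le> r \<Longrightarrow> delayed 0 u r = C1_fun u r"
  by (simp add: delayed_def)

lemmas density_0 = source_density[OF order_refl]

lemma source_mono:
  assumes "0 \<le> s" "s \<le> t" "t \<le> z"
  shows "source 0 u s \<le> source 0 u t"
proof -
  have "source 0 u t - source 0 u s = integral {s..t} (\<lambda>r. b r * F (delayed 0 u r))"
    by (rule has_bdd_density_diff[OF density_0]) (use assms z in auto)
  also have "\<dots> \<ge> 0"
    by (rule Henstock_Kurzweil_Integration.integral_nonneg)
       (use assms z in \<open>auto intro!: bdd_meas_integrable_on integrand_bdd_meas mult_nonneg_nonneg b_nonneg F_nonneg\<close>)
  finally show ?thesis by simp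
qed

lemma source_antimono:
  assumes "z \<le> s" "s \<le> t" "t \<le> 1"
  shows "source 0 u t \<le> source 0 u s"
proof -
  have "source 0 u t - source 0 u s = integral {s..t} (\<lambda>r. b r * F (delayed 0 u r))"
    by (rule has_bdd_density_diff[OF density_0]) (use assms z in auto)
  also have "\<dots> \<le> integral {s..t} (\<lambda>_. 0)"
    by (rule integral_le)
       (use assms z in \<open>auto intro!: bdd_meas_integrable_on integrand_bdd_meas bdd_meas_const mult_nonpos_nonneg b_nonpos F_nonneg\<close>)
  finally show ?thesis by simp
qed

lemma source_nonneg_left: "0 \<le> x \<Longrightarrow> x \<le> z \<Longrightarrow> 0 \<le> source 0 u x"
  using source_mono[of 0 x u] by (simp add: source_0)

lemma source_nonneg:
  assumes "0 \<le> source 0 u 1" "x \<in> {0..1}"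
  shows "0 \<le> source 0 u x"
  using source_nonneg_left[of x u] source_antimono[of x 1 u] assms by (cases "x \<le> z") auto

text \<open>If the mean of \<open>b\<close> is negative, so is the integral of \<open>b F(u)\<close> whenever \<open>F(u)\<close> is close to a
  positive constant.\<close>

lemma source_1_le:
  assumes K: "\<And>x. x \<in> {0..1} \<Longrightarrow> \<bar>F (C1_fun u x) - K\<bar> \<le> d"
  shows "source 0 u 1 \<le> K * integral {0..1} b + A * d"
proof -
  define k where "k = (\<lambda>r. b r * F (delayed 0 u r) + (- K) * b r)"
  have Kb: "bdd_meas (\<lambda>r. (- K) * b r)"
    by (intro bdd_meas_mult bdd_meas_const b_meas)
  have k: "bdd_meas k"
    unfolding k_def by (intro bdd_meas_add Kb integrand_bdd_meas) simp
  have "integral {0..1} k = source 0 u 1 + integral {0..1} (\<lambda>r. (- K) * b r)"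
    unfolding k_def source_def
    by (intro Henstock_Kurzweil_Integration.integral_add bdd_meas_integrable_on Kb integrand_bdd_meas) auto
  then have "source 0 u 1 - K * integral {0..1} b = integral {0..1} k"
    by simp
  also have "\<dots> \<le> \<bar>integral {0..1} k\<bar>"
    by simp
  also have "\<dots> \<le> A * d * (1 - 0)"
  proof (rule abs_integral_le[OF k])
    fix r :: real assume r: "r \<in> {0..1}"
    have "\<bar>k r\<bar> = \<bar>b r\<bar> * \<bar>F (C1_fun u r) - K\<bar>"
      using r by (simp add: k_def delayed_0 algebra_simps flip: abs_mult)
    also have "\<dots> \<le> A * d"
      by (intro mult_mono b_le[OF r] K[OF r] A_nonneg) simp
    finally show "\<bar>k r\<bar> \<le> A * d" .
  qed auto
  finally show ?thesis
    by simp
qed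

section \<open>Solutions of the initial value problem\<close>

context
  fixes \<mu> c :: real and u :: C1
  assumes \<mu>: "0 \<le> \<mu>" "\<mu> * (A * B) \<le> 1 / 2" and u: "u = step \<mu> c 0 u"
begin

lemma solution_0: "C1_fun u 0 = c"
  by (subst u) (simp add: C1_fun_step(1))

lemma solution_deriv: "x \<in> {0..1} \<Longrightarrow> C1_deriv u x = slope (- \<mu> * source 0 u x)"
  by (subst u) (rule C1_fun_step(2), simp_all)

lemma solution_antimono:
  assumes "0 \<le> s" "s \<le> t" "t \<le> 1"
  shows "C1_fun u t \<le> C1_fun u s"
  using C1_fun_diff_le_deriv[OF assms, of u 0] assms solution_deriv slope_nonpos by force

lemma solution_le: "x \<in> {0..1} \<Longrightarrow> C1_fun u x \<le> c"
  using solution_antimono[of 0 x] by (simp add: solution_0)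

lemma flux_bound:
  assumes "x \<in> {0..1}"
  shows "\<mu> * source 0 u x \<le> 1 / 2"
proof -
  have "\<mu> * source 0 u x \<le> \<mu> * (A * B)"
    using abs_source_le[OF order_refl assms, of u] \<mu>(1) by (intro mult_left_mono) auto
  then show ?thesis
    using \<mu>(2) by simp
qed

lemma solution_deriv_ge:
  assumes x: "x \<in> {0..1}" and N: "\<And>t. t \<in> {0..1} \<Longrightarrow> F (C1_fun u t) \<le> N"
  shows "- 2 * (\<mu> * (A * N)) \<le> C1_deriv u x"
proof -
  have "0 \<le> N"
    using F_nonneg[of "C1_fun u 0"] N[of 0] by simp
  have "\<bar>source 0 u x\<bar> \<le> A * N * (x - 0)"
    unfolding source_def
  proof (rule abs_integral_le)
    show "bdd_meas (\<lambda>r. b r * F (delayed 0 u r))"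
      by (rule integrand_bdd_meas) simp
    show "\<bar>b r * F (delayed 0 u r)\<bar> \<le> A * N" if "r \<in> {0..x}" for r
      unfolding abs_mult using that x N[of r] b_le[of r] F_nonneg A_nonneg
      by (intro mult_mono) (auto simp: delayed_0)
  qed (use x in auto)
  also have "\<dots> \<le> A * N"
    using x A_nonneg \<open>0 \<le> N\<close> by (auto intro!: mult_left_le)
  finally have s: "source 0 u x \<le> A * N"
    by simp
  show ?thesis
  proof (cases "0 \<le> source 0 u x")
    case True
    have "- 2 * (\<mu> * (A * N)) \<le> 2 * (- \<mu> * source 0 u x)"
      using mult_left_mono[OF s \<mu>(1)] by simp
    also have "\<dots> \<le> slope (- \<mu> * source 0 u x)"
      by (rule slope_bounds(1)) (use flux_bound[OF x] True \<mu>(1) in auto)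
    finally show ?thesis
      by (simp add: solution_deriv[OF x])
  next
    case False
    then have "slope (- \<mu> * source 0 u x) = 0"
      using \<mu>(1) by (intro slope_nonneg_arg) (simp add: mult_nonneg_nonpos)
    then show ?thesis
      using \<mu>(1) A_nonneg \<open>0 \<le> N\<close> by (simp add: solution_deriv[OF x])
  qed
qed

lemma solution_ge:
  assumes x: "x \<in> {0..1}" and N: "\<And>t. t \<in> {0..1} \<Longrightarrow> F (C1_fun u t) \<le> N"
  shows "c - 2 * (\<mu> * (A * N)) \<le> C1_fun u x"
proof -
  have "0 \<le> N"
    using F_nonneg[of "C1_fun u 0"] N[of 0] by simp
  have "- 2 * (\<mu> * (A * N)) * (x - 0) \<le> C1_fun u x - C1_fun u 0"
    by (rule C1_fun_diff_ge_deriv) (use x N in \<open>auto intro!: solution_deriv_ge[simplified]\<close>)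
  moreover have "2 * (\<mu> * (A * N)) * x \<le> 2 * (\<mu> * (A * N)) * 1"
    using x \<mu>(1) A_nonneg \<open>0 \<le> N\<close> by (intro mult_left_mono) auto
  ultimately show ?thesis
    by (simp add: solution_0)
qed

text \<open>If \<open>u\<close> is not positive at \<open>z\<close>, the negative part of the weight contributes nothing. Otherwise
  \<open>c\<close> is too small: \<open>u\<close> is concave on \<open>[0, z]\<close>, hence at least \<open>c / 2\<close> on \<open>[0, z / 2]\<close>. This
  bounds the slope at \<open>z / 2\<close> from below by the \<open>\<mu>\<close>-fold of \<open>K\<close> times the mass of \<open>b\<close> on
  \<open>[0, z / 2]\<close>, and the decrease of \<open>u\<close> on \<open>[z / 2, z]\<close> is at least \<open>c\<close>, more than is left
  at \<open>z / 2\<close>.\<close>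

lemma source_1_nonneg_small:
  assumes K: "\<And>v. c / 2 \<le> v \<Longrightarrow> v \<le> c \<Longrightarrow> K \<le> F v"
    and c: "c \<le> z / 2 * (\<mu> * (K * integral {0..z / 2} b))"
  shows "0 \<le> source 0 u 1"
proof (cases "C1_fun u z \<le> 0")
  case True
  have "source 0 u 1 - source 0 u z = integral {z..1} (\<lambda>r. b r * F (delayed 0 u r))"
    by (rule has_bdd_density_diff[OF density_0]) (use z in auto)
  also have "\<dots> = integral {z..1} (\<lambda>r. 0)"
  proof (rule Henstock_Kurzweil_Integration.integral_cong)
    fix r assume r: "r \<in> {z..1}"
    then have "C1_fun u r \<le> 0"
      using True solution_antimono[of z r] z by auto
    then show "b r * F (delayed 0 u r) = 0"
      using r z by (simp add: delayed_0 F_nonpos)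
  qed
  finally show ?thesis
    using source_nonneg_left[of z u] z by simp
next
  case False
  define D where "D = - slope (- \<mu> * source 0 u (z / 2))"
  have mid: "z / 2 \<in> {0..1}"
    using z by auto
  have "- D * (z / 2 - 0) \<le> C1_fun u (z / 2) - C1_fun u 0"
  proof (rule C1_fun_diff_ge_deriv)
    fix x assume x: "x \<in> {0..z / 2}"
    then have "slope (- \<mu> * source 0 u (z / 2)) \<le> slope (- \<mu> * source 0 u x)"
      using source_mono[of x "z / 2" u] z \<mu>(1) by (intro slope_mono) (simp add: mult_left_mono)
    then show "- D \<le> C1_deriv u x"
      using x z by (simp add: D_def solution_deriv)
  qed (use z in auto)
  moreover have "C1_fun u z - C1_fun u (z / 2) \<le> - D * (z - z / 2)"
  proof (rule C1_fun_diff_le_deriv)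
    fix x assume x: "x \<in> {z / 2..z}"
    then have "slope (- \<mu> * source 0 u x) \<le> slope (- \<mu> * source 0 u (z / 2))"
      using source_mono[of "z / 2" x u] z \<mu>(1) by (intro slope_mono) (simp add: mult_left_mono)
    then show "C1_deriv u x \<le> - D"
      using x z by (simp add: D_def solution_deriv)
  qed (use z in auto)
  ultimately have D: "c - z / 2 * D \<le> C1_fun u (z / 2)" "z / 2 * D < C1_fun u (z / 2)"
    using False by (simp_all add: solution_0 algebra_simps)
  have "K * integral {0..z / 2} b = integral {0..z / 2} (\<lambda>r. K * b r)"
    by simp
  also have "\<dots> \<le> source 0 u (z / 2)"
    unfolding source_def
  proof (rule integral_le)
    show "(\<lambda>r. K * b r) integrable_on {0..z / 2}" "(\<lambda>r. b r * F (delayed 0 u r)) integrable_on {0..z / 2}"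
      using z by (auto intro!: bdd_meas_integrable_on bdd_meas_mult bdd_meas_const b_meas integrand_bdd_meas)
    fix r assume r: "r \<in> {0..z / 2}"
    have "C1_fun u (z / 2) \<le> C1_fun u r" "C1_fun u r \<le> c"
      using solution_antimono[of r "z / 2"] solution_le[of r] r z by auto
    then have "K \<le> F (C1_fun u r)"
      using D by (intro K) auto
    then show "K * b r \<le> b r * F (delayed 0 u r)"
      using b_nonneg[of r] r z by (simp add: delayed_0 mult.commute[of K] mult_left_mono)
  qed
  finally have "\<mu> * (K * integral {0..z / 2} b) \<le> \<mu> * source 0 u (z / 2)"
    using \<mu>(1) by (rule mult_left_mono)
  also have "\<dots> \<le> D"
    unfolding D_def using slope_bounds(2)[of "- \<mu> * source 0 u (z / 2)"] flux_bound[OF mid]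
      source_nonneg_left[of "z / 2" u] z \<mu>(1) by auto
  finally have "z / 2 * (\<mu> * (K * integral {0..z / 2} b)) \<le> z / 2 * D"
    using z by (intro mult_left_mono) auto
  then have "c < C1_fun u (z / 2)"
    using c D(2) by linarith
  then show ?thesis
    using solution_le[OF mid] by simp
qed

text \<open>Beyond a zero of the nonincreasing function \<open>u\<close>, \<open>F(u)\<close> vanishes and the flux is constant. As it vanishes at \<open>1\<close>,
  the function stays at zero: it may have a dead core, but does not become negative.\<close>

lemma solution_nonneg:
  assumes "source 0 u 1 = 0" "0 \<le> c" "x \<in> {0..1}"
  shows "0 \<le> C1_fun u x"
proof (rule ccontr)
  assume neg: "\<not> 0 \<le> C1_fun u x"
  have "\<exists>t\<ge>0. t \<le> x \<and> C1_fun u t = 0"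
    by (rule IVT2') (use neg assms solution_0 in \<open>auto intro: continuous_on_subset[OF C1_fun_continuous]\<close>)
  then obtain t where t: "0 \<le> t" "t \<le> x" "C1_fun u t = 0"
    by blast
  have "source 0 u s = 0" if s: "t \<le> s" "s \<le> 1" for s
  proof -
    have "source 0 u 1 - source 0 u s = integral {s..1} (\<lambda>r. b r * F (delayed 0 u r))"
      by (rule has_bdd_density_diff[OF density_0]) (use s t in auto)
    also have "\<dots> = integral {s..1} (\<lambda>r. 0)"
    proof (rule Henstock_Kurzweil_Integration.integral_cong)
      fix r assume r: "r \<in> {s..1}"
      then have "C1_fun u r \<le> 0"
        using solution_antimono[of t r] t s by auto
      then show "b r * F (delayed 0 u r) = 0"
        using r t s by (simp add: delayed_0 F_nonpos)
    qed
    finally show ?thesis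
      using assms(1) by simp
  qed
  then have "C1_deriv u s = 0" if "s \<in> {t..x}" for s
    using that t assms(3) by (simp add: solution_deriv slope_nonneg_arg)
  then have "0 * (x - t) \<le> C1_fun u x - C1_fun u t"
    by (intro C1_fun_diff_ge_deriv) (use t assms(3) in auto)
  then show False
    using neg t by simp
qed

text \<open>Where the truncation is inactive, the slope is a smooth function of the flux and the flux is a
  primitive, so the chain rule provides the second derivative.\<close>

lemma
  assumes J: "source 0 u 1 = 0"
  shows solution_flux: "has_bdd_density (flux u) (\<lambda>r. - \<mu> * (b r * F (delayed 0 u r)))"
    and solution_neumann: "neumann u"
    and solution_sobolev: "C1_fun u \<in> sobolev1 2"
proof -
  define y where "y = (\<lambda>x. - \<mu> * source 0 u x)"
  have y_range: "- 1 / 2 \<le> y x" "y x \<le> 0" if "x \<in> {0..1}" for x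
    using flux_bound[OF that] source_nonneg[OF _ that, of u] J \<mu>(1) by (auto simp: y_def)
  have deriv: "C1_deriv u x = y x / sqrt (1 - (y x)\<^sup>2)" if "x \<in> {0..1}" for x
    using solution_deriv[OF that] slope_eq[OF y_range[OF that]] by (simp add: y_def)
  have pos: "0 < 1 - (y x)\<^sup>2" if "x \<in> {0..1}" for x
  proof -
    have "0 < sqrt (1 - (y x)\<^sup>2)"
      using slope_arg_sqrt(1)[OF y_range[OF that]] by linarith
    then show ?thesis by simp
  qed
  have y: "has_bdd_density y (\<lambda>r. - \<mu> * (b r * F (delayed 0 u r)))"
    unfolding y_def by (rule has_bdd_density_cmult[OF density_0])
  have "flux u x = y x" if "x \<in> {0..1}" for x
  proof -
    have "1 + (y x / sqrt (1 - (y x)\<^sup>2))\<^sup>2 = 1 / (1 - (y x)\<^sup>2)"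
      using pos[OF that] by (simp add: power_divide field_simps)
    then show ?thesis
      using pos[OF that] by (simp add: flux_def deriv[OF that] real_sqrt_divide)
  qed
  then show "has_bdd_density (flux u) (\<lambda>r. - \<mu> * (b r * F (delayed 0 u r)))"
    by (rule has_bdd_density_cong[OF y _ refl])
  show "neumann u"
    using J by (simp add: neumann_def deriv y_def source_0)
  define H' where "H' = (\<lambda>v::real. 1 / (sqrt (1 - v\<^sup>2) * (1 - v\<^sup>2)))"
  have H: "((\<lambda>v. v / sqrt (1 - v\<^sup>2)) has_real_derivative H' v) (at v)" if "0 < 1 - v\<^sup>2" for v :: real
    using that
    by (auto intro!: derivative_eq_intros simp: H'_def divide_simps) (auto simp: power2_eq_square algebra_simps)
  have "has_bdd_density (\<lambda>x. y x / sqrt (1 - (y x)\<^sup>2)) (\<lambda>x. H' (y x) * (- \<mu> * (b x * F (delayed 0 u x))))"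
  proof (rule has_bdd_density_chain[OF y])
    show "((\<lambda>v. v / sqrt (1 - v\<^sup>2)) has_real_derivative H' (y x)) (at (y x))" if "x \<in> {0..1}" for x
      by (rule H[OF pos[OF that]])
    show "continuous_on {0..1} (\<lambda>x. H' (y x))"
      unfolding H'_def by (intro continuous_intros has_bdd_density_continuous[OF y]) (use pos in force)
  qed
  then have d2: "has_bdd_density (C1_deriv u) (\<lambda>x. H' (y x) * (- \<mu> * (b x * F (delayed 0 u x))))"
    by (rule has_bdd_density_cong) (simp_all add: deriv)
  have "\<exists>v. weak_deriv n (C1_fun u) v" if "n \<le> 2" for n
  proof -
    have "integrable leb01 (C1_fun u)"
      by (intro bdd_meas_integrable_leb01 bdd_meas_continuous C1_fun_continuous)
    then have "weak_deriv 0 (C1_fun u) (C1_fun u)"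
      by (simp add: weak_deriv_def)
    moreover have "n = 0 \<or> n = 1 \<or> n = 2"
      using that by auto
    ultimately show ?thesis
      using weak_deriv_1_density[OF C1_has_bdd_density[of u]] weak_deriv_2_density[OF C1_has_bdd_density d2] by blast
  qed
  then show "C1_fun u \<in> sobolev1 2"
    by (simp add: sobolev1_def)
qed

end

text \<open>Conversely, the flux of a solution lies in \<open>[-1/2, 0]\<close>, where the truncation is inactive, and
  determines the slope.\<close>

lemma step_of_flux:
  assumes \<mu>: "0 < \<mu>" "\<mu> * (A * B) \<le> 1 / 2" and "neumann u"
    and flux: "has_bdd_density (flux u) (\<lambda>r. - \<mu> * (b r * F (delayed 0 u r)))"
  shows "u = step \<mu> (C1_fun u 0) 0 u" and "source 0 u 1 = 0"
proof -
  have flux_eq: "flux u x = - \<mu> * source 0 u x" if "x \<in> {0..1}" for x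
    using has_bdd_densityD(2)[OF flux that] \<open>neumann u\<close>
    by (simp add: neumann_def flux_def source_def)
  from this[of 1] show J: "source 0 u 1 = 0"
    using \<mu>(1) \<open>neumann u\<close> by (simp add: neumann_def flux_def)
  have "C1_deriv u x = slope (- \<mu> * source 0 u x)" if x: "x \<in> {0..1}" for x
  proof -
    define d where "d = C1_deriv u x"
    have pos: "0 < 1 + d\<^sup>2"
      by (simp add: add_pos_nonneg)
    have y: "flux u x = d / sqrt (1 + d\<^sup>2)"
      by (simp add: flux_def d_def)
    have "1 - (d / sqrt (1 + d\<^sup>2))\<^sup>2 = 1 / (1 + d\<^sup>2)"
      using pos by (simp add: power_divide field_simps)
    then have "flux u x / sqrt (1 - (flux u x)\<^sup>2) = d"
      using pos by (simp add: y real_sqrt_divide)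
    moreover have "- 1 / 2 \<le> flux u x" "flux u x \<le> 0"
    proof -
      have "\<mu> * source 0 u x \<le> \<mu> * (A * B)"
        using abs_source_le[OF order_refl x, of u] \<mu>(1) by (intro mult_left_mono) auto
      then show "- 1 / 2 \<le> flux u x"
        using \<mu>(2) by (simp add: flux_eq[OF x])
      show "flux u x \<le> 0"
        using source_nonneg[OF _ x, of u] J \<mu>(1) by (simp add: flux_eq[OF x])
    qed
    ultimately show ?thesis
      using slope_eq[of "flux u x"] by (simp add: flux_eq[OF x] d_def)
  qed
  note deriv = this
  show "u = step \<mu> (C1_fun u 0) 0 u"
  proof (rule C1_eqI)
    fix x :: real assume x: "x \<in> {0..1}"
    have "C1_fun u x = C1_fun u 0 + integral {0..x} (C1_deriv u)"
      by (rule has_bdd_densityD(2)[OF C1_has_bdd_density x])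
    also have "integral {0..x} (C1_deriv u) = integral {0..x} (\<lambda>x. slope (- \<mu> * source 0 u x))"
      by (rule Henstock_Kurzweil_Integration.integral_cong) (use x deriv in auto)
    finally show "C1_fun u x = C1_fun (step \<mu> (C1_fun u 0) 0 u) x"
      by (simp add: C1_fun_step(1)[OF order_refl x])
  qed
qed

end

context sign_changing_problem
begin

section \<open>Regular solutions\<close>

lemma regular_solution_of_step:
  assumes ab: "AE x in leb01. a x = b x" and fF: "\<And>v. 0 \<le> v \<Longrightarrow> F v = f v"
    and \<mu>: "0 \<le> \<mu>" "\<mu> * (A * B) \<le> 1 / 2" and u: "u = step \<mu> c 0 u"
    and J: "source 0 u 1 = 0" and c: "0 < c"
  shows "regular_solution a f \<mu> u" and "positive_C1 u"
proof -
  have u_nonneg: "0 \<le> C1_fun u x" if "x \<in> {0..1}" for x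
    using solution_nonneg[OF \<mu> u J _ that] c by simp
  define g where "g = (\<lambda>r. - \<mu> * (b r * F (delayed 0 u r)))"
  have "AE x in leb01. - g x = \<mu> * a x * f (C1_fun u x)"
    using ab AE_space[of leb01]
  proof eventually_elim
    case (elim x)
    then have x: "x \<in> {0..1}" by simp
    then show ?case
      using elim(1) fF[OF u_nonneg[OF x]] by (simp add: g_def delayed_0)
  qed
  moreover have "weak_deriv 1 (flux u) g"
    unfolding g_def by (rule weak_deriv_1_density[OF solution_flux[OF \<mu> u J]])
  ultimately show "regular_solution a f \<mu> u"
    using solution_neumann[OF \<mu> u J] solution_sobolev[OF \<mu> u J] by (auto simp: regular_solution_def)
  have bdd: "bdd_above (C1_fun u ` {0..1})"
    by (intro bounded_imp_bdd_above compact_imp_bounded compact_continuous_image C1_fun_continuous) simp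
  have "c \<le> (SUP x\<in>{0..1}. C1_fun u x)"
    using cSUP_upper[OF _ bdd, of 0] solution_0[OF \<mu> u] by simp
  moreover have "0 \<le> (INF x\<in>{0..1}. C1_fun u x)"
    by (rule cINF_greatest) (use u_nonneg in auto)
  ultimately show "positive_C1 u"
    using c by (simp add: positive_C1_def)
qed

lemma step_of_regular_solution:
  assumes ab: "AE x in leb01. a x = b x" and fF: "\<And>v. 0 \<le> v \<Longrightarrow> F v = f v"
    and \<mu>: "0 < \<mu>" "\<mu> * (A * B) \<le> 1 / 2"
    and u: "regular_solution a f \<mu> u" "positive_C1 u"
  shows "\<And>x. x \<in> {0..1} \<Longrightarrow> 0 \<le> C1_fun u x"
    and "u = step \<mu> (C1_fun u 0) 0 u" and "source 0 u 1 = 0"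
proof -
  have bdd: "bdd_below (C1_fun u ` {0..1})"
    by (intro bounded_imp_bdd_below compact_imp_bounded compact_continuous_image C1_fun_continuous) simp
  show u_nonneg: "0 \<le> C1_fun u x" if "x \<in> {0..1}" for x
    using cINF_lower[OF bdd that] u(2) by (simp add: positive_C1_def)
  define k where "k = (\<lambda>r. - \<mu> * (b r * F (delayed 0 u r)))"
  obtain g where g: "weak_deriv 1 (flux u) g" "AE x in leb01. - g x = \<mu> * a x * f (C1_fun u x)"
    using u(1) by (auto simp: regular_solution_def)
  have "AE x in leb01. g x = k x"
    using ab g(2) AE_space[of leb01]
  proof eventually_elim
    case (elim x)
    then have x: "x \<in> {0..1}" by simp
    then show ?case
      using elim(1,2) fF[OF u_nonneg[OF x]] by (simp add: k_def delayed_0)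
  qed
  moreover have "continuous_on {0..1} (flux u)"
    unfolding flux_def
  proof (intro continuous_intros C1_deriv_continuous ballI)
    show "sqrt (1 + (C1_deriv u x)\<^sup>2) \<noteq> 0" for x
      using sum_power2_gt_zero_iff[of 1 "C1_deriv u x"] by auto
  qed
  moreover have "bdd_meas k"
    unfolding k_def by (intro bdd_meas_mult[of "\<lambda>_. - \<mu>"] bdd_meas_const integrand_bdd_meas) simp
  ultimately have "has_bdd_density (flux u) k"
    using weak_deriv_1_imp_density[OF _ _ g(1)] by blast
  moreover have "neumann u"
    using u(1) by (simp add: regular_solution_def)
  ultimately show "u = step \<mu> (C1_fun u 0) 0 u" "source 0 u 1 = 0"
    using step_of_flux[OF \<mu>, of u] by (auto simp: k_def)
qed

section \<open>Sign conditions for sublinear nonlinearities\<close>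

text \<open>Both sides of the last condition on \<open>c\<close> are proportional to \<open>\<mu>\<close> if \<open>c\<close> is a constant multiple
  of \<open>\<mu>\<close> to the power \<open>1 / (1 - p)\<close>.\<close>

lemma source_1_nonneg_bottom:
  assumes \<mu>: "0 \<le> \<mu>" "\<mu> * (A * B) \<le> 1 / 2" and u: "u = step \<mu> c 0 u"
    and p: "0 < p" "p < 1"
    and near: "\<And>v. 0 < v \<Longrightarrow> v \<le> v0 \<Longrightarrow> v powr p / 2 \<le> F v"
    and c: "0 < c" "c \<le> v0" "c powr (1 - p) \<le> z / 8 * integral {0..z / 2} b * \<mu>"
  shows "0 \<le> source 0 u 1"
proof (rule source_1_nonneg_small[OF \<mu> u])
  fix v assume v: "c / 2 \<le> v" "v \<le> c"
  then have "(c / 2) powr p \<le> v powr p"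
    using c(1) p by (intro powr_mono2) auto
  then show "(c / 2) powr p / 2 \<le> F v"
    using near[of v] v c by simp
next
  have "c powr p / 2 \<le> (c / 2) powr p"
  proof -
    have "c powr p * (1 / 2) powr 1 \<le> c powr p * (1 / 2) powr p"
      using p by (intro mult_left_mono powr_mono') auto
    also have "\<dots> = (c / 2) powr p"
      using c(1) by (simp flip: powr_mult)
    finally show ?thesis by simp
  qed
  moreover have nonneg: "0 \<le> z / 4 * integral {0..z / 2} b * \<mu>"
    using c(3) powr_ge_zero[of c "1 - p"] by linarith
  ultimately have le: "z / 4 * integral {0..z / 2} b * \<mu> * (c powr p / 2) \<le> z / 4 * integral {0..z / 2} b * \<mu> * (c / 2) powr p"
    by (intro mult_left_mono)
  have "c = c powr (1 - p) * c powr p"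
    using c(1) by (simp flip: powr_add)
  also have "\<dots> \<le> z / 8 * integral {0..z / 2} b * \<mu> * c powr p"
    using c(3) by (intro mult_right_mono) auto
  also have "\<dots> \<le> z / 2 * (\<mu> * ((c / 2) powr p / 2 * integral {0..z / 2} b))"
    using le by (simp add: algebra_simps)
  finally show "c \<le> z / 2 * (\<mu> * ((c / 2) powr p / 2 * integral {0..z / 2} b))" .
qed

text \<open>The decrease of \<open>u\<close> is of the order \<open>\<mu> c\<^sup>p\<close>. The last condition on \<open>c\<close> makes this small
  relative to \<open>c\<close>, so that \<open>F(u)\<close> is close to the constant \<open>c\<^sup>p\<close>.\<close>

lemma source_1_nonpos_top:
  assumes \<mu>: "0 \<le> \<mu>" "\<mu> * (A * B) \<le> 1 / 2" and u: "u = step \<mu> c 0 u"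
    and p: "0 < p" "p < 1" and \<delta>: "0 < \<delta>" "\<delta> \<le> 1" "integral {0..1} b + A * \<delta> \<le> 0"
    and near: "\<And>v. 0 < v \<Longrightarrow> v \<le> v0 \<Longrightarrow> \<bar>F v - v powr p\<bar> \<le> \<delta> / 2 * v powr p"
    and c: "0 < c" "c \<le> v0" "8 * A * \<mu> \<le> \<delta> * c powr (1 - p)"
  shows "source 0 u 1 \<le> 0"
proof -
  have N: "F (C1_fun u t) \<le> 2 * c powr p" if t: "t \<in> {0..1}" for t
  proof (cases "C1_fun u t \<le> 0")
    case False
    have le: "C1_fun u t \<le> c"
      by (rule solution_le[OF \<mu> u t])
    have "\<bar>F (C1_fun u t) - C1_fun u t powr p\<bar> \<le> \<delta> / 2 * C1_fun u t powr p"
      by (rule near) (use False le c(2) in auto)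
    then have "F (C1_fun u t) \<le> C1_fun u t powr p + \<delta> / 2 * C1_fun u t powr p"
      by linarith
    also have "\<dots> \<le> c powr p + 1 * c powr p"
      using False le p \<delta> by (intro add_mono mult_mono powr_mono2) auto
    finally show ?thesis by simp
  qed (simp add: F_nonpos)
  have cp: "c = c powr (1 - p) * c powr p"
    using c(1) by (simp flip: powr_add)
  have "8 * A * \<mu> * c powr p \<le> \<delta> * c powr (1 - p) * c powr p"
    using c(3) by (intro mult_right_mono) auto
  then have drop: "2 * (\<mu> * (A * (2 * c powr p))) \<le> \<delta> / 2 * c"
    by (subst (asm) mult.assoc[of \<delta>], subst (asm) cp[symmetric]) (simp add: algebra_simps)
  have "\<bar>F (C1_fun u t) - c powr p\<bar> \<le> \<delta> * c powr p" if t: "t \<in> {0..1}" for t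
  proof -
    define v where "v = C1_fun u t"
    have "v \<le> c"
      unfolding v_def by (rule solution_le[OF \<mu> u t])
    have "c - \<delta> / 2 * c \<le> v"
      using solution_ge[OF \<mu> u t N] drop unfolding v_def by linarith
    then have v: "(1 - \<delta> / 2) * c \<le> v"
      by (simp add: algebra_simps)
    have half: "0 < 1 - \<delta> / 2" "1 - \<delta> / 2 \<le> 1"
      using \<delta> by auto
    then have "0 < (1 - \<delta> / 2) * c"
      using c(1) by (intro mult_pos_pos)
    then have "0 < v"
      using v by linarith
    have vp: "v powr p \<le> c powr p"
      using \<open>0 < v\<close> \<open>v \<le> c\<close> p by (intro powr_mono2) auto
    have "(1 - \<delta> / 2) * c powr p \<le> (1 - \<delta> / 2) powr p * c powr p"
      using powr_mono'[of p 1 "1 - \<delta> / 2"] half p by (intro mult_right_mono) auto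
    also have "\<dots> = ((1 - \<delta> / 2) * c) powr p"
      using half c(1) by (simp add: powr_mult)
    also have "\<dots> \<le> v powr p"
      using v half c(1) p by (intro powr_mono2) auto
    finally have "\<bar>v powr p - c powr p\<bar> \<le> \<delta> / 2 * c powr p"
      using vp by (simp add: algebra_simps)
    moreover have "\<bar>F v - v powr p\<bar> \<le> \<delta> / 2 * v powr p"
      by (rule near) (use \<open>0 < v\<close> \<open>v \<le> c\<close> c(2) in auto)
    then have "\<bar>F v - v powr p\<bar> \<le> \<delta> / 2 * c powr p"
      by (rule order_trans) (use vp \<delta>(1) in \<open>auto intro: mult_left_mono\<close>)
    ultimately show ?thesis
      unfolding v_def by linarith
  qed
  from source_1_le[OF this] have "source 0 u 1 \<le> c powr p * (integral {0..1} b + A * \<delta>)"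
    by (simp add: algebra_simps)
  also have "\<dots> \<le> 0"
    using \<delta>(3) by (simp add: mult_nonneg_nonpos)
  finally show ?thesis .
qed

text \<open>Solutions for a small parameter are nearly constant, since their slopes are of the order of the
  parameter. Unless they are close to zero, \<open>F(u)\<close> is then nearly constant as well, and its integral
  against \<open>b\<close> cannot vanish.\<close>

lemma solution_small:
  assumes \<mu>: "0 \<le> \<mu>" "\<mu> * (A * B) \<le> 1 / 2" and u: "u = step \<mu> c 0 u" and J: "source 0 u 1 = 0"
    and \<delta>: "integral {0..1} b + A * \<delta> < 0"
    and nearly: "\<And>c. e \<le> c \<Longrightarrow> \<exists>K>0. \<forall>v. c - r \<le> v \<and> v \<le> c \<longrightarrow> \<bar>F v - K\<bar> \<le> \<delta> * K"
    and r: "2 * (\<mu> * (A * B)) \<le> r"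
  shows "c < e"
proof (rule ccontr)
  assume "\<not> c < e"
  then obtain K where "K > 0" and K: "\<And>v. c - r \<le> v \<Longrightarrow> v \<le> c \<Longrightarrow> \<bar>F v - K\<bar> \<le> \<delta> * K"
    using nearly[of c] by auto
  have "\<bar>F (C1_fun u x) - K\<bar> \<le> \<delta> * K" if "x \<in> {0..1}" for x
    using solution_ge[OF \<mu> u that F_le] solution_le[OF \<mu> u that] r by (intro K) auto
  from source_1_le[OF this] have "source 0 u 1 \<le> K * (integral {0..1} b + A * \<delta>)"
    by (simp add: algebra_simps)
  then show False
    using J mult_pos_neg[OF \<open>K > 0\<close> \<delta>] by simp
qed

lemma norm_solution_le:
  assumes \<mu>: "0 \<le> \<mu>" "\<mu> * (A * B) \<le> 1 / 2" and u: "u = step \<mu> c 0 u" and c: "0 \<le> c"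
  shows "norm u \<le> c + 4 * (\<mu> * (A * B))"
proof -
  have "norm u \<le> c + 2 * (2 * (\<mu> * (A * B)))"
  proof (rule norm_C1_le)
    show "\<bar>C1_fun u 0\<bar> \<le> c"
      using solution_0[OF \<mu> u] c by simp
    show "\<bar>C1_deriv u x\<bar> \<le> 2 * (\<mu> * (A * B))" if "x \<in> {0..1}" for x
      using solution_deriv_ge[OF \<mu> u that F_le] solution_deriv[OF \<mu> u that] slope_nonpos[of "- \<mu> * source 0 u x"]
      by auto
  qed
  then show ?thesis by simp
qed

end

section \<open>The asymptotics of the nonlinearity\<close>

lemma tendsto_quotient_near:
  assumes "((\<lambda>u. f u / u powr p) \<longlongrightarrow> (1::real)) (at_right 0)" "\<epsilon> > 0"
  shows "\<exists>v0>0. \<forall>v. 0 < v \<and> v \<le> v0 \<longrightarrow> \<bar>f v - v powr p\<bar> \<le> \<epsilon> * v powr p"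
proof -
  have "\<forall>\<^sub>F v in at_right 0. dist (f v / v powr p) 1 < \<epsilon>"
    by (rule tendstoD[OF assms])
  then obtain d where "d > 0" and d: "\<And>v. 0 < v \<Longrightarrow> v < d \<Longrightarrow> dist (f v / v powr p) 1 < \<epsilon>"
    by (auto simp: eventually_at_right_field)
  have "\<bar>f v - v powr p\<bar> \<le> \<epsilon> * v powr p" if "0 < v" "v \<le> d / 2" for v
  proof -
    have pos: "v powr p > 0"
      using that by simp
    have "\<bar>f v / v powr p - 1\<bar> * v powr p \<le> \<epsilon> * v powr p"
      using d[of v] that \<open>d > 0\<close> by (intro mult_right_mono) (auto simp: dist_real_def)
    moreover have "(f v / v powr p - 1) * v powr p = f v - v powr p"
      using pos by (simp add: field_simps)
    then have "\<bar>f v - v powr p\<bar> = \<bar>f v / v powr p - 1\<bar> * \<bar>v powr p\<bar>"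
      by (simp only: flip: abs_mult)
    ultimately show ?thesis by simp
  qed
  then show ?thesis
    using \<open>d > 0\<close> by (intro exI[of _ "d / 2"]) auto
qed

text \<open>On intervals of bounded length, a power is asymptotically constant at infinity in the relative
  sense.\<close>

lemma nearly_constant_at_infinity:
  fixes f :: "real \<Rightarrow> real"
  assumes lim: "((\<lambda>u. f u / u powr (- q)) \<longlongrightarrow> h) at_top" and "0 < h" "0 < q" "q < 1" "0 < \<delta>"
  shows "\<exists>R>0. \<forall>c\<ge>R. \<exists>K>0. \<forall>v. c - 1 \<le> v \<and> v \<le> c \<longrightarrow> \<bar>f v - K\<bar> \<le> \<delta> * K"
proof -
  define \<eta> where "\<eta> = min 1 (\<delta> / 3)"
  have \<eta>: "0 < \<eta>" "\<eta> \<le> 1" "3 * \<eta> \<le> \<delta>"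
    using \<open>0 < \<delta>\<close> by (auto simp: \<eta>_def)
  have "\<forall>\<^sub>F v in at_top. dist (f v / v powr (- q)) h < \<eta> * h"
    by (rule tendstoD[OF lim]) (use \<eta> \<open>0 < h\<close> in simp)
  then obtain R0 where R0: "\<And>v. R0 \<le> v \<Longrightarrow> dist (f v / v powr (- q)) h < \<eta> * h"
    by (auto simp: eventually_at_top_linorder)
  define R where "R = max R0 0 + 1 + 1 / \<eta>"
  have "R > 0"
    using \<eta> by (simp add: R_def add_pos_pos add_nonneg_pos)
  have "\<bar>f v - h * c powr (- q)\<bar> \<le> \<delta> * (h * c powr (- q))" if c: "R \<le> c" and v: "c - 1 \<le> v" "v \<le> c" for c v
  proof -
    have "0 < 1 / \<eta>"
      using \<eta>(1) by simp
    then have v0: "R0 \<le> v" "1 / \<eta> \<le> v" "0 < v"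
      using c v(1) max.cobounded1[of R0 0] max.cobounded2[of 0 R0] unfolding R_def by linarith+
    have "c / v \<le> 1 + \<eta>"
    proof -
      have "1 \<le> \<eta> * v"
        using v0(2) \<eta>(1) by (simp add: field_simps)
      then show ?thesis
        using v v0(3) by (simp add: field_simps)
    qed
    have "(c / v) powr q \<le> (c / v) powr 1"
      using v v0(3) \<open>q < 1\<close> by (intro powr_mono) auto
    then have ratio: "(c / v) powr q \<le> 1 + \<eta>"
      using \<open>c / v \<le> 1 + \<eta>\<close> v v0(3) by simp
    have "v powr (- q) = (c / v) powr q * c powr (- q)"
      using v v0(3) by (simp add: powr_divide powr_minus field_simps)
    then have up: "v powr (- q) \<le> (1 + \<eta>) * c powr (- q)"
      using ratio by (simp add: mult_right_mono)
    have low: "c powr (- q) \<le> v powr (- q)"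
      using v v0(3) \<open>0 < q\<close> by (intro powr_mono2') auto
    have "\<bar>f v / v powr (- q) - h\<bar> * v powr (- q) \<le> \<eta> * h * (2 * c powr (- q))"
    proof (rule mult_mono)
      show "v powr (- q) \<le> 2 * c powr (- q)"
        using up mult_right_mono[of "1 + \<eta>" 2 "c powr (- q)"] \<eta>(2) by simp
    qed (use R0[OF v0(1)] \<eta> \<open>0 < h\<close> in \<open>auto simp: dist_real_def\<close>)
    moreover have "(f v / v powr (- q) - h) * v powr (- q) = f v - h * v powr (- q)"
      using v0(3) by (simp add: field_simps)
    then have "\<bar>f v - h * v powr (- q)\<bar> = \<bar>f v / v powr (- q) - h\<bar> * \<bar>v powr (- q)\<bar>"
      by (simp only: flip: abs_mult)
    then have "\<bar>f v / v powr (- q) - h\<bar> * v powr (- q) = \<bar>f v - h * v powr (- q)\<bar>"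
      by simp
    moreover have "\<bar>h * v powr (- q) - h * c powr (- q)\<bar> \<le> h * (\<eta> * c powr (- q))"
      using mult_left_mono[OF low, of h] mult_left_mono[OF up, of h] \<open>0 < h\<close> by (simp add: algebra_simps)
    ultimately have "\<bar>f v - h * v powr (- q)\<bar> \<le> 2 * (\<eta> * (h * c powr (- q)))"
        "\<bar>h * v powr (- q) - h * c powr (- q)\<bar> \<le> \<eta> * (h * c powr (- q))"
      by (simp_all add: algebra_simps)
    then have "\<bar>f v - h * c powr (- q)\<bar> \<le> 3 * \<eta> * (h * c powr (- q))"
      by linarith
    also have "\<dots> \<le> \<delta> * (h * c powr (- q))"
      using \<eta>(3) \<open>0 < h\<close> by (intro mult_right_mono) auto
    finally show ?thesis .
  qed
  moreover have "0 < h * c powr (- q)" if "R \<le> c" for c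
    using that \<open>R > 0\<close> \<open>0 < h\<close> by simp
  ultimately show ?thesis
    using \<open>R > 0\<close> by blast
qed

lemma nearly_constant_compact:
  fixes f :: "real \<Rightarrow> real"
  assumes f: "continuous_on UNIV f" "\<And>u. 0 < u \<Longrightarrow> 0 < f u" and "0 < e" "0 < \<delta>"
  shows "\<exists>r>0. r < e \<and> (\<forall>c. e \<le> c \<and> c \<le> R \<longrightarrow> (\<forall>v. c - r \<le> v \<and> v \<le> c \<longrightarrow> \<bar>f v - f c\<bar> \<le> \<delta> * f c))"
proof (cases "e \<le> R")
  case True
  have cont: "continuous_on S f" for S
    using f(1) continuous_on_subset by blast
  obtain x where x: "x \<in> {e..R}" "\<And>c. c \<in> {e..R} \<Longrightarrow> f x \<le> f c"
    using continuous_attains_inf[OF _ _ cont, of "{e..R}"] True by auto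
  have "0 < \<delta> * f x"
    using x(1) f(2)[of x] \<open>0 < e\<close> \<open>0 < \<delta>\<close> by simp
  moreover have "uniformly_continuous_on {0..R} f"
    by (rule compact_uniformly_continuous[OF cont]) simp
  ultimately obtain d where "d > 0" and d: "\<And>s t. s \<in> {0..R} \<Longrightarrow> t \<in> {0..R} \<Longrightarrow> dist t s < d \<Longrightarrow> dist (f t) (f s) < \<delta> * f x"
    using uniformly_continuous_onE by metis
  define r where "r = min d e / 2"
  have r: "0 < r" "r < e" "r < d"
    using \<open>d > 0\<close> \<open>0 < e\<close> by (auto simp: r_def min_def)
  have "\<bar>f v - f c\<bar> \<le> \<delta> * f c" if c: "e \<le> c" "c \<le> R" and v: "c - r \<le> v" "v \<le> c" for c v
  proof -
    have "\<bar>f v - f c\<bar> \<le> \<delta> * f x"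
      using d[of c v] c v r \<open>0 < e\<close> by (auto simp: dist_real_def intro: less_imp_le)
    also have "\<dots> \<le> \<delta> * f c"
      using x(2)[of c] c \<open>0 < \<delta>\<close> by (intro mult_left_mono) auto
    finally show ?thesis .
  qed
  then show ?thesis
    using r by blast
next
  case False
  then show ?thesis
    using \<open>0 < e\<close> by (intro exI[of _ "e / 2"]) auto
qed

lemma nearly_constant:
  fixes f :: "real \<Rightarrow> real"
  assumes f: "continuous_on UNIV f" "\<And>u. 0 < u \<Longrightarrow> 0 < f u"
    and "((\<lambda>u. f u / u powr (- q)) \<longlongrightarrow> h) at_top" "0 < h" "0 < q" "q < 1" and "0 < e" "0 < \<delta>"
  shows "\<exists>r>0. r < e \<and> (\<forall>c\<ge>e. \<exists>K>0. \<forall>v. c - r \<le> v \<and> v \<le> c \<longrightarrow> \<bar>f v - K\<bar> \<le> \<delta> * K)"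
proof -
  obtain R where R: "\<And>c. R \<le> c \<Longrightarrow> \<exists>K>0. \<forall>v. c - 1 \<le> v \<and> v \<le> c \<longrightarrow> \<bar>f v - K\<bar> \<le> \<delta> * K"
    using nearly_constant_at_infinity[OF assms(3-6) \<open>0 < \<delta>\<close>] by blast
  obtain r where r: "0 < r" "r < e" "\<And>c v. e \<le> c \<Longrightarrow> c \<le> R \<Longrightarrow> c - r \<le> v \<Longrightarrow> v \<le> c \<Longrightarrow> \<bar>f v - f c\<bar> \<le> \<delta> * f c"
    using nearly_constant_compact[OF f \<open>0 < e\<close> \<open>0 < \<delta>\<close>, of R] by auto
  have "\<exists>K>0. \<forall>v. c - min r 1 \<le> v \<and> v \<le> c \<longrightarrow> \<bar>f v - K\<bar> \<le> \<delta> * K" if c: "e \<le> c" for c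
  proof (cases "c \<le> R")
    case True
    then show ?thesis
      using r c f(2)[of c] \<open>0 < e\<close> by (intro exI[of _ "f c"]) auto
  next
    case False
    then obtain K where "K > 0" "\<forall>v. c - 1 \<le> v \<and> v \<le> c \<longrightarrow> \<bar>f v - K\<bar> \<le> \<delta> * K"
      using R[of c] by auto
    then show ?thesis
      by (intro exI[of _ K]) auto
  qed
  then show ?thesis
    using r(1,2) by (intro exI[of _ "min r 1"]) auto
qed

lemma bounded_above_by_asymptotics:
  fixes f :: "real \<Rightarrow> real"
  assumes f: "continuous_on UNIV f"
    and lim: "((\<lambda>u. f u / u powr (- q)) \<longlongrightarrow> h) at_top" and "0 < q"
  shows "\<exists>B. \<forall>v\<ge>0. f v \<le> B"
proof -
  have "\<forall>\<^sub>F v in at_top. f v / v powr (- q) < h + 1"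
    by (rule order_tendstoD(2)[OF lim]) simp
  then obtain R0 where R0: "\<And>v. R0 \<le> v \<Longrightarrow> f v / v powr (- q) < h + 1"
    by (auto simp: eventually_at_top_linorder)
  define R where "R = max 1 R0"
  have R: "1 \<le> R" "R0 \<le> R"
    by (simp_all add: R_def)
  have "\<exists>x\<in>{0..R}. \<forall>y\<in>{0..R}. f y \<le> f x"
    by (rule continuous_attains_sup) (use R f continuous_on_subset in auto)
  then obtain x where x: "\<And>v. v \<in> {0..R} \<Longrightarrow> f v \<le> f x"
    by blast
  have "f v \<le> \<bar>h + 1\<bar>" if "R \<le> v" for v
  proof -
    have v: "1 \<le> v" "R0 \<le> v"
      using that R by auto
    then have "f v \<le> (h + 1) * v powr (- q)"
      using R0[of v] by (simp add: pos_divide_less_eq less_imp_le)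
    also have "\<dots> \<le> \<bar>h + 1\<bar> * 1"
    proof (rule mult_mono)
      show "v powr (- q) \<le> 1"
        using powr_mono[of "- q" 0 v] v(1) \<open>0 < q\<close> by simp
    qed auto
    finally show ?thesis by simp
  qed
  then have "f v \<le> max (f x) \<bar>h + 1\<bar>" if "0 \<le> v" for v
    using x[of v] that by (cases "R \<le> v") (auto simp: le_max_iff_disj)
  then show ?thesis by blast
qed

section \<open>The weight\<close>

lemma AE_leb01_iff: "(AE x in lebesgue_on {s<..<t}. P x) \<longleftrightarrow> (AE x in lebesgue. s < x \<and> x < t \<longrightarrow> P x)"
  for s t :: real
  by (subst AE_restrict_space_iff) auto

text \<open>Modifying the weight on a null set turns the almost everywhere bounds into bounds at every point,
  including \<open>0\<close>, \<open>z\<close> and \<open>1\<close>, where it is set to zero.\<close>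

lemma bounded_representative:
  assumes a: "a \<in> Linfty01" and z: "0 < z" "z < (1::real)"
    and pos: "AE x in lebesgue_on {0<..<z}. a x > 0" and neg: "AE x in lebesgue_on {z<..<1}. a x < 0"
  obtains b A where "bdd_meas b" "0 < A" "\<And>x. x \<in> {0..1} \<Longrightarrow> \<bar>b x\<bar> \<le> A"
    "\<And>x. x \<in> {0..z} \<Longrightarrow> 0 \<le> b x" "\<And>x. x \<in> {z..1} \<Longrightarrow> b x \<le> 0" "AE x in leb01. a x = b x"
proof -
  obtain A0 where A0: "AE x in leb01. \<bar>a x\<bar> \<le> A0" and a_meas: "a \<in> borel_measurable leb01"
    using a by (auto simp: Linfty01_def)
  define A where "A = max A0 1"
  define g where "g = (\<lambda>x. if x < z then max 0 (min A (a x)) else if z < x then min 0 (max (- A) (a x)) else 0)"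
  define b where "b = (\<lambda>x. if x \<in> {0<..<1} then g x else 0)"
  have id: "(\<lambda>x. x) \<in> borel_measurable leb01"
    by (intro measurable_restrict_space1 measurable_completion) simp
  have "g \<in> borel_measurable leb01"
    unfolding g_def
    by (intro measurable_If borel_measurable_max borel_measurable_min a_meas borel_measurable_const
        borel_measurable_less id)
  then have "b \<in> borel_measurable lebesgue"
    unfolding b_def by (subst borel_measurable_if) auto
  then have b_meas: "b \<in> borel_measurable (lebesgue_on {0..1})"
    by (rule measurable_restrict_space1)
  have b_le: "\<bar>b x\<bar> \<le> A" for x
    by (auto simp: b_def g_def A_def)
  have "AE x in lebesgue. x \<noteq> z"
    using AE_lborel_singleton[of z] by (rule AE_completion)
  then have "AE x in leb01. a x = b x"
    using pos neg A0 unfolding AE_leb01_iff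
  proof eventually_elim
    case (elim x)
    then show ?case
      using z by (auto simp: b_def g_def A_def)
  qed
  moreover have "bdd_meas b"
    using b_meas b_le by (auto simp: bdd_meas_def)
  moreover have "0 \<le> b x" if "x \<in> {0..z}" for x
    using that z by (auto simp: b_def g_def)
  moreover have "b x \<le> 0" if "x \<in> {z..1}" for x
    using that z by (auto simp: b_def g_def)
  moreover have "0 < A"
    by (simp add: A_def)
  ultimately show thesis
    using that b_le by blast
qed

lemma integral_pos_of_AE_pos:
  fixes b :: "real \<Rightarrow> real"
  assumes b: "bdd_meas b" and t: "0 < t" "t \<le> 1"
    and nonneg: "\<And>x. x \<in> {0..t} \<Longrightarrow> 0 \<le> b x" and pos: "AE x in lebesgue_on {0<..<t}. 0 < b x"
  shows "0 < integral {0..t} b"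
proof -
  let ?M = "lebesgue_on {0<..<t}"
  have "b \<in> borel_measurable ?M"
    by (rule measurable_restrict_mono[where A = "{0..1}"]) (use b t in \<open>auto simp: bdd_meas_def\<close>)
  obtain K where K: "\<forall>x\<in>{0..1}. \<bar>b x\<bar> \<le> K"
    using b by (auto simp: bdd_meas_def)
  have int: "integrable ?M b"
    by (rule measurable_bounded_by_integrable_imp_lebesgue_integrable[where g = "\<lambda>_. K"])
       (use K t \<open>b \<in> borel_measurable ?M\<close> in \<open>auto simp: integrable_restrict_space\<close>)
  have "integral {0..t} b = integral\<^sup>L ?M b"
    using lebesgue_integral_eq_integral[OF int] by (simp add: integral_open_interval_real)
  moreover have "AE x in ?M. 0 \<le> b x"
    using pos by eventually_elim simp
  then have "0 \<le> integral\<^sup>L ?M b" "integral\<^sup>L ?M b = 0 \<longleftrightarrow> (AE x in ?M. b x = 0)"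
    using integral_nonneg_AE[of b ?M] integral_nonneg_eq_0_iff_AE[OF int] by auto
  moreover have "\<not> (AE x in ?M. b x = 0)"
  proof
    assume "AE x in ?M. b x = 0"
    with pos have "AE x in ?M. False"
      by eventually_elim simp
    then have "AE x in lebesgue. x \<notin> {0<..<t}"
      by (simp add: AE_leb01_iff)
    then have "{0<..<t} \<in> null_sets lebesgue"
      by (subst AE_iff_null_sets) auto
    then have "emeasure lebesgue {0<..<t} = 0"
      by (rule null_setsD1)
    then show False
      using t by simp
  qed
  ultimately show ?thesis
    by simp
qed

section \<open>The component of the zero solution\<close>

theorem theorem4p2:
  fixes a f :: "real \<Rightarrow> real" and z h p q :: real
  assumes "a \<in> Linfty01"
    and "(\<integral>x. a x \<partial>leb01) < 0"
    and "0 < z" "z < 1"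
    and "AE x in lebesgue_on {0<..<z}. a x > 0"
    and "AE x in lebesgue_on {z<..<1}. a x < 0"
    and "continuous_on UNIV f"
    and "f 0 = 0"
    and "\<And>u. u > 0 \<Longrightarrow> f u > 0"
    and "h > 0" "0 < p" "p < 1" "0 < q" "q < 1"
    and "((\<lambda>u. f u / u powr p) \<longlongrightarrow> 1) (at_right 0)"
    and "((\<lambda>u. f u / u powr (- q)) \<longlongrightarrow> h) at_top"
  shows "\<exists>C \<in> components (S_r_plus a f).
    (\<exists>\<mu>s>0. {0..<\<mu>s} \<subseteq> fst ` C) \<and>
    (\<forall>\<epsilon>>0. \<exists>\<delta>>0. \<forall>(\<mu>, u)\<in>C. 0 < \<mu> \<and> \<mu> < \<delta> \<longrightarrow> norm u < \<epsilon>)"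
proof -
  obtain b A where b: "bdd_meas b" "0 < A" "\<And>x. x \<in> {0..1} \<Longrightarrow> \<bar>b x\<bar> \<le> A"
    "\<And>x. x \<in> {0..z} \<Longrightarrow> 0 \<le> b x" "\<And>x. x \<in> {z..1} \<Longrightarrow> b x \<le> 0" and ab: "AE x in leb01. a x = b x"
    by (rule bounded_representative[OF assms(1,3-6)]) blast
  define F where "F = (\<lambda>v. f (max v 0))"
  obtain B0 where B0: "\<And>v. 0 \<le> v \<Longrightarrow> f v \<le> B0"
    using bounded_above_by_asymptotics[OF assms(7,16,13)] by auto
  define B where "B = max B0 1"
  have fF: "F v = f v" if "0 \<le> v" for v
    using that by (simp add: F_def)
  have F_nonneg: "0 \<le> F v" for v
    using assms(8) assms(9)[of v] by (cases "v \<le> 0") (auto simp: F_def max_def)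
  have F_le: "F v \<le> B" for v
    using B0[of "max v 0"] by (simp add: F_def B_def le_max_iff_disj)
  have F_nonpos: "F v = 0" if "v \<le> 0" for v
    using that assms(8) by (simp add: F_def max_def)
  have F_cont: "continuous_on UNIV F"
    unfolding F_def by (rule continuous_on_compose2[OF assms(7)]) (auto intro!: continuous_intros)
  interpret sign_changing_problem b F A B z
    by unfold_locales (use b F_nonneg F_le F_nonpos F_cont assms(3,4) in auto)
  have "0 < B"
    by (simp add: B_def)
  define I where "I = integral {0..1} b"
  define I1 where "I1 = integral {0..z / 2} b"
  have "(\<integral>x. a x \<partial>leb01) = (\<integral>x. b x \<partial>leb01)"
    by (rule integral_cong_AE)
       (use assms(1) ab bdd_meas_integrable_leb01[OF b(1)] in \<open>auto simp: Linfty01_def\<close>)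
  then have "I < 0"
    using assms(2) bdd_meas_LINT[OF b(1)] by (simp add: I_def)
  have "0 < I1"
    unfolding I1_def
  proof (rule integral_pos_of_AE_pos[OF b(1)])
    show "AE x in lebesgue_on {0<..<z / 2}. 0 < b x"
      using assms(5) ab unfolding AE_leb01_iff by eventually_elim (use z in auto)
  qed (use z b(4) in auto)
  define \<delta> where "\<delta> = min 1 (- I / (2 * A))"
  have \<delta>: "0 < \<delta>" "\<delta> \<le> 1" "I + A * \<delta> < 0"
  proof -
    have "0 < - I / (2 * A)"
      using \<open>I < 0\<close> \<open>0 < A\<close> by (intro divide_pos_pos) auto
    then show "0 < \<delta>" "\<delta> \<le> 1"
      unfolding \<delta>_def by simp_all
    have "A * \<delta> \<le> A * (- I / (2 * A))"
      using \<open>0 < A\<close> by (intro mult_left_mono) (auto simp: \<delta>_def)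
    then show "I + A * \<delta> < 0"
      using \<open>0 < A\<close> \<open>I < 0\<close> by simp
  qed

  \<comment> \<open>The limit holds along all positive solutions, not only along a component.\<close>
  have small: "\<exists>d>0. \<forall>(\<mu>, u)\<in>S_r_plus a f. 0 < \<mu> \<and> \<mu> < d \<longrightarrow> norm u < \<epsilon>" if "\<epsilon> > 0" for \<epsilon>
  proof -
    obtain r where r: "0 < r" "r < \<epsilon> / 2"
      and near: "\<And>c. \<epsilon> / 2 \<le> c \<Longrightarrow> \<exists>K>0. \<forall>v. c - r \<le> v \<and> v \<le> c \<longrightarrow> \<bar>f v - K\<bar> \<le> \<delta> * K"
      using nearly_constant[OF assms(7,9,16,10,13,14), of "\<epsilon> / 2" \<delta>] \<delta>(1) \<open>\<epsilon> > 0\<close> by auto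
    have nearF: "\<exists>K>0. \<forall>v. c - r \<le> v \<and> v \<le> c \<longrightarrow> \<bar>F v - K\<bar> \<le> \<delta> * K" if c: "\<epsilon> / 2 \<le> c" for c
    proof -
      obtain K where "K > 0" "\<And>v. c - r \<le> v \<Longrightarrow> v \<le> c \<Longrightarrow> \<bar>f v - K\<bar> \<le> \<delta> * K"
        using near[OF c] by auto
      moreover have "F v = f v" if "c - r \<le> v" for v
        using that c r by (intro fF) auto
      ultimately show ?thesis by (intro exI[of _ K]) auto
    qed
    define d where "d = min (1 / 2) (min (r / 2) (\<epsilon> / 8)) / (A * B)"
    have "A * B > 0"
      using \<open>0 < A\<close> \<open>0 < B\<close> by simp
    have "norm u < \<epsilon>" if S: "(\<mu>, u) \<in> S_r_plus a f" and \<mu>: "0 < \<mu>" "\<mu> < d" for \<mu> u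
    proof (cases "u = 0")
      case False
      then have u: "regular_solution a f \<mu> u" "positive_C1 u"
        using S by (auto simp: S_r_plus_def)
      have "\<mu> * (A * B) < min (1 / 2) (min (r / 2) (\<epsilon> / 8))"
        using \<mu>(2) \<open>A * B > 0\<close> by (simp add: d_def pos_less_divide_eq)
      then have le: "\<mu> * (A * B) \<le> 1 / 2" "2 * (\<mu> * (A * B)) \<le> r" "\<mu> * (A * B) < \<epsilon> / 8"
        by auto
      note step = step_of_regular_solution[OF ab fF \<mu>(1) le(1) u]
      have "C1_fun u 0 < \<epsilon> / 2"
        by (rule solution_small[OF _ le(1) step(2,3) _ nearF le(2)]) (use \<mu>(1) \<delta>(3) in \<open>auto simp: I_def\<close>)
      moreover have "norm u \<le> C1_fun u 0 + 4 * (\<mu> * (A * B))"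
        by (rule norm_solution_le[OF _ le(1) step(2)]) (use \<mu>(1) step(1) in auto)
      ultimately show ?thesis
        using le(3) by linarith
    qed (use \<open>\<epsilon> > 0\<close> in simp)
    moreover have "d > 0"
      using r \<open>\<epsilon> > 0\<close> \<open>A * B > 0\<close> by (simp add: d_def)
    ultimately show ?thesis
      by (intro exI[of _ d]) auto
  qed

  obtain v0 where "v0 > 0" and near: "\<And>v. 0 < v \<Longrightarrow> v \<le> v0 \<Longrightarrow> \<bar>f v - v powr p\<bar> \<le> \<delta> / 2 * v powr p"
    using tendsto_quotient_near[OF assms(15), of "\<delta> / 2"] \<delta>(1) by auto
  have nearF: "\<bar>F v - v powr p\<bar> \<le> \<delta> / 2 * v powr p" if "0 < v" "v \<le> v0" for v
    using near[OF that] fF[of v] that by simp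
  have half: "v powr p / 2 \<le> F v" if "0 < v" "v \<le> v0" for v
  proof -
    have "\<delta> / 2 * v powr p \<le> 1 / 2 * v powr p"
      using \<delta>(2) by (intro mult_right_mono) auto
    then show ?thesis
      using nearF[OF that] by linarith
  qed
  define \<kappa> where "\<kappa> = 1 / (1 - p)"
  have \<kappa>: "0 < \<kappa>" "\<kappa> * (1 - p) = 1"
    using assms(12) by (auto simp: \<kappa>_def)
  \<comment> \<open>The source integral is nonnegative for \<open>s = m\<close> and nonpositive for \<open>s = M\<close>.
    The bound \<open>L\<close> keeps the flux in \<open>[-1/2, 0]\<close> and the initial values in the range
    \<open>(0, v0]\<close> where \<open>F\<close> is close to the power.\<close>
  define m where "m = (z / 8 * I1) powr \<kappa>"
  define M where "M = max m ((8 * A / \<delta>) powr \<kappa>)"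
  define L where "L = min (1 / 2 / (A * B)) ((v0 / M) powr (1 - p))"
  define \<gamma> where "\<gamma> = (\<lambda>\<mu>::real. \<mu> powr \<kappa>)"
  have m: "0 < m" "m powr (1 - p) = z / 8 * I1"
    using z \<open>0 < I1\<close> \<kappa>(2) by (auto simp: m_def powr_powr)
  have M: "m \<le> M" "0 < M" "8 * A / \<delta> \<le> M powr (1 - p)"
  proof -
    show "m \<le> M" "0 < M"
      using m(1) by (auto simp: M_def)
    have "8 * A / \<delta> = ((8 * A / \<delta>) powr \<kappa>) powr (1 - p)"
      using \<kappa>(2) \<open>0 < A\<close> \<delta>(1) by (simp add: powr_powr)
    also have "\<dots> \<le> M powr (1 - p)"
      using assms(12) by (intro powr_mono2) (auto simp: M_def)
    finally show "8 * A / \<delta> \<le> M powr (1 - p)" .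
  qed
  have "0 < L"
    using \<open>0 < A\<close> \<open>0 < B\<close> \<open>v0 > 0\<close> M(2) by (simp add: L_def)
  have \<mu>_le: "\<mu> * (A * B) \<le> 1 / 2" if "\<mu> \<le> L" for \<mu>
    using that \<open>0 < A\<close> \<open>0 < B\<close> by (simp add: L_def pos_le_divide_eq)
  have c: "0 < s * \<gamma> \<mu>" "s * \<gamma> \<mu> \<le> v0" "(s * \<gamma> \<mu>) powr (1 - p) = s powr (1 - p) * \<mu>"
    if "0 < \<mu>" "\<mu> \<le> L" "0 < s" "s \<le> M" for \<mu> s
  proof -
    show "0 < s * \<gamma> \<mu>"
      using that by (simp add: \<gamma>_def)
    have "\<gamma> \<mu> \<le> ((v0 / M) powr (1 - p)) powr \<kappa>"
      unfolding \<gamma>_def using that \<kappa>(1) by (intro powr_mono2) (auto simp: L_def)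
    also have "\<dots> = v0 / M"
      using \<open>v0 > 0\<close> M(2) \<kappa>(2) by (simp add: powr_powr mult.commute)
    finally have "s * \<gamma> \<mu> \<le> M * (v0 / M)"
      using that M(2) by (intro mult_mono) (auto simp: \<gamma>_def)
    then show "s * \<gamma> \<mu> \<le> v0"
      using M(2) by simp
    show "(s * \<gamma> \<mu>) powr (1 - p) = s powr (1 - p) * \<mu>"
      using that \<kappa>(2) by (simp add: \<gamma>_def powr_mult powr_powr)
  qed
  have "\<exists>C. connected C \<and> C \<subseteq> branch \<gamma> m M L \<and> (0, 0) \<in> C \<and> (\<exists>q\<in>C. fst q = L)"
  proof (rule branch_continuum[OF \<open>0 < L\<close> M(1)])
    show "F 0 = 0"
      by (rule F_nonpos) simp
    show "continuous_on {0..L} \<gamma>"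
      unfolding \<gamma>_def using \<kappa>(1) by (intro continuous_on_powr' continuous_intros) auto
    show "\<gamma> 0 = 0"
      by (simp add: \<gamma>_def)
    show "0 \<le> source 0 u 1" if \<mu>: "0 < \<mu>" "\<mu> \<le> L" and u: "u = step \<mu> (m * \<gamma> \<mu>) 0 u" for \<mu> u
      by (rule source_1_nonneg_bottom[OF _ \<mu>_le[OF \<mu>(2)] u assms(11,12) half])
         (use \<mu> m c[OF \<mu> m(1) M(1)] in \<open>auto simp: I1_def\<close>)
    show "source 0 u 1 \<le> 0" if \<mu>: "0 < \<mu>" "\<mu> \<le> L" and u: "u = step \<mu> (M * \<gamma> \<mu>) 0 u" for \<mu> u
    proof (rule source_1_nonpos_top[OF _ \<mu>_le[OF \<mu>(2)] u assms(11,12) \<delta>(1,2) _ nearF])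
      have "8 * A \<le> \<delta> * M powr (1 - p)"
        using M(3) \<delta>(1) by (simp add: pos_divide_le_eq mult.commute)
      from mult_right_mono[OF this, of \<mu>] show "8 * A * \<mu> \<le> \<delta> * (M * \<gamma> \<mu>) powr (1 - p)"
        using \<mu> c(3)[OF \<mu> M(2)] by (simp add: mult.assoc)
    qed (use \<mu> c(1,2)[OF \<mu> M(2)] \<delta>(3) in \<open>auto simp: I_def\<close>)
  qed
  then obtain C where C: "connected C" "C \<subseteq> branch \<gamma> m M L" "(0, 0) \<in> C" "\<exists>q\<in>C. fst q = L"
    by blast
  have sub: "branch \<gamma> m M L \<subseteq> S_r_plus a f"
  proof
    fix q assume "q \<in> branch \<gamma> m M L"
    then obtain \<mu> u s where q: "q = (\<mu>, u)" "0 \<le> \<mu>" "\<mu> \<le> L" "m \<le> s" "s \<le> M"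
      "u = step \<mu> (s * \<gamma> \<mu>) 0 u" "source 0 u 1 = 0"
      by (auto simp: branch_def)
    show "q \<in> S_r_plus a f"
    proof (cases "\<mu> = 0")
      case True
      then have "u = step 0 0 0 u"
        using q(6) by (simp add: \<gamma>_def)
      then have "u = 0"
        by (rule solution_parameter_0(1)[OF F_nonpos[OF order_refl]])
      then show ?thesis
        using True q(1) by (simp add: S_r_plus_def)
    next
      case False
      then have "0 < s * \<gamma> \<mu>"
        using c(1)[of \<mu> s] q m(1) by auto
      from regular_solution_of_step[OF ab fF q(2) \<mu>_le[OF q(3)] q(6,7) this]
      show ?thesis
        using q(1,2) by (simp add: S_r_plus_def)
    qed
  qed
  have "(0, 0) \<in> S_r_plus a f"
    by (simp add: S_r_plus_def)
  then have comp: "connected_component_set (S_r_plus a f) (0, 0) \<in> components (S_r_plus a f)"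
    by (rule componentsI)
  have CC: "C \<subseteq> connected_component_set (S_r_plus a f) (0, 0)"
    by (rule connected_component_maximal) (use C sub in auto)
  have "connected (fst ` C)"
    by (intro connected_continuous_image C(1) continuous_intros)
  moreover have "0 \<in> fst ` C" "L \<in> fst ` C"
    using C(3,4) by force+
  ultimately have "{0..L} \<subseteq> fst ` C"
    by (rule connected_contains_Icc)
  then have "{0..<L} \<subseteq> fst ` connected_component_set (S_r_plus a f) (0, 0)"
    using CC by force
  moreover have "\<exists>d>0. \<forall>(\<mu>, u)\<in>connected_component_set (S_r_plus a f) (0, 0). 0 < \<mu> \<and> \<mu> < d \<longrightarrow> norm u < \<epsilon>"
    if "\<epsilon> > 0" for \<epsilon>
    using small[OF that] connected_component_subset[of "S_r_plus a f" "(0, 0)"] by (meson subsetD)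
  ultimately show ?thesis
    using comp \<open>0 < L\<close> by blast
qed

end
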